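(* Let $n\ge3$ and $S\subseteq\{1,\dots,n\}$ with $|S|\ge3$. Let $I_1,I_2,I_3$ be three non-empty subsets of $S$ such that $I_1\cup I_2\cup I_3=S$ and $I_1<I_2<I_3$. The element of $\mathfrak{aw}(n)$ $$\omega_S=\sum_{I\subseteq I_1,\ J\subseteq I_2,\ K\subseteq I_3}(-1)^{|S|-|I|-|J|-|K|}\,\varOmega_{I,J,K}$$ is well defined, in the sense that it does not depend on the choice of $I_1,I_2,I_3$.
   Context: Base field $\mathbb{C}(q)$, $q$ an indeterminate. $[A,B]=AB-BA$, $[A,B]_q=\frac{1}{q-q^{-1}}(qAB-q^{-1}BA)$. For $I,J\subseteq\{1,\dots,n\}$, $I<J$ means every element of $I$ is strictly smaller than every element of $J$. A connected subset is a non-empty set of consecutive integers. Two disjoint connected subsets are adjacent if their union is connected. A sequence $(I_1,\dots,I_k)$ of connected subsets is monotonic if $I_1<\dots<I_k$ or $I_1>\dots>I_k$; it is a monotonic sequence of adjacent subsets if moreover $I_j,I_{j+1}$ are adjacent for all $j$. Elements: $C_I$ for $I\subseteq\{1,\dots,n\}$ connected; $C_\varnothing:=1$. Adjacent sets in an index are merged (e.g. $C_{I_1I_2}=C_{I_2I_1}:=C_{I_1\cup I_2}$ if $I_1,I_2$ are adjacent; $C_{I_1I_3I_4}$ with $I_3,I_4$ adjacent means $C_{I_1(I_3\cup I_4)}$); empty sets are dropped. For a monotonic sequence $(I_1,\dots,I_k)$, $k\ge2$, of connected subsets with non-empty holes $H_a$ (the set of integers strictly between $I_a$ and $I_{a+1}$),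 define recursively on $k$, for any choice of $a\in\{1,\dots,k-1\}$ (the result does not depend on $a$; one may take $a=1$), $$C_{I_1\dots I_k}:=-[C_{I_1\dots I_aH_a},C_{H_aI_{a+1}\dots I_k}]_q+C_{I_1\dots I_a}C_{I_{a+1}\dots I_k}+C_{H_a}C_{I_1\dots I_aH_aI_{a+1}\dots I_k}.$$ For $k=2$ this reads $C_{I_1I_2}=-[C_{I_1H},C_{HI_2}]_q+C_{I_1}C_{I_2}+C_HC_{I_1HI_2}$, with $H$ the hole between $I_1$ and $I_2$. The algebra $\mathfrak{aw}(n)$ is the unital associative algebra generated by the $C_I$, $I$ a connected subset of $\{1,\dots,n\}$, with relations: (i) $[C_I,C_J]=0$ for connected $I,J$ with $I\cap J=\varnothing$ or $I\subset J$; (ii) $C_{I_1I_2}=-[C_{I_2I_3},C_{I_1I_3}]_q+C_{I_1}C_{I_2}+C_{I_3}C_{I_1I_2I_3}$ for every monotonic sequence $(I_1,I_2,I_3)$ of adjacent connected subsets; (iii) $C_{I_1I_4}=-[C_{I_1I_3},C_{I_3I_4}]_q+C_{I_1}C_{I_4}+C_{I_3}C_{I_1I_3I_4}$ for every monotonic sequence $(I_1,I_2,I_3,I_4)$ of adjacent connected subsets. For an arbitrary subset $S\subseteq\{1,\dots,n\}$ with maximal connected components $S_1<\dots<S_k$, write $C_S:=C_{S_1\dots S_k}$ (increasing order). For subsets $I_1<I_2<I_3$ (arbitrary, possibly empty or not connected, not necessarily adjacent), write $C_{I_1I_2}=C_{I_1\cup I_2}$ etc., and set $$\begin{aligned}\varOmega_{I_1,I_2,I_3}={}&qC_{I_1I_2}C_{I_2I_3}C_{I_1I_3}+\frac{q^2C_{I_1I_2}^2+q^{-2}C_{I_2I_3}^2+q^2C_{I_1I_3}^2+C_{I_1I_2I_3}^2+C_{I_1}^2+C_{I_2}^2+C_{I_3}^2}{q+q^{-1}}\\&-qC_{I_1I_2}(C_{I_1}C_{I_2}+C_{I_3}C_{I_1I_2I_3})-q^{-1}C_{I_2I_3}(C_{I_2}C_{I_3}+C_{I_1}C_{I_1I_2I_3})\\&-qC_{I_1I_3}(C_{I_1}C_{I_3}+C_{I_2}C_{I_1I_2I_3})+(q+q^{-1})C_{I_1}C_{I_2}C_{I_3}C_{I_1I_2I_3}-\frac{1}{q+q^{-1}},\end{aligned}$$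 which is $0$ if one of the $I_j$ is empty. *)

theory Defs
  imports
    Complex_Main
    "HOL-Library.Poly_Mapping"
    "HOL-Library.Cardinality"
    "HOL-Computational_Algebra.Polynomial"
    "HOL-Computational_Algebra.Fraction_Field"
begin

section \<open>Algebras over the field of rational functions\<close>

type_synonym ratfun = "complex poly fract"

definition q :: ratfun
  where "q = Fract [:0, 1:] 1"

class ratfun_algebra = ring_1 +
  fixes scaleQ :: "ratfun \<Rightarrow> 'a \<Rightarrow> 'a" (infixr "*\<^sub>Q" 75)
  assumes scaleQ_add_right: "a *\<^sub>Q (x + y) = a *\<^sub>Q x + a *\<^sub>Q y"
    and scaleQ_add_left: "(a + b) *\<^sub>Q x = a *\<^sub>Q x + b *\<^sub>Q x"
    and scaleQ_scaleQ: "a *\<^sub>Q b *\<^sub>Q x = (a * b) *\<^sub>Q x"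
    and scaleQ_one: "1 *\<^sub>Q x = x"
    and mult_scaleQ_left: "(a *\<^sub>Q x) * y = a *\<^sub>Q (x * y)"
    and mult_scaleQ_right: "x * (a *\<^sub>Q y) = a *\<^sub>Q (x * y)"

definition comm :: "'a::ring_1 \<Rightarrow> 'a \<Rightarrow> 'a"
  where "comm A B = A * B - B * A"

definition qcomm :: "'a::ratfun_algebra \<Rightarrow> 'a \<Rightarrow> 'a"
  where "qcomm A B =
    (1 / (q - inverse q)) *\<^sub>Q (q *\<^sub>Q (A * B) - inverse q *\<^sub>Q (B * A))"


section \<open>Subsets of the integers\<close>

definition conn :: "nat set \<Rightarrow> bool"
  where "conn I \<longleftrightarrow> (\<exists>a b. a \<le> b \<and> I = {a..b})"

definition set_less :: "nat set \<Rightarrow> nat set \<Rightarrow> bool" (infix "\<prec>" 50)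
  where "I \<prec> J \<longleftrightarrow> (\<forall>x\<in>I. \<forall>y\<in>J. x < y)"

definition adjacent :: "nat set \<Rightarrow> nat set \<Rightarrow> bool"
  where "adjacent I J \<longleftrightarrow> conn I \<and> conn J \<and> I \<inter> J = {} \<and> conn (I \<union> J)"

definition monotonic :: "nat set list \<Rightarrow> bool"
  where "monotonic Is \<longleftrightarrow> successively (\<prec>) Is \<or> successively (\<lambda>I J. J \<prec> I) Is"

definition monotonic_adjacent :: "nat \<Rightarrow> nat set list \<Rightarrow> bool"
  where "monotonic_adjacent n Is \<longleftrightarrow>
    (\<forall>I\<in>set Is. conn I \<and> I \<subseteq> {1..n}) \<and> monotonic Is \<and> successively adjacent Is"

definition hole :: "nat set \<Rightarrow> nat set \<Rightarrow> nat set"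
  where "hole I J =
    {x. (\<forall>i\<in>I. \<forall>j\<in>J. i < x \<and> x < j) \<or> (\<forall>i\<in>I. \<forall>j\<in>J. j < x \<and> x < i)}"

definition components :: "nat set \<Rightarrow> nat set set"
  where "components S =
    {I. conn I \<and> I \<subseteq> S \<and> (\<forall>J. conn J \<and> I \<subseteq> J \<and> J \<subseteq> S \<longrightarrow> J = I)}"

definition component_list :: "nat set \<Rightarrow> nat set list"
  where "component_list S = (THE Is. sorted_wrt (\<prec>) Is \<and> set Is = components S)"

lemma components_less:
  assumes "I \<in> components S" "J \<in> components S" "I \<noteq> J" "Min I \<le> Min J"
  shows "I \<prec> J"
proof -
  from assms obtain a b where I: "I = {a..b}" "a \<le> b"
    by (auto simp: components_def conn_def)
  from assms obtain c d where J: "J = {c..d}" "c \<le> d"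
    by (auto simp: components_def conn_def)
  have "Min I = a" "Min J = c"
    using I J by (auto intro!: Min_eqI)
  then have "a \<le> c"
    using assms by simp
  have "b < c"
  proof (rule ccontr)
    assume "\<not> b < c"
    then have un: "I \<union> J = {a..max b d}"
      using I J \<open>a \<le> c\<close> by auto
    then have "conn (I \<union> J)"
      unfolding conn_def using I by (intro exI[of _ a] exI[of _ "max b d"]) simp
    moreover have "I \<union> J \<subseteq> S"
      using assms by (auto simp: components_def)
    ultimately have "I \<union> J = I" "I \<union> J = J"
      using assms(1,2) unfolding components_def by blast+
    then show False
      using assms(3) by simp
  qed
  then show ?thesis
    using I J by (auto simp: set_less_def)
qed

lemma component_list:
  assumes "finite S"
  shows "sorted_wrt (\<prec>) (component_list S) \<and> set (component_list S) = components S"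
proof -
  have "finite (components S)"
    by (rule finite_subset[of _ "Pow S"]) (use assms in \<open>auto simp: components_def\<close>)
  then obtain xs where xs: "set xs = components S" "distinct xs"
    using finite_distinct_list by blast
  define ys where "ys = sort_key Min xs"
  have ys: "set ys = components S" "distinct ys" "sorted (map Min ys)"
    using xs by (auto simp: ys_def)
  have "sorted_wrt (\<prec>) ys"
    unfolding sorted_wrt_iff_nth_less
  proof (intro allI impI)
    fix i j assume ij: "i < j" "j < length ys"
    then have "Min (ys ! i) \<le> Min (ys ! j)"
      using ys(3) by (auto simp: sorted_iff_nth_mono)
    moreover have "ys ! i \<noteq> ys ! j"
      using ij ys(2) by (simp add: nth_eq_iff_index_eq)
    moreover have "ys ! i \<in> components S" "ys ! j \<in> components S"
      using ij ys(1) nth_mem by fastforce+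
    ultimately show "ys ! i \<prec> ys ! j"
      by (blast intro: components_less)
  qed
  moreover have "us = vs"
    if "sorted_wrt (\<prec>) us" "sorted_wrt (\<prec>) vs" "set us = set vs" "{} \<notin> set vs" for us vs
    using that
  proof (induction us arbitrary: vs)
    case (Cons u us)
    then obtain v vs' where vs: "vs = v # vs'"
      by (cases vs) auto
    have asym: "\<not> y \<prec> x" if "x \<in> set vs" "y \<in> set vs" "x \<prec> y" for x y
    proof -
      from that Cons.prems(4) obtain a b where "a \<in> x" "b \<in> y"
        by (metis equals0I)
      with that(3) show ?thesis
        by (meson less_asym set_less_def)
    qed
    have u: "u \<in> set vs" "\<And>x. x \<in> set us \<Longrightarrow> u \<prec> x"
      and v: "v \<in> set vs" "\<And>x. x \<in> set vs' \<Longrightarrow> v \<prec> x"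
      and sets: "insert u (set us) = insert v (set vs')" "set vs = insert v (set vs')"
      using Cons.prems(1,2,3) vs by auto
    have "u = v"
      using asym[OF u(1) v(1)] u(2)[of v] v(2)[of u] sets by blast
    moreover have "u \<notin> set us" "v \<notin> set vs'"
      using asym[OF u(1) u(1)] asym[OF v(1) v(1)] u(2)[of u] v(2)[of v] by blast+
    ultimately have "set us = set vs'"
      using sets by (metis insert_ident)
    then have "us = vs'"
      using Cons.prems(1,2,4) vs by (intro Cons.IH) auto
    then show ?case
      using vs \<open>u = v\<close> by simp
  qed simp
  moreover have "{} \<notin> components S"
    by (auto simp: components_def conn_def)
  ultimately have "\<exists>!Is. sorted_wrt (\<prec>) Is \<and> set Is = components S"
    using ys(1) by metis
  then show ?thesis
    unfolding component_list_def by (rule theI')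
qed


section \<open>The elements indexed by sequences of connected subsets\<close>

text \<open>
  The recursion is the case \<open>a = 1\<close> of the defining one. The argument \<open>c\<close> provides the
  elements attached to connected subsets. Neighbouring adjacent entries are merged, and
  \<open>Cseq c\<close> is only meaningful on monotonic sequences.
\<close>

fun Cseq :: "(nat set \<Rightarrow> 'a::ratfun_algebra) \<Rightarrow> nat set list \<Rightarrow> 'a"
  where
    "Cseq c [] = 1"
  | "Cseq c [I] = c I"
  | "Cseq c (I # J # Is) =
      (let H = hole I J in
       if H = {} then Cseq c ((I \<union> J) # Is)
       else - qcomm (c (I \<union> H)) (Cseq c ((H \<union> J) # Is))
            + c I * Cseq c (J # Is)
            + c H * Cseq c ((I \<union> H \<union> J) # Is))"


section \<open>Free algebras\<close>

text \<open>Scalars are to be treated as atomic by lifting and transfer.\<close>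

lifting_forget fract.lifting
lifting_forget poly.lifting

datatype 'g word = Word (letters: "'g list")

instantiation word :: (type) monoid_add
begin

definition zero_word :: "'a word"
  where "0 = Word []"

definition plus_word :: "'a word \<Rightarrow> 'a word \<Rightarrow> 'a word"
  where "u + v = Word (letters u @ letters v)"

instance
  by standard (auto simp: zero_word_def plus_word_def)

end

lemma plus_word_eq_0_iff: "u + v = 0 \<longleftrightarrow> u = 0 \<and> v = (0 :: 'g word)"
  by (cases u; cases v) (auto simp: zero_word_def plus_word_def)

typedef 'g free_algebra = "UNIV :: ('g word \<Rightarrow>\<^sub>0 ratfun) set"
  by simp

setup_lifting type_definition_free_algebra

lemma single_0_commute:
  fixes p :: "'g::monoid_add \<Rightarrow>\<^sub>0 'k::comm_semiring_0"
  shows "Poly_Mapping.single 0 c * p = p * Poly_Mapping.single 0 c"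
proof -
  have "Poly_Mapping.lookup (Poly_Mapping.single 0 c * p) k =
      Poly_Mapping.lookup (p * Poly_Mapping.single 0 c) k" for k
  proof -
    have 1: "(\<Sum>v. Poly_Mapping.lookup p v when k = 0 + v) = Poly_Mapping.lookup p k"
      by simp
    have 2: "(\<Sum>l. Poly_Mapping.lookup (Poly_Mapping.single 0 c) l
        * (\<Sum>v. Poly_Mapping.lookup p v when k = l + v)) = c * Poly_Mapping.lookup p k"
    proof -
      have "(\<Sum>l. Poly_Mapping.lookup (Poly_Mapping.single 0 c) l
          * (\<Sum>v. Poly_Mapping.lookup p v when k = l + v)) =
        (\<Sum>l. c * Poly_Mapping.lookup p k when l = (0 :: 'g))"
        by (rule Sum_any.cong) (auto simp: lookup_single when_def)
      then show ?thesis by simp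
    qed
    have 3: "(\<Sum>v. Poly_Mapping.lookup (Poly_Mapping.single 0 c) v when k = l + v) =
        (c when l = k)" for l
    proof -
      have "(\<Sum>v. Poly_Mapping.lookup (Poly_Mapping.single 0 c) v when k = l + v) =
          (\<Sum>v. (c when l = k) when v = (0 :: 'g))"
        by (rule Sum_any.cong) (auto simp: lookup_single when_def)
      then show ?thesis by simp
    qed
    have "(\<Sum>l. Poly_Mapping.lookup p l
        * (\<Sum>v. Poly_Mapping.lookup (Poly_Mapping.single 0 c) v when k = l + v)) =
        (\<Sum>l. Poly_Mapping.lookup p k * c when l = k)"
      unfolding 3 by (rule Sum_any.cong) (auto simp: when_def)
    then show ?thesis
      by (simp add: lookup_mult 2 mult.commute)
  qed
  then show ?thesis
    by (intro poly_mapping_eqI)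
qed

instantiation free_algebra :: (type) ratfun_algebra
begin

lift_definition zero_free_algebra :: "'a free_algebra" is 0 .
lift_definition one_free_algebra :: "'a free_algebra" is 1 .
lift_definition plus_free_algebra :: "'a free_algebra \<Rightarrow> 'a free_algebra \<Rightarrow> 'a free_algebra"
  is "(+)" .
lift_definition minus_free_algebra :: "'a free_algebra \<Rightarrow> 'a free_algebra \<Rightarrow> 'a free_algebra"
  is "(-)" .
lift_definition uminus_free_algebra :: "'a free_algebra \<Rightarrow> 'a free_algebra" is uminus .
lift_definition times_free_algebra :: "'a free_algebra \<Rightarrow> 'a free_algebra \<Rightarrow> 'a free_algebra"
  is "(*)" .
lift_definition scaleQ_free_algebra :: "ratfun \<Rightarrow> 'a free_algebra \<Rightarrow> 'a free_algebra"
  is "\<lambda>a p. Poly_Mapping.single 0 a * p" .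

instance
proof
  fix a b :: ratfun and x y z :: "'a free_algebra"
  show "x + y + z = x + (y + z)" by transfer (rule add.assoc)
  show "x + y = y + x" by transfer (rule add.commute)
  show "0 + x = x" by transfer simp
  show "- x + x = 0" by transfer simp
  show "x - y = x + - y" by transfer simp
  show "x * y * z = x * (y * z)" by transfer (rule mult.assoc)
  show "(x + y) * z = x * z + y * z" by transfer (rule distrib_right)
  show "x * (y + z) = x * y + x * z" by transfer (rule distrib_left)
  show "1 * x = x" by transfer simp
  show "x * 1 = x" by transfer simp
  show "(0 :: 'a free_algebra) \<noteq> 1" by transfer simp
  show "a *\<^sub>Q (x + y) = a *\<^sub>Q x + a *\<^sub>Q y" by transfer (rule distrib_left)
  show "(a + b) *\<^sub>Q x = a *\<^sub>Q x + b *\<^sub>Q x"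
    by transfer (simp only: single_add distrib_right)
  show "a *\<^sub>Q b *\<^sub>Q x = (a * b) *\<^sub>Q x"
    by transfer (simp only: mult_single mult.assoc[symmetric] add_0_left)
  show "1 *\<^sub>Q x = x" by transfer simp
  show "(a *\<^sub>Q x) * y = a *\<^sub>Q (x * y)" by transfer (rule mult.assoc)
  show "x * (a *\<^sub>Q y) = a *\<^sub>Q (x * y)"
  proof transfer
    fix x y :: "'a word \<Rightarrow>\<^sub>0 ratfun" and a :: ratfun
    have "x * (Poly_Mapping.single 0 a * y) = (x * Poly_Mapping.single 0 a) * y"
      by (rule mult.assoc[symmetric])
    also have "\<dots> = Poly_Mapping.single 0 a * x * y"
      by (rule arg_cong[OF single_0_commute[symmetric]])
    finally show "x * (Poly_Mapping.single 0 a * y) = Poly_Mapping.single 0 a * (x * y)"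
      by (simp only: mult.assoc)
  qed
qed

end

lift_definition free_gen :: "'g \<Rightarrow> 'g free_algebra"
  is "\<lambda>g. Poly_Mapping.single (Word [g]) 1" .


section \<open>The algebra $\mathfrak{aw}(n)$\<close>

text \<open>The number $n$ is the cardinality of the index type \<open>'n\<close>.\<close>

typedef ('n::finite) conn_subset = "{I. conn I \<and> I \<subseteq> {1..CARD('n)}}"
proof -
  have "1 \<le> CARD('n)"
    using zero_less_card_finite[where 'a='n] by linarith
  then have "{1} \<in> {I. conn I \<and> I \<subseteq> {1..CARD('n)}}"
    by (auto simp: conn_def intro!: exI[of _ 1])
  then show ?thesis by blast
qed

text \<open>Only meaningful for connected subsets of \<open>{1..CARD('n)}\<close>.\<close>

definition gen :: "nat set \<Rightarrow> ('n::finite) conn_subset free_algebra"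
  where "gen I = free_gen (Abs_conn_subset I)"

text \<open>Each defining relation \<open>l = r\<close> is represented by the element \<open>l - r\<close>.\<close>

inductive_set aw_relators :: "('n::finite) conn_subset free_algebra set"
  where
    commuting:
      "conn I \<Longrightarrow> I \<subseteq> {1..CARD('n)} \<Longrightarrow> conn J \<Longrightarrow> J \<subseteq> {1..CARD('n)} \<Longrightarrow>
       I \<inter> J = {} \<or> I \<subseteq> J \<Longrightarrow>
       comm (gen I) (gen J) \<in> (aw_relators :: 'n conn_subset free_algebra set)"
  | triple:
      "monotonic_adjacent CARD('n) [I1, I2, I3] \<Longrightarrow>
       gen (I1 \<union> I2)
         - (- qcomm (gen (I2 \<union> I3)) (Cseq gen [I1, I3])
            + gen I1 * gen I2 + gen I3 * gen (I1 \<union> I2 \<union> I3))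
       \<in> (aw_relators :: 'n conn_subset free_algebra set)"
  | quadruple:
      "monotonic_adjacent CARD('n) [I1, I2, I3, I4] \<Longrightarrow>
       Cseq gen [I1, I4]
         - (- qcomm (Cseq gen [I1, I3]) (gen (I3 \<union> I4))
            + gen I1 * gen I4 + gen I3 * Cseq gen [I1, I3 \<union> I4])
       \<in> (aw_relators :: 'n conn_subset free_algebra set)"

inductive_set aw_ideal :: "('n::finite) conn_subset free_algebra set"
  where
    relator: "x \<in> aw_relators \<Longrightarrow> x \<in> aw_ideal"
  | zero: "0 \<in> aw_ideal"
  | add: "x \<in> aw_ideal \<Longrightarrow> y \<in> aw_ideal \<Longrightarrow> x + y \<in> aw_ideal"
  | mult_left: "x \<in> aw_ideal \<Longrightarrow> a * x \<in> aw_ideal"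
  | mult_right: "x \<in> aw_ideal \<Longrightarrow> x * a \<in> aw_ideal"

lemma aw_ideal_minus: "x \<in> aw_ideal \<Longrightarrow> - x \<in> aw_ideal"
  using aw_ideal.mult_left[of x "-1"] by simp

lemma aw_ideal_scaleQ: "x \<in> aw_ideal \<Longrightarrow> a *\<^sub>Q x \<in> aw_ideal"
  using aw_ideal.mult_left[of x "a *\<^sub>Q 1"] by (simp add: mult_scaleQ_left)

text \<open>The augmentation shows that the ideal is proper.\<close>

lift_definition aug :: "'g free_algebra \<Rightarrow> ratfun" is "\<lambda>p. Poly_Mapping.lookup p 0" .

lemma aug_zero: "aug 0 = 0"
  by transfer simp

lemma aug_one: "aug 1 = 1"
  by transfer (simp add: lookup_one)

lemma aug_add: "aug (x + y) = aug x + aug y"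
  by transfer (simp add: lookup_add)

lemma aug_minus: "aug (- x) = - aug x"
  by transfer simp

lemma aug_diff: "aug (x - y) = aug x - aug y"
  by transfer (simp add: lookup_minus)

lemma aug_mult: "aug (x * y) = aug x * aug y"
proof transfer
  fix p r :: "'a word \<Rightarrow>\<^sub>0 ratfun"
  have *: "(\<Sum>v. Poly_Mapping.lookup r v when (0 :: 'a word) = u + v) =
      (Poly_Mapping.lookup r 0 when u = 0)" for u
  proof -
    have "(\<Sum>v. Poly_Mapping.lookup r v when (0 :: 'a word) = u + v) =
        (\<Sum>v. (Poly_Mapping.lookup r 0 when u = 0) when v = (0 :: 'a word))"
    proof (rule Sum_any.cong)
      fix v
      have "(0 = u + v) = (u = 0 \<and> v = 0)"
        using plus_word_eq_0_iff[of u v] by metis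
      then show "(Poly_Mapping.lookup r v when (0 :: 'a word) = u + v) =
          ((Poly_Mapping.lookup r 0 when u = 0) when v = (0 :: 'a word))"
        by (simp add: when_def)
    qed
    then show ?thesis by simp
  qed
  have "Poly_Mapping.lookup (p * r) 0 =
      (\<Sum>u. Poly_Mapping.lookup p u * (Poly_Mapping.lookup r 0 when u = 0))"
    by (simp only: lookup_mult *)
  also have "\<dots> = (\<Sum>u. (Poly_Mapping.lookup p 0 * Poly_Mapping.lookup r 0) when u = (0 :: 'a word))"
    by (rule Sum_any.cong) (simp add: when_def)
  finally show "Poly_Mapping.lookup (p * r) 0 =
      Poly_Mapping.lookup p 0 * Poly_Mapping.lookup r 0"
    by simp
qed

lemma aug_scaleQ: "aug (a *\<^sub>Q x) = a * aug x"
proof -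
  have "aug (a *\<^sub>Q (1 :: 'a free_algebra)) = a"
    by transfer simp
  moreover have "a *\<^sub>Q x = (a *\<^sub>Q 1) * x"
    by (simp add: mult_scaleQ_left)
  ultimately show ?thesis
    by (simp add: aug_mult)
qed

lemma aug_gen: "aug (gen I) = 0"
  unfolding gen_def by transfer (simp add: lookup_single zero_word_def)

lemma aug_qcomm: "aug x = 0 \<Longrightarrow> aug y = 0 \<Longrightarrow> aug (qcomm x y) = 0"
  by (simp add: qcomm_def aug_scaleQ aug_diff aug_mult)

lemma aug_Cseq:
  "Is \<noteq> [] \<Longrightarrow> aug (Cseq (gen :: nat set \<Rightarrow> 'n::finite conn_subset free_algebra) Is) = 0"
proof (induction "gen :: nat set \<Rightarrow> 'n conn_subset free_algebra" Is rule: Cseq.induct)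
  case (3 I J Is)
  then show ?case
    by (auto simp: Let_def aug_add aug_diff aug_minus aug_mult aug_gen aug_qcomm)
qed (simp_all add: aug_gen)

lemma aug_aw_ideal: "x \<in> aw_ideal \<Longrightarrow> aug x = 0"
proof (induction rule: aw_ideal.induct)
  case (relator x)
  then show ?case
    by cases (simp_all del: Cseq.simps
        add: comm_def aug_add aug_diff aug_minus aug_mult aug_gen aug_qcomm aug_Cseq)
qed (simp_all add: aug_zero aug_add aug_mult)

quotient_type 'n aw = "('n::finite) conn_subset free_algebra" / "\<lambda>x y. x - y \<in> aw_ideal"
proof (rule equivpI)
  show "reflp (\<lambda>x y. x - y \<in> (aw_ideal :: 'n conn_subset free_algebra set))"
    by (auto intro!: reflpI simp: aw_ideal.zero)
  show "symp (\<lambda>x y. x - y \<in> (aw_ideal :: 'n conn_subset free_algebra set))"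
    by (rule sympI) (drule aw_ideal_minus, simp)
  show "transp (\<lambda>x y. x - y \<in> (aw_ideal :: 'n conn_subset free_algebra set))"
    by (rule transpI) (drule (1) aw_ideal.add, simp)
qed

instantiation aw :: (finite) ratfun_algebra
begin

lift_definition zero_aw :: "'a aw" is 0 .
lift_definition one_aw :: "'a aw" is 1 .
lift_definition plus_aw :: "'a aw \<Rightarrow> 'a aw \<Rightarrow> 'a aw" is "(+)"
  by (drule (1) aw_ideal.add) (simp add: algebra_simps)
lift_definition uminus_aw :: "'a aw \<Rightarrow> 'a aw" is uminus
  by (drule aw_ideal_minus) (simp add: algebra_simps)
lift_definition minus_aw :: "'a aw \<Rightarrow> 'a aw \<Rightarrow> 'a aw" is "(-)"
proof -
  fix x x' y y' :: "'a conn_subset free_algebra"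
  assume "x - x' \<in> aw_ideal" "y - y' \<in> aw_ideal"
  then have "(x - x') + - (y - y') \<in> aw_ideal"
    by (intro aw_ideal.add aw_ideal_minus)
  then show "x - y - (x' - y') \<in> aw_ideal"
    by (simp add: algebra_simps)
qed
lift_definition times_aw :: "'a aw \<Rightarrow> 'a aw \<Rightarrow> 'a aw" is "(*)"
proof -
  fix x x' y y' :: "'a conn_subset free_algebra"
  assume "x - x' \<in> aw_ideal" "y - y' \<in> aw_ideal"
  then have "(x - x') * y + x' * (y - y') \<in> aw_ideal"
    by (intro aw_ideal.add aw_ideal.mult_left aw_ideal.mult_right)
  then show "x * y - x' * y' \<in> aw_ideal"
    by (simp add: algebra_simps)
qed
lift_definition scaleQ_aw :: "ratfun \<Rightarrow> 'a aw \<Rightarrow> 'a aw" is scaleQ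
proof -
  fix a and x x' :: "'a conn_subset free_algebra"
  assume "x - x' \<in> aw_ideal"
  then have "a *\<^sub>Q (x - x') \<in> aw_ideal"
    by (rule aw_ideal_scaleQ)
  moreover have "a *\<^sub>Q x = a *\<^sub>Q (x - x') + a *\<^sub>Q x'"
    by (simp flip: scaleQ_add_right)
  ultimately show "a *\<^sub>Q x - a *\<^sub>Q x' \<in> aw_ideal"
    by simp
qed

instance
proof
  have eqI: "x - y \<in> aw_ideal" if "x = y" for x y :: "'a conn_subset free_algebra"
    using that by (simp add: aw_ideal.zero)
  fix a b :: ratfun and x y z :: "'a aw"
  show "x + y + z = x + (y + z)" by transfer (rule eqI, rule add.assoc)
  show "x + y = y + x" by transfer (rule eqI, rule add.commute)
  show "0 + x = x" by transfer (rule eqI, simp)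
  show "- x + x = 0" by transfer (rule eqI, simp)
  show "x - y = x + - y" by transfer (rule eqI, simp)
  show "x * y * z = x * (y * z)" by transfer (rule eqI, rule mult.assoc)
  show "(x + y) * z = x * z + y * z" by transfer (rule eqI, rule distrib_right)
  show "x * (y + z) = x * y + x * z" by transfer (rule eqI, rule distrib_left)
  show "1 * x = x" by transfer (rule eqI, simp)
  show "x * 1 = x" by transfer (rule eqI, simp)
  have "0 - 1 \<notin> (aw_ideal :: 'a conn_subset free_algebra set)"
  proof
    assume "0 - 1 \<in> (aw_ideal :: 'a conn_subset free_algebra set)"
    then have "aug (0 - 1 :: 'a conn_subset free_algebra) = 0"
      by (rule aug_aw_ideal)
    then show False
      by (simp only: aug_diff aug_zero aug_one) simp
  qed
  then show "(0 :: 'a aw) \<noteq> 1" by transfer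
  show "a *\<^sub>Q (x + y) = a *\<^sub>Q x + a *\<^sub>Q y" by transfer (rule eqI, rule scaleQ_add_right)
  show "(a + b) *\<^sub>Q x = a *\<^sub>Q x + b *\<^sub>Q x" by transfer (rule eqI, rule scaleQ_add_left)
  show "a *\<^sub>Q b *\<^sub>Q x = (a * b) *\<^sub>Q x" by transfer (rule eqI, rule scaleQ_scaleQ)
  show "1 *\<^sub>Q x = x" by transfer (rule eqI, rule scaleQ_one)
  show "(a *\<^sub>Q x) * y = a *\<^sub>Q (x * y)" by transfer (rule eqI, rule mult_scaleQ_left)
  show "x * (a *\<^sub>Q y) = a *\<^sub>Q (x * y)" by transfer (rule eqI, rule mult_scaleQ_right)
qed

end

lift_definition aw_gen :: "nat set \<Rightarrow> ('n::finite) aw" is gen .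

definition C :: "nat set \<Rightarrow> ('n::finite) aw"
  where "C S = Cseq aw_gen (component_list S)"


section \<open>The elements $\Omega_{I_1,I_2,I_3}$ and $\omega_S$\<close>

definition Omega :: "nat set \<Rightarrow> nat set \<Rightarrow> nat set \<Rightarrow> ('n::finite) aw"
  where "Omega I1 I2 I3 =
    q *\<^sub>Q (C (I1 \<union> I2) * C (I2 \<union> I3) * C (I1 \<union> I3))
    + (1 / (q + inverse q)) *\<^sub>Q
        (q ^ 2 *\<^sub>Q C (I1 \<union> I2) ^ 2 + inverse q ^ 2 *\<^sub>Q C (I2 \<union> I3) ^ 2
         + q ^ 2 *\<^sub>Q C (I1 \<union> I3) ^ 2 + C (I1 \<union> I2 \<union> I3) ^ 2 + C I1 ^ 2 + C I2 ^ 2 + C I3 ^ 2)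
    - q *\<^sub>Q (C (I1 \<union> I2) * (C I1 * C I2 + C I3 * C (I1 \<union> I2 \<union> I3)))
    - inverse q *\<^sub>Q (C (I2 \<union> I3) * (C I2 * C I3 + C I1 * C (I1 \<union> I2 \<union> I3)))
    - q *\<^sub>Q (C (I1 \<union> I3) * (C I1 * C I3 + C I2 * C (I1 \<union> I2 \<union> I3)))
    + (q + inverse q) *\<^sub>Q (C I1 * C I2 * C I3 * C (I1 \<union> I2 \<union> I3))
    - (1 / (q + inverse q)) *\<^sub>Q 1"

definition omega :: "nat set \<Rightarrow> nat set \<Rightarrow> nat set \<Rightarrow> nat set \<Rightarrow> ('n::finite) aw"
  where "omega S I1 I2 I3 =
    (\<Sum>I\<in>Pow I1. \<Sum>J\<in>Pow I2. \<Sum>K\<in>Pow I3.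
      (- 1) ^ (card S - card I - card J - card K) * Omega I J K)"

end

theory Submission
  imports Defs
begin

text \<open>
  Say that \<open>(P, Q, R)\<close> satisfies the exchange relation if
  \<open>C (P \<union> R) = - [C (P \<union> Q), C (Q \<union> R)]\<^sub>q + C P * C R + C Q * C (P \<union> Q \<union> R)\<close>.
  Up to the cyclic order of the line, all disjoint triples \<open>P\<close>, \<open>Q\<close>, \<open>R\<close> do, and \<open>C X\<close> commutes
  with \<open>C Y\<close> for \<open>X \<subseteq> Y\<close>. Evaluating triple products in two ways by these relations gives, for
  \<open>A < B < x < E\<close>,
  \<open>\<Omega>(A, B \<union> x, E) + \<Omega>(A, B, x) = \<Omega>(A, B, x \<union> E) + \<Omega>(A, x, E)\<close>.
  In the alternating sum the second and the fourth term vanish, because each of them is independent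
  of a subset of a non-empty block. Hence single points may be moved between neighbouring blocks.
\<close>

section \<open>Identities in algebras over the rational functions\<close>

text \<open>The engine is \<open>qcomm_assoc\<close>: nested q-commutators may be rebracketed once
  the outer factors commute. Thus an exchange relation passes from sets with a gap filled or cut off
  to the set with the gap, but each passage consumes commutation relations. Those between an
  interval and a set that contains or avoids it are cheap. The obstacle is the commutation of nested
  sets that both have gaps: filling a gap of the larger set helps directly only if the smaller set
  lies on one side of it. The remaining case needs the elements of decreasing sequences, whose
  q-commutator has its factors reversed. They are controlled on four adjacent intervals, where the
  decreasing quadruple relation yields both the wrap-around relation and a commutation between
  interleaving blocks. The four-term identity is associativity in disguise: the products
  \<open>d * h * b\<close> and \<open>b * h * d\<close> of the elements of A \<union> x, A \<union>
  B \<union> E and B \<union> x \<union> E are computed with both bracketings. Exchange relations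
  give two expressions of \<open>h\<close>, which disappears from the result.\<close>

lemma q_nonzero: "q \<noteq> 0"
  by (simp add: q_def Zero_fract_def eq_fract)

text \<open>These are the denominators of \<open>qcomm\<close> and \<open>Omega\<close>. Multiplied
  by \<open>q\<close> they become q^2 - 1 and q^2 + 1, which are non-zero polynomials.\<close>

lemma q_minus_inverse_nonzero: "q - inverse q \<noteq> 0" and q_plus_inverse_nonzero: "q + inverse q \<noteq> 0"
proof -
  have 1: "q*q = Fract [:0,0,1:] 1" by (simp add: q_def)
  have "q*q - 1 \<noteq> 0" "q*q+1 \<noteq> 0" unfolding 1 by (simp_all add: One_fract_def Zero_fract_def eq_fract one_pCons)
  then show "q - inverse q \<noteq> 0" "q + inverse q \<noteq> 0"
    using q_nonzero by (auto simp: field_simps add_eq_0_iff)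
qed

lemma scaleQ_zero_right [simp]: "a *\<^sub>Q (0::'a::ratfun_algebra) = 0"
  using scaleQ_add_right[of a 0 "0::'a"] by simp

lemma scaleQ_zero_left [simp]: "0 *\<^sub>Q (x::'a::ratfun_algebra) = 0"
  using scaleQ_add_left[of 0 0 x] by simp

lemma scaleQ_minus_right: "a *\<^sub>Q (- x) = - (a *\<^sub>Q (x::'a::ratfun_algebra))"
  using scaleQ_add_right[of a x "-x"] by (simp add: eq_neg_iff_add_eq_0 add.commute)

lemma scaleQ_minus_left: "(- a) *\<^sub>Q x = - (a *\<^sub>Q (x::'a::ratfun_algebra))"
  using scaleQ_add_left[of a "-a" x] by (simp add: eq_neg_iff_add_eq_0 add.commute)

lemma scaleQ_diff_right: "a *\<^sub>Q (x - y) = a *\<^sub>Q x - a *\<^sub>Q (y::'a::ratfun_algebra)"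
  using scaleQ_add_right[of a x "-y"] by (simp add: scaleQ_minus_right)

lemma scaleQ_diff_left: "(a - b) *\<^sub>Q x = a *\<^sub>Q x - b *\<^sub>Q (x::'a::ratfun_algebra)"
  using scaleQ_add_left[of a "-b" x] by (simp add: scaleQ_minus_left)

lemmas scaleQ_linear = scaleQ_add_right scaleQ_diff_right scaleQ_minus_right
  mult_scaleQ_left mult_scaleQ_right scaleQ_scaleQ

section \<open>Calculus of q-commutators\<close>

lemma qcomm_add_left: "qcomm (x + y) z = qcomm x z + qcomm y z"
  and qcomm_add_right: "qcomm z (x + y) = qcomm z x + qcomm z y"
  and qcomm_minus_left: "qcomm (- x) z = - qcomm x z"
  and qcomm_minus_right: "qcomm z (- x) = - qcomm z x"
  and qcomm_diff_left: "qcomm (x - y) z = qcomm x z - qcomm y z"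
  and qcomm_diff_right: "qcomm z (x - y) = qcomm z x - qcomm z y"
  by (simp_all add: qcomm_def algebra_simps scaleQ_linear)

lemmas qcomm_linear = qcomm_add_left qcomm_add_right qcomm_minus_left qcomm_minus_right
  qcomm_diff_left qcomm_diff_right

text \<open>The factor 1 / (q - inverse q) in \<open>qcomm\<close> is chosen for this. It also makes
  exchange relations with an empty block trivial.\<close>

lemma qcomm_commuting: "x * y = y * x \<Longrightarrow> qcomm x y = x * y"
proof -
  assume "x * y = y * x"
  then have "qcomm x y = ((1 / (q - inverse q)) * (q - inverse q)) *\<^sub>Q (x * y)"
    by (simp add: qcomm_def scaleQ_scaleQ flip: scaleQ_diff_left)
  then show ?thesis using q_minus_inverse_nonzero by (simp add: scaleQ_one)
qed

lemma qcomm_mult_left: "z * y = y * z \<Longrightarrow> qcomm (z * x) y = z * qcomm x y"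
  and qcomm_mult_right: "z * x = x * z \<Longrightarrow> qcomm x (z * y) = z * qcomm x y"
  and qcomm_mult_left': "z * y = y * z \<Longrightarrow> qcomm (x * z) y = qcomm x y * z"
  and qcomm_mult_right': "z * x = x * z \<Longrightarrow> qcomm x (y * z) = qcomm x y * z"
proof -
  show "z * y = y * z \<Longrightarrow> qcomm (z * x) y = z * qcomm x y"
    by (simp add: qcomm_def algebra_simps scaleQ_linear) (metis mult.assoc)
  show "z * x = x * z \<Longrightarrow> qcomm x (z * y) = z * qcomm x y"
    by (simp add: qcomm_def algebra_simps scaleQ_linear) (metis mult.assoc)
  show "z * y = y * z \<Longrightarrow> qcomm (x * z) y = qcomm x y * z"
    by (simp add: qcomm_def algebra_simps scaleQ_linear)
  show "z * x = x * z \<Longrightarrow> qcomm x (y * z) = qcomm x y * z"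
    by (simp add: qcomm_def algebra_simps scaleQ_linear)
qed

text \<open>Expanded, both sides contain \<open>a * b * w\<close>, \<open>w * b * a\<close> and two
  mixed terms, and the mixed terms agree because \<open>a\<close> and \<open>w\<close> may be
  swapped where they are neighbours.\<close>

lemma qcomm_assoc:
  assumes "a * w = w * a"
  shows "qcomm (qcomm a b) w = qcomm a (qcomm b w)"
proof -
  have "w * a * b = a * w * b" "b * (a * w) = b * (w * a)" using assms by simp_all
  then show ?thesis
  by (simp add: qcomm_def algebra_simps scaleQ_linear)
qed

text \<open>Left and right multiplications by \<open>a\<close> commute with those by
  \<open>b\<close> when \<open>a\<close> and \<open>b\<close> commute, and \<open>qcomm a _\<close>
  is a combination of the former.\<close>

lemma qcomm_left_commute:
  assumes "a * b = b * a"
  shows "qcomm a (qcomm b w) = qcomm b (qcomm a w)"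
proof -
  have "a * (b * w) = b * (a * w)" "w * (a * b) = w * (b * a)"
    using assms by (metis mult.assoc)+
  then show ?thesis
  by (simp add: qcomm_def algebra_simps scaleQ_linear)
qed

lemma qcomm_right_commute:
  assumes "a * b = b * a"
  shows "qcomm (qcomm w a) b = qcomm (qcomm w b) a"
proof -
  have "a * (b * w) = b * (a * w)" "w * (a * b) = w * (b * a)"
    using assms by (metis mult.assoc)+
  then show ?thesis
  by (simp add: qcomm_def algebra_simps scaleQ_linear)
qed

text \<open>A q-analogue of the Jacobi identity, free of commutation hypotheses. The inner
  q-commutators are taken in the cyclic order of \<open>a\<close>, \<open>b\<close>,
  \<open>w\<close>, so that the mixed terms cancel.\<close>

lemma comm_qcomm_right:
  "comm a (qcomm b w) = comm (qcomm a b) w - comm b (qcomm w a)"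
  by (simp add: qcomm_def comm_def algebra_simps scaleQ_linear)

lemma commute_left: "x * y = y * x \<Longrightarrow> x * (y * z) = y * (x * (z::'a::semigroup_mult))"
  by (metis mult.assoc)

lemma commute_add: "x * y = y * x \<Longrightarrow> x * z = z * x \<Longrightarrow> x * (y + z) = (y + z) * (x::'a::ring_1)"
  and commute_diff: "x * y = y * x \<Longrightarrow> x * z = z * x \<Longrightarrow> x * (y - z) = (y - z) * (x::'a::ring_1)"
  and commute_mult: "x * y = y * x \<Longrightarrow> x * z = z * x \<Longrightarrow> x * (y * z) = y * z * (x::'a::ring_1)"
  by (simp_all add: algebra_simps) (metis mult.assoc)

lemma commute_qcomm:
  assumes "x * y = y * x" "x * z = z * x" shows "x * qcomm y z = qcomm y z * x"
  using assms commute_mult[of x y z] commute_mult[of x z y]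
  by (simp add: qcomm_def algebra_simps scaleQ_linear)

text \<open>Here \<open>p\<close> and \<open>x\<close> are two parts of the first block,
  \<open>h\<close> fills the gap between them and \<open>w\<close> belongs to \<open>p\<close>
  together with \<open>h\<close>. The relations 1 express elements that have the gap through
  elements where it is filled or \<open>p\<close> is cut off. Since \<open>w\<close> commutes with
  \<open>s\<close>, the operator \<open>qcomm _ s\<close> passes inside \<open>qcomm w _\<close>,
  where the relations 2 apply.\<close>

lemma gap_left_ring:
 fixes p :: "'a::ratfun_algebra"
 assumes 1: "pxz = - qcomm w hxz + p * xz + h * phxz"
  "pxy = - qcomm w hxy + p * xy + h * phxy"
  "px = - qcomm w hx + p * x + h * phx"
  "pxyz = - qcomm w hxyz + p * xyz + h * phxyz"
  and 2: "hxz = - qcomm hxy s + hx * z + y * hxyz"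
  "xz = - qcomm xy s + x * z + y * xyz"
  "phxz = - qcomm phxy s + phx * z + y * phxyz"
  and 3: "w * s = s * w" "w * z = z * w" "y * w = w * y" "p * s = s * p" "h * s = s * h" "p * y = y * p" "h * y = y * h"
 shows "pxz = - qcomm pxy s + px * z + y * pxyz"
  using 3 3[THEN commute_left] by (simp add: 1 2 qcomm_linear qcomm_assoc[OF 3(1)] qcomm_mult_left qcomm_mult_right qcomm_mult_right' algebra_simps)

text \<open>The sets of \<open>h\<close> and \<open>y\<close> are two candidates for the middle
  block in the same hole. Expanding \<open>hz\<close> on one side and \<open>xy\<close> on the other
  gives the same double q-commutator of \<open>xh\<close>, \<open>hy\<close> and \<open>yz\<close>,
  bracketed in the two possible ways.\<close>

lemma gap_between_ring:
 fixes x :: "'a::ratfun_algebra"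
 assumes xy: "xy = - qcomm xh hy + x * y + h * xhy"
  and xyz: "xyz = - qcomm xh hyz + x * yz + h * xhyz"
  and hz: "hz = - qcomm hy yz + h * z + y * hyz"
  and xhz: "xhz = - qcomm xhy yz + xh * z + y * xhyz"
  and 3: "xh * yz = yz * xh" "x * yz = yz * x" "h * yz = yz * h" "y * yz = yz * y" "h * xh = xh * h" "y * xh = xh * y" "x * y = y * x" "h * y = y * h" "z * xh = xh * z"
 shows "xz = - qcomm xh hz + x * z + h * xhz \<longleftrightarrow> xz = - qcomm xy yz + x * z + y * xyz"
  using 3 3[THEN commute_left]
  by (simp add: xy xyz hz xhz qcomm_linear qcomm_assoc[OF 3(1)] qcomm_mult_left qcomm_mult_right qcomm_mult_right' qcomm_commuting algebra_simps)

text \<open>The expansion across the gap \<open>h\<close> of \<open>gap_left_ring\<close>, for the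
  rotated relation that has \<open>px\<close> as its third block. The operators
  \<open>qcomm w _\<close> and \<open>qcomm yz _\<close> now act from the same side, so they are
  interchanged instead of rebracketed.\<close>

lemma L_gapX_ring:
 fixes p :: "'a::ratfun_algebra"
 assumes 1: "pxz = - qcomm w hxz + p * xz + h * phxz"
  "pxy = - qcomm w hxy + p * xy + h * phxy"
  "px = - qcomm w hx + p * x + h * phx"
  "pxyz = - qcomm w hxyz + p * xyz + h * phxyz"
  and 2: "hxy = - qcomm yz hxz + hx * y + z * hxyz"
  "xy = - qcomm yz xz + x * y + z * xyz"
  "phxy = - qcomm yz phxz + phx * y + z * phxyz"
  and 3: "w * yz = yz * w" "w * y = y * w" "z * w = w * z" "p * yz = yz * p" "h * yz = yz * h" "p * z = z * p" "h * z = z * h"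
 shows "pxy = - qcomm yz pxz + px * y + z * pxyz"
  using 3 3[THEN commute_left] by (simp add: 1 2 qcomm_linear qcomm_left_commute[OF 3(1)] qcomm_mult_left qcomm_mult_right qcomm_mult_right' algebra_simps)

text \<open>This and the next two identities concern the wrap-around relation, whose third block
  consists of the outer blocks 1 and 4. The gap \<open>h\<close> is in block 4 here, in block 1 and
  in block 2 below. Its position decides whether its operator acts opposite to
  \<open>qcomm s _\<close> (rebracketing) or on the same side (interchange).\<close>

lemma W_gap4_ring:
 fixes s :: "'a::ratfun_algebra"
 assumes 1: "x124 = - qcomm x12ah w + x12a * b + h * x12ahb"
  "x134 = - qcomm x13ah w + x13a * b + h * x13ahb"
  "x14 = - qcomm x1ah w + x1a * b + h * x1ahb"
  "x1234 = - qcomm x123ah w + x123a * b + h * x123ahb"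
 and 2: "x12ah = - qcomm s x13ah + x2 * x1ah + x3 * x123ah"
  "x12a = - qcomm s x13a + x2 * x1a + x3 * x123a"
  "x12ahb = - qcomm s x13ahb + x2 * x1ahb + x3 * x123ahb"
 and 3: "s * w = w * s" "x2 * w = w * x2" "x3 * w = w * x3" "h * s = s * h" "b * s = s * b" "h * x2 = x2 * h" "h * x3 = x3 * h"
 shows "x124 = - qcomm s x134 + x2 * x14 + x3 * x1234"
  using 3 3[THEN commute_left] by (simp add: 1 2 qcomm_linear qcomm_assoc[OF 3(1), symmetric] qcomm_mult_left qcomm_mult_right qcomm_mult_right' algebra_simps)

lemma W_gap1_ring:
 fixes s :: "'a::ratfun_algebra"
 assumes 1: "x124 = - qcomm w hx24 + p * x24 + h * phx24"
  "x134 = - qcomm w hx34 + p * x34 + h * phx34"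
  "x14 = - qcomm w hx4 + p * x4 + h * phx4"
  "x1234 = - qcomm w hx234 + p * x234 + h * phx234"
 and 2: "hx24 = - qcomm s hx34 + x2 * hx4 + x3 * hx234"
  "x24 = - qcomm s x34 + x2 * x4 + x3 * x234"
  "phx24 = - qcomm s phx34 + x2 * phx4 + x3 * phx234"
 and 3: "s * w = w * s" "x2 * w = w * x2" "x3 * w = w * x3" "h * s = s * h" "p * s = s * p" "h * x2 = x2 * h" "h * x3 = x3 * h" "p * x2 = x2 * p" "p * x3 = x3 * p"
 shows "x124 = - qcomm s x134 + x2 * x14 + x3 * x1234"
  using 3 3[THEN commute_left] by (simp add: 1 2 qcomm_linear qcomm_left_commute[OF 3(1)] qcomm_mult_left qcomm_mult_right qcomm_mult_right' algebra_simps)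

text \<open>With the gap in block 2, the relations W that expand \<open>x124\<close> and
  \<open>x1234\<close> are themselves wrap-around relations. Hence intervals that touch the middle
  block have to be settled before general second blocks.\<close>

lemma W_gap2_ring:
 fixes p :: "'a::ratfun_algebra"
 assumes 1: "x23 = - qcomm w hu3 + p * u3 + h * phu3"
  "x2 = - qcomm w hu + p * u + h * phu"
 and W: "x124 = - qcomm w x1hu4 + p * x1u4 + h * x1phu4"
  "x1234 = - qcomm w x1hu34 + p * x1u34 + h * x1phu34"
 and 2: "x1hu4 = - qcomm hu3 x134 + hu * x14 + x3 * x1hu34"
   "x1u4 = - qcomm u3 x134 + u * x14 + x3 * x1u34"
   "x1phu4 = - qcomm phu3 x134 + phu * x14 + x3 * x1phu34"
 and 3: "w * x134 = x134 * w" "w * x14 = x14 * w" "x3 * w = w * x3" "p * x134 = x134 * p" "h * x134 = x134 * h" "p * x3 = x3 * p" "h * x3 = x3 * h"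
 shows "x124 = - qcomm x23 x134 + x2 * x14 + x3 * x1234"
  apply (subst W(1)) apply (subst W(2)) apply (subst 1) apply (subst 1)
  using 3 3[THEN commute_left] apply (simp add: 2 qcomm_linear qcomm_assoc[OF 3(1)] qcomm_mult_left qcomm_mult_right qcomm_mult_right' algebra_simps)
  done

text \<open>Knowing a q-commutator in both orders amounts to knowing a commutator; in this way
  exchange relations produce commutation relations.\<close>

lemma qcomm_minus_swap: "qcomm x y - qcomm y x = ((q + inverse q) / (q - inverse q)) *\<^sub>Q comm x y"
proof -
  have "qcomm x y - qcomm y x = (1 / (q - inverse q)) *\<^sub>Q ((q + inverse q) *\<^sub>Q comm x y)"
    by (simp add: qcomm_def comm_def scaleQ_linear scaleQ_add_left algebra_simps)
  then show ?thesis by (simp add: scaleQ_scaleQ)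
qed

lemma scaleQ_cancel: "a \<noteq> 0 \<Longrightarrow> a *\<^sub>Q x = a *\<^sub>Q y \<Longrightarrow> x = y"
  by (metis scaleQ_scaleQ scaleQ_one left_inverse)

text \<open>In the following identities \<open>x13\<close> stands for the element indexed by the union of the first and the
  third block, and so on, and \<open>F\<close> for that of all blocks.\<close>

lemma four_blocks_ring:
 fixes x1 :: "'a::ratfun_algebra"
 assumes x13: "x13 = - qcomm x12 x23 + x1 * x3 + x2 * x123" and x24: "x24 = - qcomm x23 x34 + x2 * x4 + x3 * x234"
  and x124: "x124 = - qcomm x123 x34 + x12 * x4 + x3 * F"
  and x134: "x134 = - qcomm x12 x234 + x1 * x34 + x2 * F"
  and x14: "x14 = - qcomm x123 x234 + x1 * x4 + x23 * F"
  and x14': "x14 = - qcomm x12 x24 + x1 * x4 + x2 * x124"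
  and L0: "x12 = - qcomm x23 x13 + x1 * x2 + x3 * x123"
  and L: "x23 = - qcomm x34 x24 + x2 * x3 + x4 * x234" "x123 = - qcomm x34 x124 + x12 * x3 + x4 * F"
   "x123 = - qcomm x234 x14 + x1 * x23 + x4 * F" "x12 = - qcomm x234 x134 + x1 * x2 + x34 * F"
  and U: "- qcomm x234 x123 + x23 * F = qcomm (qcomm x34 x23) x12 - x3 * qcomm x234 x12 - x2 * qcomm x34 x123 + x2 * x3 * F"
  and 3: "\<forall>z\<in>{x1,x2,x3,x4,F}. \<forall>y\<in>{x12,x23,x34,x123,x234}. y * z = z * y"
   "\<forall>y\<in>{x2,x3,x4,F}. y * x1 = x1 * y" "\<forall>y\<in>{x3,x4,F}. y * x2 = x2 * y" "\<forall>y\<in>{x4,F}. y * x3 = x3 * y" "F * x4 = x4 * F"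
  and 4: "x34 * x12 = x12 * x34" "x234 * x23 = x23 * x234" "x234 * x34 = x34 * x234" "x123 * x23 = x23 * x123"
   "x123 * x12 = x12 * x123"
  defines "u13 \<equiv> - qcomm x23 x12 + x1 * x3 + x2 * x123"
 shows W_mixed_base_ring: "x124 = - qcomm u13 x234 + x1 * x24 + x3 * F"
   and W_base_ring: "x124 = - qcomm x23 x134 + x2 * x14 + x3 * F"
   and K_base_ring: "comm u13 x24 = 0"
proof -
  have c': "\<forall>z\<in>{x1,x2,x3,x4,F}. \<forall>y\<in>{x12,x23,x34,x123,x234}. \<forall>w. y * (z * w) = z * (y * w)"
   "\<forall>y\<in>{x2,x3,x4,F}. \<forall>w. y * (x1 * w) = x1 * (y * w)" "\<forall>y\<in>{x3,x4,F}. \<forall>w. y * (x2 * w) = x2 * (y * w)"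
   "\<forall>y\<in>{x4,F}. \<forall>w. y * (x3 * w) = x3 * (y * w)" "\<forall>w. F * (x4 * w) = x4 * (F * w)"
    using 3 commute_left by blast+
  note c = 3[simplified] 4 and lc = c'[simplified] 4[THEN commute_left]
  note qs = qcomm_linear qcomm_mult_left qcomm_mult_right qcomm_commuting c lc algebra_simps
  \<comment> \<open>The \<open>u\<close> elements have the factors of the q-commutator reversed;
    they belong to decreasing sequences.\<close>
  define u14 where "u14 = - qcomm x234 x123 + x1 * x4 + x23 * F"
  define u24 where "u24 = - qcomm x34 x23 + x2 * x4 + x3 * x234"
  define u134 where "u134 = - qcomm x234 x12 + x1 * x34 + x2 * F"
  define u124 where "u124 = - qcomm x34 x123 + x12 * x4 + x3 * F"
  have b2334: "qcomm x23 x34 = - x24 + x2 * x4 + x3 * x234" using x24 by simp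
  have b12334: "qcomm x123 x34 = - x124 + x12 * x4 + x3 * F" using x124 by simp
  have b12234: "qcomm x12 x234 = - x134 + x1 * x34 + x2 * F" using x134 by simp
  have b123234: "qcomm x123 x234 = - x14 + x1 * x4 + x23 * F" using x14 by simp
  have bL1: "qcomm x34 x24 = - x23 + x2 * x3 + x4 * x234" using L(1) by (simp add: algebra_simps)
  have bL2: "qcomm x34 x124 = - x123 + x12 * x3 + x4 * F" using L(2) by (simp add: algebra_simps)
  have bL3: "qcomm x234 x14 = - x123 + x1 * x23 + x4 * F" using L(3) by (simp add: algebra_simps)
  have bL4: "qcomm x234 x134 = - x12 + x1 * x2 + x34 * F" using L(4) by (simp add: algebra_simps)
  \<comment> \<open>This is \<open>U\<close>, the decreasing quadruple relation, with the
    \<open>u\<close> elements put back.\<close>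
  have u14: "u14 = - qcomm u24 x12 + x4 * x1 + x2 * u124"
    using U unfolding u14_def u24_def u124_def by (simp add: qs)
  \<comment> \<open>\<open>qcomm_assoc\<close> with equal outer factors moves the second
    \<open>x234\<close> inside, next to \<open>x123\<close>, where the order is the one given by
    \<open>b123234\<close>.\<close>
  have s1: "qcomm u14 x234 = - x123 + x1 * x23 + x4 * F"
    unfolding u14_def by (simp add: qs qcomm_assoc b123234 bL3)
  have s2a: "qcomm u24 x34 = - x23 + x2 * x3 + x4 * x234"
    unfolding u24_def by (simp add: qs qcomm_assoc b2334 bL1)
  have s2b: "qcomm u124 x34 = - x123 + x12 * x3 + x4 * F"
    unfolding u124_def by (simp add: qs qcomm_assoc b12334 bL2)
  have s2: "qcomm u14 x34 = - u13 + x1 * x3 + x4 * u134"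
    unfolding u14 using qcomm_right_commute[OF 4(1)[symmetric], of u24]
    by (simp add: qs s2a s2b u13_def u134_def)
  have s3: "qcomm u134 x234 = - x12 + x1 * x2 + x34 * F"
    unfolding u134_def by (simp add: qs qcomm_assoc b12234 bL4)
  have e123: "x123 = - qcomm u14 x234 + x1 * x23 + x4 * F" using s1 by simp
  \<comment> \<open>The substitution creates a double q-commutator with right factors
    \<open>x234\<close> and \<open>x34\<close>. They commute, and \<open>s2\<close> evaluates the
    inner part after the interchange.\<close>
  have "x124 = - qcomm (- qcomm u14 x234 + x1 * x23 + x4 * F) x34 + x12 * x4 + x3 * F"
    using x124 e123 by simp
  also have "\<dots> = qcomm (qcomm u14 x34) x234 - x1 * qcomm x23 x34 - x4 * F * x34 + x12 * x4 + x3 * F"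
    using qcomm_right_commute[OF 4(3)[symmetric], of u14] by (simp add: qs)
  also have "\<dots> = - qcomm u13 x234 + x1 * x24 + x3 * F"
    by (simp add: qs s2 s3 b2334)
  finally show mix: "x124 = - qcomm u13 x234 + x1 * x24 + x3 * F" .
  have "qcomm x23 x134 = - qcomm (qcomm x23 x12) x234 + x1 * qcomm x23 x34 + x2 * F * x23"
    unfolding x134 using qcomm_assoc[OF 4(2)[symmetric], of x12] by (simp add: qs)
  also have "\<dots> = qcomm u13 x234 - x1 * x3 * x234 - x2 * qcomm x123 x234 + x1 * qcomm x23 x34 + x2 * F * x23"
    by (simp add: u13_def qs)
  also have "\<dots> = - x124 + x2 * x14 + x3 * F"
    by (subst mix) (simp add: qs b123234 b2334)
  finally show W: "x124 = - qcomm x23 x134 + x2 * x14 + x3 * F" by simp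
  have s4: "qcomm x34 x14 = - x13 + x1 * x3 + x4 * x134"
  proof -
    have "qcomm x34 x14 = - qcomm x12 (qcomm x34 x24) + x1 * x4 * x34 + x2 * qcomm x34 x124"
      unfolding x14' using qcomm_left_commute[OF 4(1)[symmetric], of x24] by (simp add: qs)
    then show ?thesis by (simp add: qs bL1 bL2 x13 x134)
  qed
  have mixu: "u124 = - qcomm x234 x13 + x1 * u24 + x3 * F"
  proof -
    have "u124 = - qcomm x34 (- qcomm x234 x14 + x1 * x23 + x4 * F) + x12 * x4 + x3 * F"
      using L(3) by (simp add: u124_def)
    also have "\<dots> = qcomm x234 (qcomm x34 x14) - x1 * qcomm x34 x23 - x4 * F * x34 + x12 * x4 + x3 * F"
      using qcomm_left_commute[OF 4(3)[symmetric], of x14] by (simp add: qs)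
    also have "\<dots> = - qcomm x234 x13 + x1 * u24 + x3 * F"
      by (simp add: qs s4 bL4 u24_def)
    finally show ?thesis .
  qed
  have b1: "qcomm u134 x23 = - u124 + x2 * u14 + x3 * F"
  proof -
    have "qcomm u134 x23 = - qcomm x234 (qcomm x12 x23) + x1 * qcomm x34 x23 + x2 * F * x23"
      unfolding u134_def by (simp add: qs qcomm_assoc)
    then show ?thesis by (simp add: qs mixu x13 u24_def u14_def)
  qed
  have b2: "qcomm x23 u134 = qcomm x234 u13 + x2 * u14 - x1 * x24"
  proof -
    have "qcomm x23 u134 = - qcomm x234 (qcomm x23 x12) + x1 * qcomm x23 x34 + x2 * F * x23"
      unfolding u134_def using qcomm_left_commute[OF 4(2)[symmetric], of x12] by (simp add: qs)
    then show ?thesis by (simp add: qs b2334 u13_def u14_def)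
  qed
  have b3: "qcomm u13 x23 = - x12 + x1 * x2 + x3 * x123"
  proof -
    have "qcomm x23 x13 = - x12 + x1 * x2 + x3 * x123" using L0 by (simp add: algebra_simps)
    then show ?thesis by (simp add: u13_def x13 qs qcomm_assoc)
  qed
  have b4: "qcomm x34 u13 = - u14 + x1 * x4 + x3 * u134"
    using qcomm_assoc[OF 4(1), of x23]
    by (simp add: u13_def u14 u24_def u134_def u124_def qs)
  have c1: "x23 * u14 = u14 * x23"
    unfolding u14_def by (simp add: qs commute_qcomm[of x23 x234 x123])
  \<comment> \<open>Both orders of these q-commutators have been evaluated; comparing their
    differences gives the claim up to the scalar of \<open>qcomm_minus_swap\<close>, which is
    cancelled.\<close>
  have key: "comm x123 x34 - comm x23 u134 = comm u13 x234"
  proof (rule scaleQ_cancel)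
    show "(q + inverse q) / (q - inverse q) \<noteq> 0" using q_minus_inverse_nonzero q_plus_inverse_nonzero by simp
    have "(qcomm x123 x34 - qcomm x34 x123) - (qcomm x23 u134 - qcomm u134 x23) = qcomm u13 x234 - qcomm x234 u13"
      using mix by (simp add: b1 b2 b12334 u124_def algebra_simps)
    then show "((q + inverse q) / (q - inverse q)) *\<^sub>Q (comm x123 x34 - comm x23 u134)
       = ((q + inverse q) / (q - inverse q)) *\<^sub>Q comm u13 x234"
      unfolding qcomm_minus_swap by (simp add: scaleQ_diff_right)
  qed
  have "comm u13 x24 = - comm u13 (qcomm x23 x34) + x3 * comm u13 x234"
  proof -
    have "u13 * (x2 * x4) = x2 * x4 * u13" "u13 * (x3 * x234) = x3 * (u13 * x234)"
      unfolding u13_def by (simp_all add: qs qcomm_def scaleQ_linear)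
    then show ?thesis unfolding x24 by (simp add: comm_def algebra_simps)
  qed
  \<comment> \<open>The Jacobi identity leaves the inner q-commutators of \<open>u13\<close> with
    \<open>x23\<close> and \<open>x34\<close>, in exactly the orders known from \<open>b3\<close>
    and \<open>b4\<close>.\<close>
  also have "\<dots> = - comm (- x12 + x1 * x2 + x3 * x123) x34 + comm x23 (- u14 + x1 * x4 + x3 * u134) + x3 * comm u13 x234"
    by (simp add: comm_qcomm_right b3 b4)
  also have "\<dots> = - (x3 * (comm x123 x34 - comm x23 u134)) + x3 * comm u13 x234"
    by (simp add: comm_def c1 c lc algebra_simps)
  also have "\<dots> = 0" by (simp add: key)
  finally show "comm u13 x24 = 0" .
qed

section \<open>Reordering products by means of q-commutators\<close>

lemma q_cancel: "q * inverse q = 1" "inverse q * q = 1" "q * (inverse q * x) = x" "inverse q * (q * x) = x"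
  using q_nonzero by (simp_all flip: mult.assoc)

text \<open>This and the three rules below are normal-ordering rules: an unwanted order of factors
  is traded for the other one at the cost of a q-commutator that an exchange relation
  evaluates.\<close>

lemma qcomm_swap_right: "qcomm x y = (q * (q + inverse q)) *\<^sub>Q (y * x) - (q * q) *\<^sub>Q qcomm y x"
proof -
  have "(q - inverse q) *\<^sub>Q qcomm x y = (q - inverse q) *\<^sub>Q ((q * (q + inverse q)) *\<^sub>Q (y * x) - (q * q) *\<^sub>Q qcomm y x)"
    unfolding qcomm_def using q_minus_inverse_nonzero q_nonzero
    by (simp add: scaleQ_linear scaleQ_one) (simp add: algebra_simps scaleQ_add_left scaleQ_diff_left q_cancel)
  then show ?thesis using scaleQ_cancel[OF q_minus_inverse_nonzero] by blast
qed

lemma mult_swap_right: "x * y = (q * q) *\<^sub>Q (y * x) - (q * (q - inverse q)) *\<^sub>Q qcomm y x"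
  and mult_swap_left: "x * y = (inverse q * inverse q) *\<^sub>Q (y * x) + (inverse q * (q - inverse q)) *\<^sub>Q qcomm x y"
  and qcomm_swap_left: "qcomm x y = (inverse q * (q + inverse q)) *\<^sub>Q (x * y) - (inverse q * inverse q) *\<^sub>Q qcomm y x"
proof -
  show "x * y = (q * q) *\<^sub>Q (y * x) - (q * (q - inverse q)) *\<^sub>Q qcomm y x"
   "x * y = (inverse q * inverse q) *\<^sub>Q (y * x) + (inverse q * (q - inverse q)) *\<^sub>Q qcomm x y"
    unfolding qcomm_def using q_minus_inverse_nonzero q_nonzero
    by (simp_all add: scaleQ_linear scaleQ_one q_cancel)
  have "(q - inverse q) *\<^sub>Q qcomm x y = (q - inverse q) *\<^sub>Q ((inverse q * (q + inverse q)) *\<^sub>Q (x * y) - (inverse q * inverse q) *\<^sub>Q qcomm y x)"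
    unfolding qcomm_def using q_minus_inverse_nonzero q_nonzero
    by (simp add: scaleQ_linear scaleQ_one) (simp add: algebra_simps scaleQ_add_left scaleQ_diff_left q_cancel)
  then show "qcomm x y = (inverse q * (q + inverse q)) *\<^sub>Q (x * y) - (inverse q * inverse q) *\<^sub>Q qcomm y x"
    using scaleQ_cancel[OF q_minus_inverse_nonzero] by blast
qed

text \<open>Enlarges the middle block to the union of blocks 2 and 3. The rotated relation
  \<open>T(1)\<close> replaces \<open>x234\<close> by a q-commutator ending in \<open>x12\<close>,
  which commutes with \<open>x123\<close>; after rebracketing only \<open>qcomm x123 x134\<close>
  and \<open>x2 * qcomm x123 x34\<close> remain to be found.\<close>

lemma step_B_ring:
 fixes x1 :: "'a::ratfun_algebra"
 assumes T: "x234 = - qcomm x134 x12 + x34 * x2 + x1 * F"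
  "x123 = - qcomm x234 x14 + x23 * x1 + x4 * F"
  "x12 = - qcomm x234 x134 + x2 * x1 + x34 * F"
  "x34 = - qcomm x14 x13 + x4 * x3 + x1 * x134"
  "x12 = - qcomm x23 x13 + x2 * x1 + x3 * x123"
  "x234 = - qcomm x14 x123 + x4 * x23 + x1 * F"
  "x24 = - qcomm x23 x34 + x2 * x4 + x3 * x234"
  "x13 = - qcomm x34 x14 + x3 * x1 + x4 * x134"
  "x24 = - qcomm x14 x12 + x4 * x2 + x1 * x124"
  "x23 = - qcomm x13 x12 + x3 * x2 + x1 * x123"
  "x13 = - qcomm x12 x23 + x1 * x3 + x2 * x123"
  "x14 = - qcomm x13 x34 + x1 * x4 + x3 * x134"
  "x134 = - qcomm x12 x234 + x1 * x34 + x2 * F"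
  "x14 = - qcomm x12 x24 + x1 * x4 + x2 * x124"
  and 3: "\<forall>z\<in>{x1,x2,x3,x4,F}. \<forall>y\<in>{x12,x23,x34,x123,x234,x13,x14,x24,x124,x134}. y * z = z * y"
   "\<forall>y\<in>{x2,x3,x4,F}. y * x1 = x1 * y" "\<forall>y\<in>{x3,x4,F}. y * x2 = x2 * y" "\<forall>y\<in>{x4,F}. y * x3 = x3 * y" "F * x4 = x4 * F"
  and 4: "x123 * x12 = x12 * x123" "x134 * x14 = x14 * x134" "x124 * x12 = x12 * x124" "x23 * x14 = x14 * x23" "x34 * x12 = x12 * x34"
 shows "x14 = - qcomm x123 x234 + x1 * x4 + x23 * F"
proof -
  have c': "\<forall>z\<in>{x1,x2,x3,x4,F}. \<forall>y\<in>{x12,x23,x34,x123,x234,x13,x14,x24,x124,x134}. \<forall>w. y * (z * w) = z * (y * w)"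
   "\<forall>y\<in>{x2,x3,x4,F}. \<forall>w. y * (x1 * w) = x1 * (y * w)" "\<forall>y\<in>{x3,x4,F}. \<forall>w. y * (x2 * w) = x2 * (y * w)"
   "\<forall>y\<in>{x4,F}. \<forall>w. y * (x3 * w) = x3 * (y * w)" "\<forall>w. F * (x4 * w) = x4 * (F * w)"
    using 3 commute_left by blast+
  note c = 3[simplified] 4 and lc = c'[simplified] 4[THEN commute_left]
  note qs = qcomm_linear qcomm_mult_left qcomm_mult_right qcomm_mult_right' qcomm_commuting c lc algebra_simps
  have b1: "qcomm x134 x12 = - x234 + x34 * x2 + x1 * F"
    using T(1) by (simp add: algebra_simps)
  have b2: "qcomm x234 x134 = - x12 + x2 * x1 + x34 * F"
    using T(3) by (simp add: algebra_simps)
  have b3: "qcomm x14 x13 = - x34 + x4 * x3 + x1 * x134"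
    using T(4) by (simp add: algebra_simps)
  have b4: "qcomm x23 x13 = - x12 + x2 * x1 + x3 * x123"
    using T(5) by (simp add: algebra_simps)
  have b5: "qcomm x14 x123 = - x234 + x4 * x23 + x1 * F"
    using T(6) by (simp add: algebra_simps)
  have b6: "qcomm x23 x34 = - x24 + x2 * x4 + x3 * x234"
    using T(7) by (simp add: algebra_simps)
  have b7: "qcomm x34 x14 = - x13 + x3 * x1 + x4 * x134"
    using T(8) by (simp add: algebra_simps)
  have b8: "qcomm x14 x12 = - x24 + x4 * x2 + x1 * x124"
    using T(9) by (simp add: algebra_simps)
  have b9: "qcomm x13 x12 = - x23 + x3 * x2 + x1 * x123"
    using T(10) by (simp add: algebra_simps)
  have b10: "qcomm x12 x23 = - x13 + x1 * x3 + x2 * x123"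
    using T(11) by (simp add: algebra_simps)
  have b11: "qcomm x13 x34 = - x14 + x1 * x4 + x3 * x134"
    using T(12) by (simp add: algebra_simps)
  have b12: "qcomm x12 x234 = - x134 + x1 * x34 + x2 * F"
    using T(13) by (simp add: algebra_simps)
  have b13: "qcomm x12 x24 = - x14 + x1 * x4 + x2 * x124"
    using T(14) by (simp add: algebra_simps)
  note b = b1 b2 b3 b4 b5 b6 b7 b8 b9 b10 b11 b12 b13
  \<comment> \<open>The factor \<open>x1\<close> is kept because \<open>b3\<close> expresses the
    product \<open>x1 * x134\<close> by a q-commutator.\<close>
  have e1: "x1 * qcomm x23 x134 = - x24 + x2 * x4 - qcomm x14 x12 + x1 * x2 * x14 + x1 * x3 * F"
  proof -
    have "x1 * qcomm x23 x134 = qcomm x23 (x1 * x134)" by (simp add: qs)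
    also have "x1 * x134 = x34 + qcomm x14 x13 - x4 * x3" by (simp add: b)
    also have "qcomm x23 \<dots> = qcomm x23 x34 + qcomm x14 (qcomm x23 x13) - x4 * x3 * x23"
      using qcomm_left_commute[OF 4(4), of x13] by (simp add: qs)
    also have "\<dots> = - x24 + x2 * x4 - qcomm x14 x12 + x1 * x2 * x14 + x1 * x3 * F"
      by (simp add: b(4)) (simp add: qs b(5,6))
    finally show ?thesis .
  qed
  \<comment> \<open>\<open>T(2)\<close> introduces \<open>x14\<close>, which commutes with
    \<open>x134\<close>, so that the two right factors can be interchanged.\<close>
  have e2: "qcomm x123 x134 = qcomm x12 x14 - qcomm x14 x12 - x24 + x2 * x4 + F * x13"
  proof -
    have "qcomm x123 x134 = - qcomm (qcomm x234 x134) x14 + x1 * qcomm x23 x134 + x4 * F * x134"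
      apply (subst T(2)) using qcomm_right_commute[OF 4(2), of x234] by (simp add: qs)
    also have "\<dots> = qcomm x12 x14 - qcomm x14 x12 - x24 + x2 * x4 + F * x13"
      unfolding e1 b(2) by (simp add: qs b(7))
    finally show ?thesis .
  qed
  have e3: "x2 * qcomm x123 x34 = - qcomm x12 x24 + x2 * x12 * x4 + x2 * x3 * F - x14 + x1 * x4"
  proof -
    have "x2 * qcomm x123 x34 = qcomm (x2 * x123) x34" by (simp add: qs)
    also have "x2 * x123 = qcomm x12 x23 + x13 - x1 * x3" by (simp add: b)
    also have "qcomm \<dots> x34 = qcomm x12 (qcomm x23 x34) + qcomm x13 x34 - x1 * x3 * x34"
      using qcomm_assoc[OF 4(5)[symmetric], of x23] by (simp add: qs)
    also have "\<dots> = - qcomm x12 x24 + x2 * x12 * x4 + x2 * x3 * F - x14 + x1 * x4"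
      by (simp add: qs b(6,11,12))
    finally show ?thesis .
  qed
  have e4: "qcomm x12 (qcomm x14 x12) = qcomm (qcomm x12 x14) x12"
    using qcomm_assoc[of x12 x12 x14] by simp
  have "qcomm x123 x234 = - qcomm (qcomm x123 x134) x12 + x2 * qcomm x123 x34 + x1 * F * x123"
    apply (subst T(1)) using qcomm_assoc[OF 4(1), of x134] by (simp add: qs)
  also have "\<dots> = - x14 + x1 * x4 + x23 * F"
    unfolding e2 e3 by (simp add: qcomm_linear b(8) flip: e4) (simp add: qs b(9,13))
  finally show ?thesis by simp
qed

text \<open>The Casimir element of the Askey-Wilson algebra, with \<open>u\<close>,
  \<open>v\<close>, \<open>w\<close> for the pairs of blocks 12, 23, 13, then the single blocks and
  their union. Elements instead of sets as arguments make rotated and reversed versions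
  expressible.\<close>

definition casimir :: "'a::ratfun_algebra \<Rightarrow> 'a \<Rightarrow> 'a \<Rightarrow> 'a \<Rightarrow> 'a \<Rightarrow> 'a \<Rightarrow> 'a \<Rightarrow> 'a"
  where "casimir u v w x y z f =
    q *\<^sub>Q (u * v * w)
    + (1 / (q + inverse q)) *\<^sub>Q
        (q ^ 2 *\<^sub>Q u ^ 2 + inverse q ^ 2 *\<^sub>Q v ^ 2
         + q ^ 2 *\<^sub>Q w ^ 2 + f ^ 2 + x ^ 2 + y ^ 2 + z ^ 2)
    - q *\<^sub>Q (u * (x * y + z * f))
    - inverse q *\<^sub>Q (v * (y * z + x * f))
    - q *\<^sub>Q (w * (x * z + y * f))
    + (q + inverse q) *\<^sub>Q (x * y * z * f)
    - (1 / (q + inverse q)) *\<^sub>Q 1"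

lemma scaled_casimir: "(q + inverse q) *\<^sub>Q casimir u v w x y z f =
    (q * (q + inverse q)) *\<^sub>Q (u * v * w)
    + (q * q) *\<^sub>Q (u * u) + (inverse q * inverse q) *\<^sub>Q (v * v)
         + (q * q) *\<^sub>Q (w * w) + f * f + x * x + y * y + z * z
    - (q * (q + inverse q)) *\<^sub>Q (u * (x * y + z * f))
    - (inverse q * (q + inverse q)) *\<^sub>Q (v * (y * z + x * f))
    - (q * (q + inverse q)) *\<^sub>Q (w * (x * z + y * f))
    + ((q + inverse q) * (q + inverse q)) *\<^sub>Q (x * y * z * f) - 1"
  unfolding casimir_def using q_plus_inverse_nonzero by (simp add: scaleQ_linear power2_eq_square scaleQ_one mult.commute)

text \<open>To bring \<open>w\<close> to the front of \<open>u * v * w\<close> it has to pass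
  \<open>v\<close> and \<open>u\<close>. The two q-commutators that arise are given by T, and they
  account for the changed coefficients of the terms in \<open>v\<close> and
  \<open>u\<close>.\<close>

lemma casimir_rotate:
 fixes u :: "'a::ratfun_algebra"
 assumes T: "u = - qcomm v w + x * y + z * f" "v = - qcomm w u + y * z + x * f"
  and c: "y * x = x * y" "z * x = x * z" "z * y = y * z" "z * f = f * z" "y * f = f * y" "x * f = f * x"
   "\<forall>y\<in>{u,v,w}. y * x = x * y" "\<forall>x\<in>{u,v,w}. x * y = y * x" "\<forall>y\<in>{u,v,w}. y * z = z * y" "\<forall>y\<in>{u,v,w}. y * f = f * y"
 shows "casimir u v w x y z f = casimir w u v z x y f"
proof (rule scaleQ_cancel[OF q_plus_inverse_nonzero])
  have b: "qcomm v w = - u + x * y + z * f"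
    by (subst T(1)) simp
  have b': "qcomm w u = - v + y * z + x * f"
    by (subst T(2)) simp
  have "u * v * w = (inverse q * inverse q) *\<^sub>Q ((u * w) * v) + (inverse q * (q - inverse q)) *\<^sub>Q (u * qcomm v w)"
    using mult_swap_left[of v w] by (simp add: algebra_simps scaleQ_linear)
  also have "u * w = (q * q) *\<^sub>Q (w * u) - (q * (q - inverse q)) *\<^sub>Q qcomm w u" by (rule mult_swap_right)
  finally have e: "u * v * w = w * u * v - (inverse q * (q - inverse q)) *\<^sub>Q ((- v + y * z + x * f) * v)
      + (inverse q * (q - inverse q)) *\<^sub>Q (u * (- u + x * y + z * f))"
    unfolding b b' by (simp add: scaleQ_linear scaleQ_one q_cancel mult.assoc scaleQ_add_left scaleQ_diff_left left_diff_distrib right_diff_distrib distrib_left distrib_right)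
  have c': "\<And>t. y * (x * t) = x * (y * t)" "\<And>t. z * (x * t) = x * (z * t)" "\<And>t. z * (y * t) = y * (z * t)" "\<And>t. z * (f * t) = f * (z * t)"
    "\<And>t. y * (f * t) = f * (y * t)" "\<And>t. x * (f * t) = f * (x * t)"
    "\<forall>y\<in>{u,v,w}. \<forall>t. y * (x * t) = x * (y * t)" "\<forall>x\<in>{u,v,w}. \<forall>t. x * (y * t) = y * (x * t)" "\<forall>y\<in>{u,v,w}. \<forall>t. y * (z * t) = z * (y * t)" "\<forall>y\<in>{u,v,w}. \<forall>t. y * (f * t) = f * (y * t)"
    using c commute_left by blast+
  show "(q + inverse q) *\<^sub>Q casimir u v w x y z f = (q + inverse q) *\<^sub>Q casimir w u v z x y f"
    unfolding scaled_casimir e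
    by (simp add: c(1-6) c'(1-6) c(7-)[simplified] c'(7-)[simplified] scaleQ_linear scaleQ_add_left scaleQ_diff_left distrib_left distrib_right left_diff_distrib right_diff_distrib mult.assoc q_cancel scaleQ_one)
qed

lemma scaleQ_mult_eq: "(q + inverse q) *\<^sub>Q (x * y) = q *\<^sub>Q qcomm x y + inverse q *\<^sub>Q qcomm y x"
proof -
  have "(q - inverse q) *\<^sub>Q ((q + inverse q) *\<^sub>Q (x * y)) = (q - inverse q) *\<^sub>Q (q *\<^sub>Q qcomm x y + inverse q *\<^sub>Q qcomm y x)"
    unfolding qcomm_def using q_minus_inverse_nonzero
    by (simp add: scaleQ_linear scaleQ_one) (simp add: algebra_simps scaleQ_add_left scaleQ_diff_left q_cancel)
  then show ?thesis using scaleQ_cancel[OF q_minus_inverse_nonzero] by blast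
qed

text \<open>Complements \<open>comm_qcomm_right\<close>: the q-commutators available here,
  \<open>qcomm y x\<close> and \<open>qcomm x z\<close>, run against the cyclic order used
  there.\<close>

lemma comm_qcomm_middle:
  "comm x (qcomm y z) = (q * q) *\<^sub>Q (y * qcomm x z - qcomm y x * z)
     - (inverse q * inverse q) *\<^sub>Q (qcomm x z * y - z * qcomm y x)"
proof -
  have "(q - inverse q) *\<^sub>Q comm x (qcomm y z) = (q - inverse q) *\<^sub>Q ((q * q) *\<^sub>Q (y * qcomm x z - qcomm y x * z)
     - (inverse q * inverse q) *\<^sub>Q (qcomm x z * y - z * qcomm y x))"
    unfolding qcomm_def comm_def using q_minus_inverse_nonzero
    by (simp add: scaleQ_linear scaleQ_one left_diff_distrib right_diff_distrib q_cancel) (simp add: algebra_simps scaleQ_add_left scaleQ_diff_left q_cancel)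
  then show ?thesis using scaleQ_cancel[OF q_minus_inverse_nonzero] by blast
qed

text \<open>In terms of blocks, \<open>e\<close> is 12, \<open>u\<close> 23, \<open>v\<close> 34,
  \<open>a\<close> 123, \<open>b\<close> 234, \<open>d\<close> 13, \<open>c\<close> 14,
  \<open>f\<close> 24, \<open>h\<close> 124 and \<open>g\<close> 134. \<open>T(3)\<close> and
  \<open>T(4)\<close> are two expressions of \<open>h\<close>; with them \<open>h\<close> can be
  q-commuted with \<open>d\<close> and \<open>b\<close> on either side, and the two bracketings of
  \<open>d * h * b\<close> and \<open>b * h * d\<close> are compared. Some Casimir expressions
  appear rotated, because the triple products arise in that order.\<close>

lemma casimir_exchange_ring:
 fixes x1 :: "'a::ratfun_algebra"
 assumes T: "c = - qcomm d v + x1 * x4 + x3 * g"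
  "e = - qcomm u d + x1 * x2 + x3 * a"
  "h = - qcomm u g + x2 * c + x3 * F"
  "h = - qcomm a v + x4 * e + x3 * F"
  "f = - qcomm u v + x2 * x4 + x3 * b"
  "c = - qcomm a b + x1 * x4 + F * u"
  "a = - qcomm b c + x1 * u + x4 * F"
  "b = - qcomm c a + x4 * u + x1 * F"
  "g = - qcomm e b + x1 * v + x2 * F"
  "e = - qcomm b g + x1 * x2 + F * v"
  "b = - qcomm g e + x2 * v + x1 * F"
  "d = - qcomm e u + x1 * x3 + x2 * a"
  "u = - qcomm d e + x2 * x3 + x1 * a"
  "d = - qcomm v c + x1 * x3 + x4 * g"
  "v = - qcomm c d + x3 * x4 + x1 * g"
  and 3: "\<forall>z\<in>{x1,x2,x3,x4,F}. \<forall>y\<in>{e,u,v,a,b,d,c,f,h,g}. y * z = z * y"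
   "\<forall>y\<in>{x2,x3,x4,F}. y * x1 = x1 * y" "\<forall>y\<in>{x3,x4,F}. y * x2 = x2 * y" "\<forall>y\<in>{x4,F}. y * x3 = x3 * y" "F * x4 = x4 * F"
  and 4: "d * a = a * d" "g * d = d * g" "b * u = u * b" "b * v = v * b" "c * u = u * c" "v * e = e * v" "e * a = a * e" "g * c = c * g"
 shows "casimir c a b x4 x1 u F + casimir e u d x1 x2 x3 a = casimir e b g x1 x2 v F + casimir c d v x4 x1 x3 g"
proof -
  have c': "\<forall>z\<in>{x1,x2,x3,x4,F}. \<forall>y\<in>{a,b,c,d,e,f,g,h,u,v}. \<forall>w. y * (z * w) = z * (y * w)"
   "\<forall>y\<in>{x2,x3,x4,F}. \<forall>w. y * (x1 * w) = x1 * (y * w)" "\<forall>y\<in>{x3,x4,F}. \<forall>w. y * (x2 * w) = x2 * (y * w)"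
   "\<forall>y\<in>{x4,F}. \<forall>w. y * (x3 * w) = x3 * (y * w)" "\<forall>w. F * (x4 * w) = x4 * (F * w)"
    using 3 commute_left by blast+
  note c = 3[simplified] 4 and lc = c'[simplified] 4[THEN commute_left]
  note qs = qcomm_linear qcomm_mult_left qcomm_mult_right qcomm_mult_right' qcomm_commuting c lc algebra_simps
  have b1: "qcomm d v = - c + x1 * x4 + x3 * g" using T(1) by (simp add: algebra_simps)
  have b2: "qcomm u d = - e + x1 * x2 + x3 * a" using T(2) by (simp add: algebra_simps)
  have b5: "qcomm u v = - f + x2 * x4 + x3 * b" using T(5) by (simp add: algebra_simps)
  have b6: "qcomm a b = - c + x1 * x4 + F * u" using T(6) by (simp add: algebra_simps)
  have b7: "qcomm b c = - a + x1 * u + x4 * F" using T(7) by (simp add: algebra_simps)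
  have b8: "qcomm c a = - b + x4 * u + x1 * F" using T(8) by (simp add: algebra_simps)
  have b9: "qcomm e b = - g + x1 * v + x2 * F" using T(9) by (simp add: algebra_simps)
  have b10: "qcomm b g = - e + x1 * x2 + F * v" using T(10) by (simp add: algebra_simps)
  have b11: "qcomm g e = - b + x2 * v + x1 * F" using T(11) by (simp add: algebra_simps)
  have b12: "qcomm e u = - d + x1 * x3 + x2 * a" using T(12) by (simp add: algebra_simps)
  have b13: "qcomm d e = - u + x2 * x3 + x1 * a" using T(13) by (simp add: algebra_simps)
  have b14: "qcomm v c = - d + x1 * x3 + x4 * g" using T(14) by (simp add: algebra_simps)
  have b15: "qcomm c d = - v + x3 * x4 + x1 * g" using T(15) by (simp add: algebra_simps)
  \<comment> \<open>This q-commutator is left unevaluated; it survives only as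
    \<open>comm b G\<close>, which \<open>cG\<close> computes.\<close>
  define G where "G = qcomm a g"
  have r1: "qcomm d h = qcomm a c - x4 * u - x3 * G + x2 * x3 * x4 + x3 * F * d"
    unfolding T(4) using qcomm_left_commute[OF 4(1), of v]
    by (simp add: qs b1 b13 G_def)
  have r2: "qcomm h d = qcomm e g - x2 * v - x3 * G + x2 * x3 * x4 + x3 * F * d"
    unfolding T(3) using qcomm_right_commute[OF 4(2), of u]
    by (simp add: qs b2 b15 G_def)
  have r3: "qcomm h b = qcomm c v - x4 * g + F * f"
    unfolding T(4) using qcomm_right_commute[OF 4(4), of a]
    by (simp add: qs b6 b9 b5)
  have r4: "qcomm b h = qcomm u e - x2 * a + F * f"
    unfolding T(3) using qcomm_left_commute[OF 4(3), of g]
    by (simp add: qs b10 b7 b5)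
  note sq = scaleQ_linear scaleQ_one q_cancel mult.assoc scaleQ_add_left scaleQ_diff_left left_diff_distrib right_diff_distrib distrib_left distrib_right
  let ?s = "q + inverse q" and ?k = "q - inverse q"
  have t1: "qcomm a c * b = (q * ?s) *\<^sub>Q (c * a * b) - (q * q) *\<^sub>Q ((- b + x4 * u + x1 * F) * b)"
    unfolding qcomm_swap_right[of a c] b8 by (simp add: sq)
  have eg: "qcomm e g = (inverse q * ?s) *\<^sub>Q (e * g) - (inverse q * inverse q) *\<^sub>Q (- b + x2 * v + x1 * F)"
    unfolding qcomm_swap_left[of e g] b11 ..
  have gb: "g * b = (q * q) *\<^sub>Q (b * g) - (q * ?k) *\<^sub>Q (- e + x1 * x2 + F * v)"
    unfolding mult_swap_right[of g b] b10 ..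
  have be: "b * e = (q * q) *\<^sub>Q (e * b) - (q * ?k) *\<^sub>Q (- g + x1 * v + x2 * F)"
    unfolding mult_swap_right[of b e] b9 ..
  have cv: "qcomm c v = (inverse q * ?s) *\<^sub>Q (c * v) - (inverse q * inverse q) *\<^sub>Q (- d + x1 * x3 + x4 * g)"
    unfolding qcomm_swap_left[of c v] b14 ..
  have dc: "d * c = (q * q) *\<^sub>Q (c * d) - (q * ?k) *\<^sub>Q (- v + x3 * x4 + x1 * g)"
    unfolding mult_swap_right[of d c] b15 ..
  have vd: "v * d = (q * q) *\<^sub>Q (d * v) - (q * ?k) *\<^sub>Q (- c + x1 * x4 + x3 * g)"
    unfolding mult_swap_right[of v d] b1 ..
  have ue: "qcomm u e = (q * ?s) *\<^sub>Q (e * u) - (q * q) *\<^sub>Q (- d + x1 * x3 + x2 * a)"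
    unfolding qcomm_swap_right[of u e] b12 ..
  have de: "d * e = (inverse q * inverse q) *\<^sub>Q (e * d) + (inverse q * ?k) *\<^sub>Q (- u + x2 * x3 + x1 * a)"
    unfolding mult_swap_left[of d e] b13 ..
  have du: "d * u = (q * q) *\<^sub>Q (u * d) - (q * ?k) *\<^sub>Q (- e + x1 * x2 + x3 * a)"
    unfolding mult_swap_right[of d u] b2 ..
  have bc: "b * c = (inverse q * inverse q) *\<^sub>Q (c * b) + (inverse q * ?k) *\<^sub>Q (- a + x1 * u + x4 * F)"
    unfolding mult_swap_left[of b c] b7 ..
  have ba: "b * a = (q * q) *\<^sub>Q (a * b) - (q * ?k) *\<^sub>Q (- c + x1 * x4 + F * u)"
    unfolding mult_swap_right[of b a] b6 ..
  have t2: "qcomm e g * b = (inverse q * ?s) *\<^sub>Q (e * (g * b)) - (inverse q * inverse q) *\<^sub>Q ((- b + x2 * v + x1 * F) * b)"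
    unfolding eg by (simp add: sq)
  have t3: "d * qcomm c v = (inverse q * ?s) *\<^sub>Q (d * c * v) - (inverse q * inverse q) *\<^sub>Q (d * (- d + x1 * x3 + x4 * g))"
    unfolding cv by (simp add: sq)
  have t4: "d * qcomm u e = (q * ?s) *\<^sub>Q (d * e * u) - (q * q) *\<^sub>Q (d * (- d + x1 * x3 + x2 * a))"
    unfolding ue by (simp add: sq)
  have t5: "b * qcomm e g = (inverse q * ?s) *\<^sub>Q (b * e * g) - (inverse q * inverse q) *\<^sub>Q (b * (- b + x2 * v + x1 * F))"
    unfolding eg by (simp add: sq)
  have t6: "b * qcomm a c = (q * ?s) *\<^sub>Q (b * c * a) - (q * q) *\<^sub>Q (b * (- b + x4 * u + x1 * F))"
    unfolding qcomm_swap_right[of a c] b8 by (simp add: sq)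
  have t7: "qcomm u e * d = (q * ?s) *\<^sub>Q (e * u * d) - (q * q) *\<^sub>Q ((- d + x1 * x3 + x2 * a) * d)"
    unfolding ue by (simp add: sq)
  have t8: "qcomm c v * d = (inverse q * ?s) *\<^sub>Q (c * (v * d)) - (inverse q * inverse q) *\<^sub>Q ((- d + x1 * x3 + x4 * g) * d)"
    unfolding cv by (simp add: sq)
  have deu: "d * e * u = (inverse q * inverse q) *\<^sub>Q (e * (d * u)) + (inverse q * ?k) *\<^sub>Q ((- u + x2 * x3 + x1 * a) * u)"
    unfolding de by (simp add: sq)
  have bca: "b * c * a = (inverse q * inverse q) *\<^sub>Q (c * (b * a)) + (inverse q * ?k) *\<^sub>Q ((- a + x1 * u + x4 * F) * a)"
    unfolding bc by (simp add: sq)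
  have dcv: "d * c * v = (q * q) *\<^sub>Q (c * d * v) - (q * ?k) *\<^sub>Q ((- v + x3 * x4 + x1 * g) * v)"
    unfolding dc by (simp add: sq)
  have beg: "b * e * g = (q * q) *\<^sub>Q (e * b * g) - (q * ?k) *\<^sub>Q ((- g + x1 * v + x2 * F) * g)"
    unfolding be by (simp add: sq)
  have cG: "comm b G = (q * q) *\<^sub>Q (a * (- e + x1 * x2 + F * v) - (- c + x1 * x4 + F * u) * g)
     - (inverse q * inverse q) *\<^sub>Q ((- e + x1 * x2 + F * v) * a - g * (- c + x1 * x4 + F * u))"
    unfolding G_def comm_qcomm_middle b10 b6 ..
  have cf: "comm d f = x3 * comm d b - ((q * q) *\<^sub>Q (u * (- c + x1 * x4 + x3 * g) - (- e + x1 * x2 + x3 * a) * v)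
     - (inverse q * inverse q) *\<^sub>Q ((- c + x1 * x4 + x3 * g) * u - v * (- e + x1 * x2 + x3 * a)))"
  proof -
    have "comm d f = x3 * comm d b - comm d (qcomm u v)"
      unfolding T(5) by (simp add: comm_def sq c lc)
    then show ?thesis unfolding comm_qcomm_middle b1 b2 .
  qed
  \<comment> \<open>The two bracketings of \<open>d * h * b\<close> and of \<open>b * h * d\<close>,
    each partial product to be evaluated through both of its q-commutators by
    \<open>scaleQ_mult_eq\<close>.\<close>
  have "0 = (?s *\<^sub>Q (d * h)) * b - d * (?s *\<^sub>Q (h * b)) - b * (?s *\<^sub>Q (h * d)) + (?s *\<^sub>Q (b * h)) * d"
    by (simp add: scaleQ_linear mult.assoc)
  also have "\<dots> = q *\<^sub>Q (qcomm a c * b) - q *\<^sub>Q (x4 * u * b) + inverse q *\<^sub>Q (qcomm e g * b) - inverse q *\<^sub>Q (x2 * v * b)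
    - q *\<^sub>Q (d * qcomm c v) + q *\<^sub>Q (x4 * d * g) - inverse q *\<^sub>Q (d * qcomm u e) + inverse q *\<^sub>Q (x2 * d * a)
    - q *\<^sub>Q (b * qcomm e g) + q *\<^sub>Q (x2 * b * v) - inverse q *\<^sub>Q (b * qcomm a c) + inverse q *\<^sub>Q (x4 * b * u)
    + q *\<^sub>Q (qcomm u e * d) - q *\<^sub>Q (x2 * a * d) + inverse q *\<^sub>Q (qcomm c v * d) - inverse q *\<^sub>Q (x4 * g * d)
    + ?s *\<^sub>Q (x3 * comm b G + x3 * F * comm d b - F * comm d f)"
    unfolding scaleQ_mult_eq r1 r2 r3 r4
    by (simp add: comm_def sq) (simp add: c lc)
  finally have z: "0 = \<dots>" (is "0 = ?Z") .
  have Z: "?Z = q *\<^sub>Q (qcomm a c * b) - q *\<^sub>Q (x4 * u * b) + inverse q *\<^sub>Q (qcomm e g * b) - inverse q *\<^sub>Q (x2 * v * b)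
    - q *\<^sub>Q (d * qcomm c v) + q *\<^sub>Q (x4 * d * g) - inverse q *\<^sub>Q (d * qcomm u e) + inverse q *\<^sub>Q (x2 * d * a)
    - q *\<^sub>Q (b * qcomm e g) + q *\<^sub>Q (x2 * b * v) - inverse q *\<^sub>Q (b * qcomm a c) + inverse q *\<^sub>Q (x4 * b * u)
    + q *\<^sub>Q (qcomm u e * d) - q *\<^sub>Q (x2 * a * d) + inverse q *\<^sub>Q (qcomm c v * d) - inverse q *\<^sub>Q (x4 * g * d)
    + ?s *\<^sub>Q (x3 * comm b G - F * (comm d f - x3 * comm d b))"
    by (simp add: right_diff_distrib c lc algebra_simps)
  have cf': "comm d f - x3 * comm d b = - ((q * q) *\<^sub>Q (u * (- c + x1 * x4 + x3 * g) - (- e + x1 * x2 + x3 * a) * v)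
     - (inverse q * inverse q) *\<^sub>Q ((- c + x1 * x4 + x3 * g) * u - v * (- e + x1 * x2 + x3 * a)))"
    unfolding cf by simp
  \<comment> \<open>After normal ordering, the vanishing expression is the difference of the two
    sides times \<open>?k * ?s\<close>.\<close>
  have "?k *\<^sub>Q (?s *\<^sub>Q casimir c a b x4 x1 u F + ?s *\<^sub>Q casimir e u d x1 x2 x3 a) =
    ?k *\<^sub>Q (?s *\<^sub>Q casimir e b g x1 x2 v F + ?s *\<^sub>Q casimir c d v x4 x1 x3 g) + ?Z"
    unfolding Z
    unfolding cf' scaled_casimir t1 t2 t3 t4 t5 t6 t7 t8 deu bca dcv beg gb du vd ba cG
    by (simp add: sq c lc) (simp add: mult_2 scaleQ_add_left algebra_simps, simp only: mult_2_right scaleQ_add_left add_ac)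
  then have "?k *\<^sub>Q (?s *\<^sub>Q casimir c a b x4 x1 u F + ?s *\<^sub>Q casimir e u d x1 x2 x3 a) =
    ?k *\<^sub>Q (?s *\<^sub>Q casimir e b g x1 x2 v F + ?s *\<^sub>Q casimir c d v x4 x1 x3 g)"
    by (simp flip: z)
  then have "?k *\<^sub>Q ?s *\<^sub>Q (casimir c a b x4 x1 u F + casimir e u d x1 x2 x3 a) =
    ?k *\<^sub>Q ?s *\<^sub>Q (casimir e b g x1 x2 v F + casimir c d v x4 x1 x3 g)"
    by (simp only: scaleQ_add_right)
  then show ?thesis
    by (rule scaleQ_cancel[OF q_plus_inverse_nonzero scaleQ_cancel[OF q_minus_inverse_nonzero]])
qed

text \<open>In \<open>four_blocks_ring\<close> the wrap-around relation is obtained from this mixed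
  form. The passage is reversible, since it only rebrackets around the commuting pair
  \<open>x23\<close>, \<open>x234\<close>; so the mixed form becomes available for all blocks with a
  wrap-around relation.\<close>

lemma W_mixed_ring:
 fixes x1 :: "'a::ratfun_algebra"
 assumes W: "x124 = - qcomm x23 x134 + x2 * x14 + x3 * F"
  and T: "x134 = - qcomm x12 x234 + x1 * x34 + x2 * F" "x24 = - qcomm x23 x34 + x2 * x4 + x3 * x234"
   "x14 = - qcomm x123 x234 + x1 * x4 + x23 * F"
  and c: "x23 * x234 = x234 * x23" "x1 * x23 = x23 * x1" "x2 * x23 = x23 * x2" "x3 * x234 = x234 * x3" "x1 * x234 = x234 * x1" "x2 * x234 = x234 * x2"
    "x2 * x1 = x1 * x2" "x3 * x1 = x1 * x3" "x23 * F = F * x23"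
 shows "x124 = - qcomm (- qcomm x23 x12 + x1 * x3 + x2 * x123) x234 + x1 * x24 + x3 * F"
  apply (subst W) apply (subst T(1)) apply (subst T(2)) apply (subst T(3))
  using qcomm_assoc[OF c(1), of x12] c c[THEN commute_left]
  by (simp add: qcomm_linear qcomm_mult_left qcomm_mult_right qcomm_mult_right' qcomm_commuting algebra_simps)

section \<open>Families of elements indexed by sets of integers\<close>

text \<open>Reflecting the line reverses the factors of every relation, so a reflected family lives in the
  opposite algebra. This halves the number of relations to be proved.\<close>

typedef 'a op = "UNIV :: 'a set" morphisms unop Op by simp

setup_lifting type_definition_op

instantiation op :: (ratfun_algebra) ratfun_algebra
begin
lift_definition zero_op :: "'a op" is 0 .
lift_definition one_op :: "'a op" is 1 .
lift_definition plus_op :: "'a op \<Rightarrow> 'a op \<Rightarrow> 'a op" is "(+)" .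
lift_definition minus_op :: "'a op \<Rightarrow> 'a op \<Rightarrow> 'a op" is "(-)" .
lift_definition uminus_op :: "'a op \<Rightarrow> 'a op" is uminus .
lift_definition times_op :: "'a op \<Rightarrow> 'a op \<Rightarrow> 'a op" is "\<lambda>x y. y * x" .
lift_definition scaleQ_op :: "ratfun \<Rightarrow> 'a op \<Rightarrow> 'a op" is scaleQ .
instance
  by standard (transfer; simp add: algebra_simps scaleQ_linear scaleQ_add_left scaleQ_one)+
end

lemma Op_mult: "Op (x * y) = Op y * Op x" and Op_add: "Op (x + y) = Op x + Op y"
  and Op_minus: "Op (- x) = - Op x" and Op_one: "Op 1 = 1"
  and Op_qcomm: "Op (qcomm x y) = qcomm (Op y) (Op x)" and Op_diff: "Op (x - y) = Op x - Op y"
  and Op_scaleQ: "Op (r *\<^sub>Q x) = r *\<^sub>Q Op x"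
proof -
  show "Op (x * y) = Op y * Op x" "Op (x + y) = Op x + Op y" "Op (- x) = - Op x" "Op 1 = 1"
    "Op (x - y) = Op x - Op y" "Op (r *\<^sub>Q x) = r *\<^sub>Q Op x"
    by (transfer, simp)+
  show "Op (qcomm x y) = qcomm (Op y) (Op x)"
    unfolding qcomm_def by (transfer, simp)
qed

lemma Op_eq_iff: "Op x = Op y \<longleftrightarrow> x = y" by (simp add: Op_inject)

text \<open>Induction on the number of missing points: the first gap \<open>{b..<d}\<close> may be cut off, added, or filled.\<close>

lemma gap_induct [consumes 1, case_names empty interval gap]:
  fixes P :: "nat set"
  assumes "finite P" and empty: "\<Phi> {}" and interval: "\<And>a b. a < b \<Longrightarrow> \<Phi> {a..<b}"
    and gap: "\<And>a b d K. \<lbrakk>a < b; b < d; d \<in> K; K \<subseteq> {d..}; finite K; \<Phi> K; \<Phi> ({b..<d} \<union> K); \<Phi> ({a..<d} \<union> K)\<rbrakk>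
      \<Longrightarrow> \<Phi> ({a..<b} \<union> K)"
  shows "\<Phi> P"
proof -
  define m :: "nat set \<Rightarrow> nat set" where "m P = {x. x \<notin> P \<and> (\<exists>y\<in>P. y < x) \<and> (\<exists>z\<in>P. x < z)}" for P
  have fin: "finite (m P)" if "finite P" for P
  proof (rule finite_subset)
    show "m P \<subseteq> (\<Union>z\<in>P. {..<z})" by (auto simp: m_def)
  qed (use that in simp)
  from \<open>finite P\<close> show ?thesis
  proof (induction "card (m P)" arbitrary: P rule: less_induct)
    case less
    show ?case
    proof (cases "P = {}")
      case False
      define a where "a = Min P"
      have a: "a \<in> P" "\<And>x. x \<in> P \<Longrightarrow> a \<le> x"
        using False less.prems by (auto simp: a_def)
      define b where "b = (LEAST x. a \<le> x \<and> x \<notin> P)"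
      have "\<exists>x. a \<le> x \<and> x \<notin> P"
      proof (intro exI conjI)
        show "a \<le> Suc (Max P)" using Max_ge[OF less.prems a(1)] by simp
        show "Suc (Max P) \<notin> P" using Max_ge[OF less.prems, of "Suc (Max P)"] by auto
      qed
      then have b: "a \<le> b" "b \<notin> P" "\<And>x. a \<le> x \<Longrightarrow> x < b \<Longrightarrow> x \<in> P"
        unfolding b_def by (metis (mono_tags, lifting) LeastI_ex, metis (mono_tags, lifting) LeastI_ex, metis (mono_tags, lifting) not_less_Least)
      have ab: "a < b" using a b by (metis le_neq_implies_less)
      define K where "K = {x\<in>P. b < x}"
      have P: "P = {a..<b} \<union> K"
      proof (intro equalityI subsetI)
        fix x assume "x \<in> P"
        then show "x \<in> {a..<b} \<union> K" using a(2)[of x] b(2) by (cases x b rule: linorder_cases) (auto simp: K_def)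
      next
        fix x assume "x \<in> {a..<b} \<union> K"
        then show "x \<in> P" using b(3)[of x] by (auto simp: K_def)
      qed
      show ?thesis
      proof (cases "K = {}")
        case True
        then show ?thesis using P interval[OF ab] by simp
      next
        case False
        define d where "d = Min K"
        have finK: "finite K" using less.prems by (simp add: K_def)
        have d: "d \<in> K" "K \<subseteq> {d..}" using False finK by (auto simp: d_def)
        have bd: "b < d" using d(1) by (simp add: K_def)
        have mb: "b \<in> m P" using ab d(1) bd a(1) P by (auto simp: m_def b(2))
        have Kd: "d \<le> x" if "x \<in> K" for x using that d(2) by auto
        \<comment> \<open>In all three smaller sets \<open>b\<close> is no longer missing: it is
          filled, or lies below all of \<open>K\<close>. No new missing point arises.\<close>
        have sub: "m Q \<subset> m P" if Q: "K \<subseteq> Q" "Q \<subseteq> {a..<d} \<union> K" "{b..<d} \<subseteq> Q \<or> Q = K" "{a..<b} \<subseteq> Q \<or> Q \<subseteq> {b..}" for Q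
        proof -
          have "m Q \<subseteq> m P"
          proof
            fix x assume "x \<in> m Q"
            then obtain y z where x: "x \<notin> Q" "y \<in> Q" "y < x" "z \<in> Q" "x < z" by (auto simp: m_def)
            have "a \<le> y" using subsetD[OF Q(2) x(2)] Kd[of y] ab bd by auto
            then have 1: "a < x" using x(3) by simp
            have 2: "\<exists>z\<in>K. x < z"
              using subsetD[OF Q(2) x(4)] x(5) d(1) by (auto intro: less_trans)
            have 3: "x \<notin> {a..<b}"
              using Q(4) x(1,2,3) by (auto simp: subset_iff)
            have "x \<notin> K" using x(1) Q(1) by blast
            then show "x \<in> m P" using 1 2 3 a(1) P unfolding m_def by blast
          qed
          moreover have "b \<notin> m Q"
          proof
            assume "b \<in> m Q"
            then obtain y where "b \<notin> Q" "y \<in> Q" "y < b" by (auto simp: m_def)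
            then show False using Q(3) Kd[of y] bd by (auto simp: subset_iff)
          qed
          ultimately show ?thesis using mb by blast
        qed
        have "m K \<subset> m P" "m ({b..<d} \<union> K) \<subset> m P" "m ({a..<d} \<union> K) \<subset> m P"
          by (rule sub; use ab bd in \<open>auto dest: Kd\<close>)+
        then have "card (m Q) < card (m P)" if "Q \<in> {K, {b..<d} \<union> K, {a..<d} \<union> K}" for Q
          using that fin[OF less.prems] psubset_card_mono by blast
        then have "\<Phi> K" "\<Phi> ({b..<d} \<union> K)" "\<Phi> ({a..<d} \<union> K)"
          using finK by (simp_all add: less.hyps)
        then show ?thesis
          unfolding P using gap[OF ab bd d finK] by blast
      qed
    qed (simp add: empty)
  qed
qed

section \<open>Commutation with intervals\<close>

definition comparable :: "'b set \<Rightarrow> 'b set \<Rightarrow> bool"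
  where "comparable I J \<longleftrightarrow> I \<inter> J = {} \<or> I \<subseteq> J \<or> J \<subseteq> I"

lemma comparable_pieces:
  assumes "A \<inter> H = {}" "A \<inter> K = {}" "H \<inter> K = {}"
    "I \<subseteq> H \<or> I \<inter> (A \<union> H \<union> K) = {} \<or> I \<subseteq> A \<or> I \<subseteq> K \<or> A \<union> H \<union> K \<subseteq> I"
  shows "comparable I A" "comparable I H" "comparable I (A \<union> H)" "comparable I K"
    "comparable I (H \<union> K)" "comparable I (A \<union> H \<union> K)"
  using assms(4)
  by (elim disjE; use assms(1-3) in \<open>unfold comparable_def\<close>; blast)+

text \<open>By convexity an interval cannot jump over the gap \<open>{b..<d}\<close>: if it avoids
  both parts, it avoids or lies inside the gap; if it is contained in the union, it is contained in
  one part; if it contains both parts, it contains the gap.\<close>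

lemma comparable_gap:
  fixes a b d l u :: nat
  assumes gap: "a < b" "b < d" "d \<in> K" "K \<subseteq> {d..}" and I: "I = {l..<u}" and rel: "comparable I ({a..<b} \<union> K)"
  shows "comparable I {a..<b}" "comparable I {b..<d}" "comparable I {a..<d}" "comparable I K"
    "comparable I ({b..<d} \<union> K)" "comparable I ({a..<d} \<union> K)"
proof -
  have mem: "x \<in> I" if "y \<in> I" "z \<in> I" "y \<le> x" "x \<le> z" for x y z
    using that by (auto simp: I)
  have K: "x \<in> K \<Longrightarrow> d \<le> x" for x using gap(4) by auto
  have dis: "{a..<b} \<union> {b..<d} = {a..<d}" "{a..<b} \<inter> {b..<d} = {}" "{a..<b} \<inter> K = {}" "{b..<d} \<inter> K = {}"
    using gap(1,2) by (auto dest: K)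
  have "I \<subseteq> {b..<d} \<or> I \<inter> ({a..<b} \<union> {b..<d} \<union> K) = {}" if disj: "I \<inter> ({a..<b} \<union> K) = {}"
  proof (rule ccontr)
    assume "\<not> ?thesis"
    then obtain x y where x: "x \<in> I" "b \<le> x" "x < d" and y: "y \<in> I" "y < b \<or> d \<le> y"
      using disj by (auto simp: subset_iff disjoint_iff not_le not_less)
    from y(2) have "b - 1 \<in> I \<or> d \<in> I"
      using mem[OF y(1) x(1), of "b - 1"] mem[OF x(1) y(1), of d] x(2,3) by auto
    moreover have "b - 1 \<in> {a..<b}" using gap(1) by auto
    ultimately show False using disj gap(3) by blast
  qed
  moreover have "I \<subseteq> {a..<b} \<or> I \<subseteq> K" if sub: "I \<subseteq> {a..<b} \<union> K"
  proof (rule ccontr)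
    assume "\<not> ?thesis"
    then obtain x y where xy: "x \<in> I" "y \<in> I" "x \<in> K" "y \<in> {a..<b}" using sub by blast
    then have "b \<in> I" using mem[of y x b] K[of x] gap(2) by simp
    then show False using sub gap(2) K by (metis UnE atLeastLessThan_iff less_irrefl not_less subsetD)
  qed
  moreover have "{a..<b} \<union> {b..<d} \<union> K \<subseteq> I" if sub: "{a..<b} \<union> K \<subseteq> I"
  proof -
    have "a \<in> I" "d \<in> I" using sub gap(1,3) by auto
    then have "{a..<d} \<subseteq> I" using mem[of a d] by auto
    then show ?thesis using sub dis(1) by blast
  qed
  ultimately have "I \<subseteq> {b..<d} \<or> I \<inter> ({a..<b} \<union> {b..<d} \<union> K) = {} \<or> I \<subseteq> {a..<b} \<or> I \<subseteq> K \<or> {a..<b} \<union> {b..<d} \<union> K \<subseteq> I"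
    using rel unfolding comparable_def by blast
  note comparable_pieces[OF dis(2-4) this]
  then show "comparable I {a..<b}" "comparable I {b..<d}" "comparable I {a..<d}" "comparable I K"
    "comparable I ({b..<d} \<union> K)" "comparable I ({a..<d} \<union> K)"
    by (simp_all only: dis(1))
qed

definition exch :: "(nat set \<Rightarrow> 'a::ratfun_algebra) \<Rightarrow> nat set \<Rightarrow> nat set \<Rightarrow> nat set \<Rightarrow> bool"
  where "exch c P Q R \<longleftrightarrow>
    c (P \<union> R) = - qcomm (c (P \<union> Q)) (c (Q \<union> R)) + c P * c R + c Q * c (P \<union> Q \<union> R)"

text \<open>With \<open>gap_induct\<close> this reduces a commutation to sets with fewer missing
  points.\<close>

lemma commute_exch:
  assumes "exch c P Q R" "x * c (P \<union> Q) = c (P \<union> Q) * x" "x * c (Q \<union> R) = c (Q \<union> R) * x"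
    "x * c P = c P * x" "x * c R = c R * x" "x * c Q = c Q * x" "x * c (P \<union> Q \<union> R) = c (P \<union> Q \<union> R) * x"
  shows "x * c (P \<union> R) = c (P \<union> R) * x"
  unfolding assms(1)[unfolded exch_def] using assms(2-)
  by (intro commute_add commute_mult) (auto simp: commute_qcomm)

text \<open>Index sets live in \<open>{1..<N}\<close>. The last assumption is the decreasing case of the quadruple relation,
  written without the elements attached to decreasing sequences.\<close>

locale aw_family =
  fixes c :: "nat set \<Rightarrow> 'a::ratfun_algebra" and N :: nat
  assumes c_empty: "c {} = 1"
    and intervals_commute: "\<lbrakk>{a..<b} \<subseteq> {1..<N}; {a'..<b'} \<subseteq> {1..<N}; {a..<b} \<inter> {a'..<b'} = {} \<or> {a..<b} \<subseteq> {a'..<b'}\<rbrakk>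
      \<Longrightarrow> c {a..<b} * c {a'..<b'} = c {a'..<b'} * c {a..<b}"
    and exch_first: "\<lbrakk>1 \<le> a; a < b; b < d; d \<in> K; K \<subseteq> {d..<N}\<rbrakk> \<Longrightarrow> exch c {a..<b} {b..<d} K"
    and exch_adj_L: "\<lbrakk>1 \<le> a; a < b; b < d; d < e; e \<le> N\<rbrakk> \<Longrightarrow> exch c {b..<d} {d..<e} {a..<b}"
    and exch_adj_R: "\<lbrakk>1 \<le> a; a < b; b < d; d < e; e \<le> N\<rbrakk> \<Longrightarrow> exch c {d..<e} {a..<b} {b..<d}"
    and exch_hole: "\<lbrakk>1 \<le> a; a < b; b < d; d < e; e < f; f \<le> N\<rbrakk> \<Longrightarrow> exch c {a..<b} {d..<e} {e..<f}"
    and upper: "\<lbrakk>1 \<le> a; a < b; b < d; d < e; e < f; f \<le> N\<rbrakk> \<Longrightarrow>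
      - qcomm (c {b..<f}) (c {a..<e}) + c {b..<e} * c {a..<f} =
      qcomm (qcomm (c {d..<f}) (c {b..<e})) (c {a..<d}) - c {d..<e} * qcomm (c {b..<f}) (c {a..<d})
      - c {b..<d} * qcomm (c {d..<f}) (c {a..<e}) + c {b..<d} * c {d..<e} * c {a..<f}"
begin

definition commutes :: "nat set \<Rightarrow> nat set \<Rightarrow> bool"
  where "commutes X Y \<longleftrightarrow> c X * c Y = c Y * c X"

lemma commutes_sym: "commutes X Y \<Longrightarrow> commutes Y X"
  by (simp add: commutes_def)

lemma commutes_empty [simp]: "commutes {} Y" "commutes Y {}"
  by (simp_all add: commutes_def c_empty)

lemma commutes_refl [simp]: "commutes Y Y"
  by (simp add: commutes_def)

lemma commutes_exch:
  assumes "exch c P Q R" "commutes X (P \<union> Q)" "commutes X (Q \<union> R)" "commutes X P" "commutes X R"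
    "commutes X Q" "commutes X (P \<union> Q \<union> R)"
  shows "commutes X (P \<union> R)"
  using commute_exch[OF assms(1)] assms(2-) unfolding commutes_def by blast

lemma intervals_commutes: "\<lbrakk>{a..<b} \<subseteq> {1..<N}; {a'..<b'} \<subseteq> {1..<N};
    {a..<b} \<inter> {a'..<b'} = {} \<or> {a..<b} \<subseteq> {a'..<b'} \<or> {a'..<b'} \<subseteq> {a..<b}\<rbrakk>
      \<Longrightarrow> commutes {a..<b} {a'..<b'}"
  unfolding commutes_def using intervals_commute[of a b a' b'] intervals_commute[of a' b' a b] by metis

lemma fin: "X \<subseteq> {1..<N} \<Longrightarrow> finite X"
  by (rule finite_subset) auto

text \<open>\<open>exch_first\<close> at the first gap of \<open>Y\<close> expresses
  \<open>c Y\<close> through sets that, by \<open>comparable_gap\<close>, stay comparable with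
  \<open>I\<close>.\<close>

lemma interval_commutes:
  assumes "I = {l..<u}" "I \<subseteq> {1..<N}" "Y \<subseteq> {1..<N}" "comparable I Y"
  shows "commutes I Y"
  using fin[OF assms(3)] assms(3,4)
proof (induction Y rule: gap_induct)
  case (interval a b)
  then show ?case
    using assms(2) unfolding assms(1) comparable_def by (intro intervals_commutes)
next
  case (gap a b d K)
  have U: "{a..<d} \<union> K \<subseteq> {1..<N}" "1 \<le> a" "K \<subseteq> {d..<N}"
  proof -
    have "a \<in> {1..<N}" "d \<in> {1..<N}" "K \<subseteq> {1..<N}" using gap by auto
    then show "1 \<le> a" "{a..<d} \<union> K \<subseteq> {1..<N}" by (auto simp: subset_iff)
    show "K \<subseteq> {d..<N}" using \<open>K \<subseteq> {1..<N}\<close> gap(4) by (auto simp: subset_iff)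
  qed
  have eq: "{a..<b} \<union> {b..<d} = {a..<d}" using gap by auto
  note r = comparable_gap[OF gap(1-4) assms(1) gap.prems(2)]
  have iv: "commutes I {x..<y}" if "{x..<y} \<subseteq> {a..<d}" "comparable I {x..<y}" for x y
    using assms(2) that U(1) unfolding assms(1) comparable_def by (intro intervals_commutes) blast+
  have sub: "{a..<b} \<subseteq> {a..<d}" "{b..<d} \<subseteq> {a..<d}" using gap by auto
  have "exch c {a..<b} {b..<d} K" using exch_first[OF U(2) gap(1,2,3) U(3)] .
  from commutes_exch[OF this, of I, unfolded eq] show ?case
    using iv[OF sub(1) r(1)] iv[OF sub(2) r(2)] iv[OF subset_refl r(3)] gap(6-8) r(4-6) U(1) sub by blast
qed simp_all

text \<open>The interval \<open>I\<close> shields \<open>X\<close> from \<open>Y\<close>: being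
  convex, it still contains every set obtained from \<open>X\<close> by filling gaps, so the
  induction on the gaps of \<open>X\<close> ends at intervals disjoint from
  \<open>Y\<close>.\<close>

lemma separated_commutes:
  assumes "X \<subseteq> I" "I = {l..<u}" "I \<inter> Y = {}" "I \<subseteq> {1..<N}" "Y \<subseteq> {1..<N}"
  shows "commutes X Y" "commutes Y X"
proof -
  have "X \<subseteq> I \<longrightarrow> commutes Y X"
    using fin[OF order_trans[OF assms(1,4)]]
  proof (induction X rule: gap_induct)
    case empty
    show ?case by simp
  next
    case (interval a b)
    show ?case
    proof
      assume "{a..<b} \<subseteq> I"
      then have "{a..<b} \<subseteq> {1..<N}" "{a..<b} \<inter> Y = {}" using assms by blast+
      then show "commutes Y {a..<b}" using interval_commutes[OF refl, of a b Y] assms(5) commutes_sym unfolding comparable_def by blast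
    qed
  next
    case (gap a b d K)
    show ?case
    proof
      assume Y: "{a..<b} \<union> K \<subseteq> I"
      then have "l \<le> a" "d < u" using gap assms(2) by auto
      then have sub: "{a..<d} \<subseteq> I" using assms(2) by auto
      have eq: "{a..<b} \<union> {b..<d} = {a..<d}" "{a..<b} \<union> {b..<d} \<union> K = {a..<d} \<union> K" using gap by auto
      have iv: "commutes Y {x..<y}" if "{x..<y} \<subseteq> {a..<d}" for x y
      proof -
        have "{x..<y} \<subseteq> {1..<N}" "{x..<y} \<inter> Y = {}" using that sub assms by blast+
        then show ?thesis using interval_commutes[OF refl, of x y Y] assms(5) commutes_sym unfolding comparable_def by blast
      qed
      have "a \<in> {a..<b}" using gap(1) by simp
      then have "a \<in> {1..<N}" "K \<subseteq> {1..<N}" using Y assms(4) by blast+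
      then have a1: "1 \<le> a" "K \<subseteq> {d..<N}" using gap(4) by (auto simp: subset_iff)
      have "exch c {a..<b} {b..<d} K" using exch_first[OF a1(1) gap(1,2,3) a1(2)] .
      moreover have "{a..<b} \<subseteq> {a..<d}" "{b..<d} \<subseteq> {a..<d}" using gap by auto
      ultimately show "commutes Y ({a..<b} \<union> K)"
        using commutes_exch[of "{a..<b}" "{b..<d}" K Y, unfolded eq] iv gap(6-8) Y sub by blast
    qed
  qed
  then show "commutes Y X" using assms by blast
  then show "commutes X Y" by (rule commutes_sym)
qed

end

lemma subset_ivl: "X \<subseteq> {l..<u} \<Longrightarrow> l' \<le> l \<Longrightarrow> u \<le> u' \<Longrightarrow> X \<subseteq> {l'..<u'::nat}"
  by (rule order_trans) auto

section \<open>Reflection of the line\<close>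

definition mirror :: "nat \<Rightarrow> nat set \<Rightarrow> nat set"
  where "mirror n X = (\<lambda>i. n - i) ` X"

lemma mirror_Un [simp]: "mirror n (X \<union> Y) = mirror n X \<union> mirror n Y"
  by (simp add: mirror_def image_Un)

lemma mirror_empty [simp]: "mirror n {} = {}"
  by (simp add: mirror_def)

text \<open>The shift by one comes from half-open intervals: i with l \<le> i < u is sent to n - i
  with n - u < n - i \<le> n - l.\<close>

lemma mirror_subset: "X \<subseteq> {l..<u} \<Longrightarrow> u \<le> n \<Longrightarrow> mirror n X \<subseteq> {n + 1 - u..<n + 1 - l}"
  by (force simp: mirror_def)

lemma mirror_mirror: "X \<subseteq> {1..<n} \<Longrightarrow> mirror n (mirror n X) = X"
proof -
  assume "X \<subseteq> {1..<n}"
  then have "n - (n - x) = x" if "x \<in> X" for x using that by auto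
  then show ?thesis unfolding mirror_def image_image by simp
qed

lemma mem_mirror:
  assumes "X \<subseteq> {1..<n}"
  shows "x \<in> mirror n X \<longleftrightarrow> 1 \<le> x \<and> x < n \<and> n - x \<in> X"
proof
  assume "x \<in> mirror n X"
  then obtain i where i: "i \<in> X" "x = n - i" by (auto simp: mirror_def)
  then have "i \<in> {1..<n}" using assms by blast
  then show "1 \<le> x \<and> x < n \<and> n - x \<in> X" using i by auto
next
  assume "1 \<le> x \<and> x < n \<and> n - x \<in> X"
  then show "x \<in> mirror n X" unfolding mirror_def by (intro image_eqI[of _ _ "n - x"]) auto
qed

lemma mirror_interval:
  assumes "1 \<le> a" "b \<le> n"
  shows "mirror n {a..<b} = {n + 1 - b..<n + 1 - a}"
proof -
  have "{a..<b} \<subseteq> {1..<n}" using assms by auto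
  then show ?thesis using assms by (auto simp: mem_mirror)
qed

context aw_family
begin

abbreviation c' :: "nat set \<Rightarrow> 'a op" where "c' \<equiv> \<lambda>X. Op (c (mirror N X))"

lemma commutesI: "commutes X Y \<Longrightarrow> c X * c Y = c Y * c X"
  by (simp add: commutes_def)

lemma exch_empty_left: "commutes Q (Q \<union> R) \<Longrightarrow> exch c {} Q R"
  by (simp add: exch_def commutes_def c_empty qcomm_commuting)

lemma exch_empty_middle: "commutes P R \<Longrightarrow> exch c P {} R"
  by (simp add: exch_def commutes_def c_empty qcomm_commuting)

lemma exch_empty_right: "commutes Q (P \<union> Q) \<Longrightarrow> exch c P Q {}"
  by (simp add: exch_def commutes_def c_empty qcomm_commuting)

lemma exch_gap_left:
  assumes "a < b" "b < d"
    and fill: "\<And>S. S \<in> {K, K \<union> Y, K \<union> Z, K \<union> Y \<union> Z} \<Longrightarrow> exch c {a..<b} {b..<d} S"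
    and IH: "exch c ({b..<d} \<union> K) Y Z" "exch c K Y Z" "exch c ({a..<d} \<union> K) Y Z"
    and cm: "\<And>x y S. a \<le> x \<Longrightarrow> y \<le> d \<Longrightarrow> S \<in> {Y, Z, Y \<union> Z} \<Longrightarrow> commutes {x..<y} S"
  shows "exch c ({a..<b} \<union> K) Y Z"
proof -
  have sp: "{a..<d} = {a..<b} \<union> {b..<d}" using assms(1,2) by auto
  note f = fill[of "K \<union> Z", simplified] fill[of "K \<union> Y", simplified] fill[of K, simplified] fill[of "K \<union> Y \<union> Z", simplified]
  have cm': "commutes {a..<d} (Y \<union> Z)" "commutes {a..<d} Z" "commutes Y {a..<d}" "commutes {a..<b} (Y \<union> Z)"
    "commutes {b..<d} (Y \<union> Z)" "commutes {a..<b} Y" "commutes {b..<d} Y"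
    using assms(1,2) by (auto intro!: cm commutes_sym[of _ Y])
  show ?thesis
    using f IH cm' apply -
    apply (unfold sp)
    apply (unfold exch_def commutes_def)
    apply (simp (no_asm_use) only: Un_ac)
    apply (rule gap_left_ring; assumption)
    done
qed

lemma commutes_apart:
  assumes "X \<subseteq> {l..<u}" "Y \<subseteq> {l'..<u'}" "u \<le> l'" "1 \<le> l" "u' \<le> N"
  shows "commutes X Y" "commutes Y X"
proof -
  have "commutes X Y \<and> commutes Y X"
  proof (cases "X = {} \<or> Y = {}")
    case False
    then have "l < u" "l' < u'" using assms(1,2) by auto
    then have "{l..<u} \<subseteq> {1..<N}" "Y \<subseteq> {1..<N}" "{l..<u} \<inter> Y = {}"
      using assms(2-5) by (auto simp: subset_ivl)
    then show ?thesis
      using separated_commutes[OF assms(1) refl] by blast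
  qed auto
  then show "commutes X Y" "commutes Y X" by blast+
qed

lemma commutes_nested:
  assumes "S \<subseteq> {1..<N}" "{x..<y} \<subseteq> S"
  shows "commutes {x..<y} S" "commutes S {x..<y}"
  using interval_commutes[OF refl, of x y S] assms commutes_sym unfolding comparable_def by blast+

text \<open>This says that the defining recursion may be carried out at any hole and not only at the
  first one. It is also what the reflection of \<open>exch_first\<close> requires.\<close>

lemma exch_fill:
  assumes "P \<subseteq> {1..<b}" "b - 1 \<in> P" "b < d" "d \<in> R" "R \<subseteq> {d..<N}"
  shows "exch c P {b..<d} R"
proof -
  have "finite P" using assms(1) finite_subset by auto
  then show ?thesis using assms(1,2)
  proof (induction P rule: gap_induct)
    case empty
    then show ?case by simp
  next
    case (interval a b')
    then have "b' = b" "1 \<le> a" by auto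
    then show ?case using exch_first[of a b d R] interval assms(3-) by simp
  next
    case (gap a b1 d1 K)
    have "a \<in> {1..<b}" "d1 \<in> {1..<b}" "b - 1 \<notin> {a..<b1}" "d \<in> {d..<N}" using gap assms(3-5) by auto
    then have K: "K \<subseteq> {d1..<b}" "b - 1 \<in> K" "d1 < b" "1 \<le> a" "d < N"
      using gap(4,9,10) by (auto simp: subset_iff)
    have sp: "{a..<d1} = {a..<b1} \<union> {b1..<d1}" using gap(1,2) by auto
    have 1: "exch c {a..<b1} {b1..<d1} S" if "K \<subseteq> S" "S \<subseteq> {d1..<N}" for S
      using exch_first[OF K(4) gap(1,2)] that gap(3) by blast
    note bd = K(1)[THEN subset_ivl] assms(5)[THEN subset_ivl]
    have cm: "commutes {x..<y} S" "commutes S {x..<y}" if "a \<le> x" "y \<le> d1" "S \<subseteq> {b..<N}" for x y S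
      using commutes_apart[of "{x..<y}" x y S b N] that K by auto
    have S: "{b..<d} \<union> R \<subseteq> {b..<N}" "R \<subseteq> {b..<N}" "{b..<d} \<subseteq> {b..<N}" using assms(3) K by (auto simp: bd)
    have IH: "exch c K {b..<d} R" "exch c ({b1..<d1} \<union> K) {b..<d} R" "exch c ({a..<d1} \<union> K) {b..<d} R"
      by (intro gap(6-8); use K gap(1,2) in \<open>auto simp: bd\<close>)+
    show ?case
    proof (rule exch_gap_left[OF gap(1,2) _ IH(2,1,3)])
      fix S assume "S \<in> {K, K \<union> {b..<d}, K \<union> R, K \<union> {b..<d} \<union> R}"
      then show "exch c {a..<b1} {b1..<d1} S"
        using K assms(3) by (elim insertE emptyE) (simp_all add: 1 bd le_supI1)
    next
      fix x y S assume "a \<le> x" "y \<le> d1" "S \<in> {{b..<d}, R, {b..<d} \<union> R}"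
      then show "commutes {x..<y} S" using S by (intro cm(1)) auto
    qed
  qed
qed

lemma exch_exchange_hole:
  assumes "exch c X H Y" "exch c X H (Y \<union> Z)" "exch c H Y Z" "exch c (X \<union> H) Y Z"
    and cm: "commutes (X \<union> H) (Y \<union> Z)" "commutes X (Y \<union> Z)" "commutes H (Y \<union> Z)" "commutes Y (Y \<union> Z)"
     "commutes H (X \<union> H)" "commutes Y (X \<union> H)" "commutes X Y" "commutes H Y" "commutes Z (X \<union> H)"
  shows "exch c X H Z \<longleftrightarrow> exch c X Y Z"
  using assms apply -
  apply (unfold exch_def commutes_def)
  apply (simp (no_asm_use) only: Un_ac)
  apply (rule gap_between_ring; assumption)
  done

text \<open>Reversing all products restores the order of the blocks, except in the product of the
  middle element with the full one, which the second hypothesis swaps back.\<close>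

lemma exch_Op:
  assumes "exch c (mirror N R) (mirror N Q) (mirror N P)" "commutes (mirror N Q) (mirror N P \<union> mirror N Q \<union> mirror N R)"
  shows "exch c' P Q R"
proof -
  have eq: "mirror N P \<union> mirror N Q \<union> mirror N R = mirror N R \<union> mirror N Q \<union> mirror N P" by blast
  have sw: "c (mirror N Q) * c (mirror N R \<union> mirror N Q \<union> mirror N P) =
     c (mirror N P \<union> mirror N Q \<union> mirror N R) * c (mirror N Q)"
    using assms(2) unfolding commutes_def eq .
  have "c' (P \<union> R) = Op (c (mirror N R \<union> mirror N P))" by (simp add: Un_commute)
  also have "\<dots> = - qcomm (c' (P \<union> Q)) (c' (Q \<union> R)) + c' P * c' R + c' Q * c' (P \<union> Q \<union> R)"
    unfolding assms(1)[unfolded exch_def] sw Op_add Op_minus Op_qcomm Op_mult mirror_Un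
    by (simp only: Un_commute)
  finally show ?thesis unfolding exch_def .
qed

text \<open>The locale only provides a middle block touching the right neighbour.
  \<open>exch_exchange_hole\<close> trades it for the rest of the hole, which touches the left
  one.\<close>

lemma exch_hole_right:
  assumes "1 \<le> a" "a < b" "b < d" "d < e" "e < f" "f \<le> N"
  shows "exch c {a..<b} {b..<d} {e..<f}"
proof -
  have eq: "{d..<e} \<union> {e..<f} = {d..<f}" "{a..<b} \<union> {b..<d} = {a..<d}" using assms by auto
  have cm: "commutes {x..<y} {x'..<y'}" "commutes {x'..<y'} {x..<y}" if "a \<le> x" "y \<le> x'" "y' \<le> f" for x y x' y'
    using that assms commutes_apart[of "{x..<y}" x y "{x'..<y'}" x' y'] by simp_all
  have "exch c {a..<b} {b..<d} {e..<f} \<longleftrightarrow> exch c {a..<b} {d..<e} {e..<f}"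
  proof (rule exch_exchange_hole, unfold eq)
    show "exch c {a..<b} {b..<d} {d..<e}" "exch c {a..<b} {b..<d} {d..<f}" "exch c {b..<d} {d..<e} {e..<f}"
      "exch c {a..<d} {d..<e} {e..<f}"
      using assms by (auto intro!: exch_first)
    show "commutes {d..<e} {d..<f}" "commutes {b..<d} {a..<d}"
      using assms by (auto intro!: intervals_commutes)
  qed (use assms cm in auto)
  then show ?thesis using exch_hole assms by blast
qed

text \<open>Each axiom reflects into something already available: \<open>exch_first\<close> into
  \<open>exch_fill\<close>, the two adjacent relations into each other, \<open>exch_hole\<close>
  into \<open>exch_hole_right\<close>, and \<open>upper\<close> into itself.\<close>

lemma mirror_family: "aw_family c' N"
proof
  show "c' {} = 1" by (simp add: c_empty Op_one)
next
  fix a b a' b' assume ab: "{a..<b} \<subseteq> {1..<N}" "{a'..<b'} \<subseteq> {1..<N}" "{a..<b} \<inter> {a'..<b'} = {} \<or> {a..<b} \<subseteq> {a'..<b'}"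
  show "c' {a..<b} * c' {a'..<b'} = c' {a'..<b'} * c' {a..<b}"
  proof (cases "a < b \<and> a' < b'")
    case True
    then have m: "mirror N {a..<b} = {N + 1 - b..<N + 1 - a}" "mirror N {a'..<b'} = {N + 1 - b'..<N + 1 - a'}"
      using ab by (simp_all add: mirror_interval)
    from ab(3) True have "b \<le> a' \<or> b' \<le> a \<or> a' \<le> a \<and> b \<le> b'" by (auto simp: disjoint_iff not_le)
    then have "{N + 1 - b..<N + 1 - a} \<inter> {N + 1 - b'..<N + 1 - a'} = {} \<or> {N + 1 - b..<N + 1 - a} \<subseteq> {N + 1 - b'..<N + 1 - a'}"
      using ab(1,2) True by (elim disjE) (auto simp: disjoint_iff diff_le_mono2)
    then have "commutes (mirror N {a..<b}) (mirror N {a'..<b'})"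
      unfolding m using ab(1,2) True by (intro intervals_commutes) auto
    then show ?thesis by (simp add: commutes_def flip: Op_mult)
  qed (auto simp: c_empty Op_one)
next
  fix a b d K assume K: "1 \<le> a" "a < b" "b < d" "d \<in> K" "K \<subseteq> {d..<N}"
  then have "d < N" by auto
  have KN: "K \<subseteq> {1..<N}" using K by (simp add: subset_ivl[OF K(5)])
  have m: "mirror N {a..<b} = {N + 1 - b..<N + 1 - a}" "mirror N {b..<d} = {N + 1 - d..<N + 1 - b}"
    using K \<open>d < N\<close> by (simp_all add: mirror_interval)
  have mK: "mirror N K \<subseteq> {1..<N + 1 - d}" "N - d \<in> mirror N K"
    using mirror_subset[OF K(5) order_refl] K(3,4) \<open>d < N\<close> by (simp_all add: mem_mirror[OF KN])
  show "exch c' {a..<b} {b..<d} K"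
  proof (rule exch_Op)
    show "exch c (mirror N K) (mirror N {b..<d}) (mirror N {a..<b})"
      unfolding m using K mK \<open>d < N\<close> by (intro exch_fill) auto
    show "commutes (mirror N {b..<d}) (mirror N {a..<b} \<union> mirror N {b..<d} \<union> mirror N K)"
      unfolding m using K mK \<open>d < N\<close> by (intro commutes_nested) (auto simp: subset_ivl[OF mK(1)] le_supI1)
  qed
next
  fix a b d e assume A: "1 \<le> a" "a < b" "b < d" "d < e" "e \<le> N"
  then have m: "mirror N {a..<b} = {N + 1 - b..<N + 1 - a}" "mirror N {b..<d} = {N + 1 - d..<N + 1 - b}" "mirror N {d..<e} = {N + 1 - e..<N + 1 - d}"
    by (simp_all add: mirror_interval)
  show "exch c' {b..<d} {d..<e} {a..<b}"
  proof (rule exch_Op, unfold m)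
    show "exch c {N + 1 - b..<N + 1 - a} {N + 1 - e..<N + 1 - d} {N + 1 - d..<N + 1 - b}"
      using A by (intro exch_adj_R) auto
    show "commutes {N + 1 - e..<N + 1 - d} ({N + 1 - d..<N + 1 - b} \<union> {N + 1 - e..<N + 1 - d} \<union> {N + 1 - b..<N + 1 - a})"
      using A by (intro commutes_nested) auto
  qed
  show "exch c' {d..<e} {a..<b} {b..<d}"
  proof (rule exch_Op, unfold m)
    show "exch c {N + 1 - d..<N + 1 - b} {N + 1 - b..<N + 1 - a} {N + 1 - e..<N + 1 - d}"
      using A by (intro exch_adj_L) auto
    show "commutes {N + 1 - b..<N + 1 - a} ({N + 1 - e..<N + 1 - d} \<union> {N + 1 - b..<N + 1 - a} \<union> {N + 1 - d..<N + 1 - b})"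
      using A by (intro commutes_nested) auto
  qed
next
  fix a b d e f assume A: "1 \<le> a" "a < b" "b < d" "d < e" "e < f" "f \<le> N"
  then have m: "mirror N {x..<y} = {N + 1 - y..<N + 1 - x}" if "a \<le> x" "y \<le> f" for x y
    using that by (intro mirror_interval) auto
  show "exch c' {a..<b} {d..<e} {e..<f}"
  proof (rule exch_Op)
    show "exch c (mirror N {e..<f}) (mirror N {d..<e}) (mirror N {a..<b})"
      using A by (simp add: m, intro exch_hole_right) auto
    show "commutes (mirror N {d..<e}) (mirror N {a..<b} \<union> mirror N {d..<e} \<union> mirror N {e..<f})"
      using A by (simp add: m, intro commutes_nested) auto
  qed
  let ?m = "\<lambda>x y. c {N + 1 - y..<N + 1 - x}"
  have cm: "commutes {N + 1 - d..<N + 1 - a} {N + 1 - f..<N + 1 - d}" "commutes {N + 1 - d..<N + 1 - b} {N + 1 - e..<N + 1 - d}"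
    "commutes {N + 1 - d..<N + 1 - b} {N + 1 - f..<N + 1 - a}" "commutes {N + 1 - e..<N + 1 - d} {N + 1 - f..<N + 1 - a}"
    "commutes {N + 1 - e..<N + 1 - b} {N + 1 - f..<N + 1 - a}"
    "commutes {N + 1 - e..<N + 1 - d} {N + 1 - d..<N + 1 - a}" "commutes {N + 1 - e..<N + 1 - d} {N + 1 - f..<N + 1 - b}"
    "commutes {N + 1 - d..<N + 1 - b} {N + 1 - e..<N + 1 - a}" "commutes {N + 1 - d..<N + 1 - b} {N + 1 - f..<N + 1 - d}"
    using A by (auto intro!: intervals_commutes)
  have "- qcomm (?m a e) (?m b f) + ?m b e * ?m a f =
      qcomm (qcomm (?m a d) (?m b e)) (?m d f) - ?m b d * qcomm (?m a e) (?m d f)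
      - ?m d e * qcomm (?m a d) (?m b f) + ?m d e * ?m b d * ?m a f"
    using upper[of "N + 1 - f" "N + 1 - e" "N + 1 - d" "N + 1 - b" "N + 1 - a"] A by simp
  \<comment> \<open>The outer intervals are disjoint, so the double q-commutator can be rebracketed;
    this makes \<open>upper\<close> invariant under reversal.\<close>
  moreover have "qcomm (qcomm (?m a d) (?m b e)) (?m d f) = qcomm (?m a d) (qcomm (?m b e) (?m d f))"
    by (rule qcomm_assoc) (rule cm(1)[unfolded commutes_def])
  ultimately have U: "- qcomm (?m a e) (?m b f) + ?m a f * ?m b e =
     qcomm (?m a d) (qcomm (?m b e) (?m d f)) - qcomm (?m a d) (?m b f) * ?m d e
      - qcomm (?m a e) (?m d f) * ?m b d + ?m a f * (?m d e * ?m b d)"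
    using commute_qcomm[OF cm(6,7)[unfolded commutes_def]] commute_qcomm[OF cm(8,9)[unfolded commutes_def]]
      commute_mult[OF cm(4,3)[THEN commutes_sym, unfolded commutes_def]] cm(5)[unfolded commutes_def]
    by (simp add: algebra_simps)
  show "- qcomm (c' {b..<f}) (c' {a..<e}) + c' {b..<e} * c' {a..<f} =
      qcomm (qcomm (c' {d..<f}) (c' {b..<e})) (c' {a..<d}) - c' {d..<e} * qcomm (c' {b..<f}) (c' {a..<d})
      - c' {b..<d} * qcomm (c' {d..<f}) (c' {a..<e}) + c' {b..<d} * c' {d..<e} * c' {a..<f}"
    using A arg_cong[OF U, of Op] by (simp add: m Op_add Op_diff Op_minus Op_mult Op_qcomm mult.assoc)
qed

lemma finite_ivl_subset: "X \<subseteq> {l..<u::nat} \<Longrightarrow> finite X"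
  by (rule finite_subset) auto

lemma Un_ivl: "x \<le> y \<Longrightarrow> y \<le> z \<Longrightarrow> {x..<y} \<union> {y..<z} = {x..<z::nat}"
  "x \<le> y \<Longrightarrow> y \<le> z \<Longrightarrow> {y..<z} \<union> {x..<y} = {x..<z::nat}"
  by auto

lemma gap_bounds:
  fixes a b d l u :: nat
  assumes "{a..<b} \<union> K \<subseteq> {l..<u}" "a < b" "b < d" "d \<in> K" "K \<subseteq> {d..}"
  shows "l \<le> a" "K \<subseteq> {d..<u}" "d < u" "{b..<d} \<union> K \<subseteq> {l..<u}" "{a..<d} \<union> K \<subseteq> {l..<u}" "K \<subseteq> {l..<u}"
proof -
  have "a \<in> {l..<u}" "d \<in> {l..<u}" "K \<subseteq> {l..<u}" using assms by auto
  then show "l \<le> a" "d < u" "K \<subseteq> {l..<u}" by auto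
  then show 1: "K \<subseteq> {d..<u}" using assms(5) by (auto simp: subset_iff)
  show "{b..<d} \<union> K \<subseteq> {l..<u}" "{a..<d} \<union> K \<subseteq> {l..<u}"
    using \<open>l \<le> a\<close> \<open>d < u\<close> \<open>K \<subseteq> {l..<u}\<close> assms(2,3) by auto
qed

lemma exch_from_mirror:
  assumes "exch c' (mirror N R) (mirror N Q) (mirror N P)" "commutes Q (P \<union> Q \<union> R)"
    "P \<subseteq> {1..<N}" "Q \<subseteq> {1..<N}" "R \<subseteq> {1..<N}"
  shows "exch c P Q R"
proof -
  have "Op (c (R \<union> P)) = - qcomm (Op (c (R \<union> Q))) (Op (c (Q \<union> P))) + Op (c R) * Op (c P) + Op (c Q) * Op (c (R \<union> Q \<union> P))"
    using assms(1,3-5) unfolding exch_def by (simp add: mirror_mirror)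
  also have "\<dots> = Op (- qcomm (c (Q \<union> P)) (c (R \<union> Q)) + c P * c R + c (R \<union> Q \<union> P) * c Q)"
    by (simp add: Op_add Op_minus Op_mult Op_qcomm Op_diff)
  also have "c (R \<union> Q \<union> P) * c Q = c Q * c (P \<union> Q \<union> R)"
    using assms(2) unfolding commutes_def by (simp add: ac_simps)
  finally show ?thesis unfolding exch_def Op_eq_iff by (simp only: Un_commute)
qed

text \<open>All sets used to fill gaps of \<open>P\<close> stay below \<open>l\<close>, so they
  commute with what belongs to \<open>Y\<close> and \<open>Z\<close>, and
  \<open>exch_gap_left\<close> applies at every step.\<close>

lemma exch_left_induct:
  assumes P: "P \<subseteq> {1..<l}" and YZ: "Y \<subseteq> {l..<N}" "Z \<subseteq> {l..<N}"
    and base: "exch c {} Y Z" "\<And>a p. 1 \<le> a \<Longrightarrow> a < p \<Longrightarrow> p \<le> l \<Longrightarrow> exch c {a..<p} Y Z"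
  shows "exch c P Y Z"
  using finite_ivl_subset[OF P] P
proof (induction P rule: gap_induct)
  case (interval a b)
  then show ?case using base(2)[of a b] by simp
next
  case (gap a b d K)
  note B = gap_bounds[OF gap.prems gap(1-4)]
  show ?case
  proof (cases "Y \<union> Z = {}")
    case False
    then have "l < N" using YZ by auto
    show ?thesis
    proof (rule exch_gap_left[OF gap(1,2) _ gap(7)[OF B(4)] gap(6)[OF B(6)] gap(8)[OF B(5)]])
      fix S assume "S \<in> {K, K \<union> Y, K \<union> Z, K \<union> Y \<union> Z}"
      then have "S \<subseteq> {d..<N}" "d \<in> S"
        using gap(3) B(3) \<open>l < N\<close>
        by (elim insertE emptyE, simp_all add: subset_ivl[OF B(2)] subset_ivl[OF YZ(1)] subset_ivl[OF YZ(2)])+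
      then show "exch c {a..<b} {b..<d} S" using exch_first[OF B(1) gap(1,2)] by blast
    next
      fix x y S assume A: "a \<le> x" "y \<le> d" "S \<in> {Y, Z, Y \<union> Z}"
      then have "S \<subseteq> {l..<N}" using YZ by auto
      then show "commutes {x..<y} S"
        using commutes_apart[of "{x..<y}" x y S l N] A B by simp
    qed
  qed (simp add: exch_empty_middle)
qed (rule base(1))

lemma exch_middle_adjacent:
  assumes "P \<subseteq> {1..<b}" "1 \<le> b" "b < d" "d < e" "e \<le> N"
  shows "exch c P {b..<d} {d..<e}"
proof (rule exch_left_induct[OF assms(1)])
  show "exch c {} {b..<d} {d..<e}"
    using assms by (intro exch_empty_left commutes_nested) (simp_all add: Un_ivl)
  fix a p assume "1 \<le> a" "a < p" "p \<le> b"
  then show "exch c {a..<p} {b..<d} {d..<e}"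
    using assms exch_hole[of a p b d e] exch_first[of a b d "{d..<e}"] by (cases "p = b") auto
qed (use assms in auto)

end

text \<open>The reflection of \<open>exch_middle_adjacent\<close>: now the first block is the
  interval that touches the middle one, and the third is arbitrary.\<close>

lemma (in aw_family) exch_adjacent_middle:
  assumes "1 \<le> a" "a < b" "b < d" "R \<subseteq> {d..<N}" "d \<le> N"
  shows "exch c {a..<b} {b..<d} R"
proof -
  interpret m: aw_family c' N by (rule mirror_family)
  have R: "R \<subseteq> {1..<N}" using assms by (simp add: subset_ivl[OF assms(4)])
  have mR: "mirror N R \<subseteq> {1..<N + 1 - d}" using mirror_subset[OF assms(4) order_refl] by simp
  have mI: "mirror N {a..<b} = {N + 1 - b..<N + 1 - a}" "mirror N {b..<d} = {N + 1 - d..<N + 1 - b}"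
    using assms by (simp_all add: mirror_interval)
  have "exch c' (mirror N R) {N + 1 - d..<N + 1 - b} {N + 1 - b..<N + 1 - a}"
    using assms mR by (intro m.exch_middle_adjacent) simp_all
  then show ?thesis
    by (intro exch_from_mirror) (use assms mI R in \<open>auto intro!: commutes_nested\<close>)
qed

section \<open>Wrap-around exchange relations\<close>

context aw_family
begin

lemma exch_middle:
  assumes P: "P \<subseteq> {1..<b}" and b: "1 \<le> b" "b < d" "d \<le> N" and R: "R \<subseteq> {d..<N}"
  shows "exch c P {b..<d} R"
proof (rule exch_left_induct[OF P])
  show "{b..<d} \<subseteq> {b..<N}" "R \<subseteq> {b..<N}" using b by (simp_all add: subset_ivl[OF R])
  show "exch c {} {b..<d} R"
    using b by (intro exch_empty_left commutes_nested) (simp_all add: subset_ivl[OF R])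
  fix a p assume a: "1 \<le> a" "a < p" "p \<le> b"
  show "exch c {a..<p} {b..<d} R"
  proof (cases "p = b")
    case True
    then show ?thesis using exch_adjacent_middle[of a b d R] a b R by simp
  next
    case False
    have ap: "commutes {x..<y} S" "commutes S {x..<y}" if "1 \<le> x" "y \<le> b" "S \<subseteq> {b..<N}" for x y S
      using commutes_apart[of "{x..<y}" x y S b N] that by simp_all
    \<comment> \<open>The part \<open>{p..<b}\<close> of the hole touches the first block, where the
      relation is already known; it is traded for \<open>{b..<d}\<close>.\<close>
    have "exch c {a..<p} {p..<b} R \<longleftrightarrow> exch c {a..<p} {b..<d} R"
    proof (rule exch_exchange_hole)
      show "exch c {a..<p} {p..<b} {b..<d}" "exch c {a..<p} {p..<b} ({b..<d} \<union> R)"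
        using a b False by (simp_all add: exch_adjacent_middle subset_ivl[OF R])
      show "exch c {p..<b} {b..<d} R"
        using a b False R by (simp add: exch_adjacent_middle)
      show "exch c ({a..<p} \<union> {p..<b}) {b..<d} R"
        using a b R by (simp add: exch_adjacent_middle Un_ivl)
      show "commutes {b..<d} ({b..<d} \<union> R)"
        using b by (intro commutes_nested) (simp_all add: subset_ivl[OF R])
      show "commutes {p..<b} ({a..<p} \<union> {p..<b})"
        using a b by (intro commutes_nested) (simp_all)
      show "commutes ({a..<p} \<union> {p..<b}) ({b..<d} \<union> R)" "commutes {b..<d} ({a..<p} \<union> {p..<b})" "commutes R ({a..<p} \<union> {p..<b})"
        using a b by (simp_all add: Un_ivl ap subset_ivl[OF R])
      show "commutes {a..<p} ({b..<d} \<union> R)" "commutes {p..<b} ({b..<d} \<union> R)" "commutes {a..<p} {b..<d}" "commutes {p..<b} {b..<d}"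
        using a b by (simp_all add: ap subset_ivl[OF R])
    qed
    moreover have "exch c {a..<p} {p..<b} R"
      using a b False by (simp add: exch_adjacent_middle subset_ivl[OF R])
    ultimately show ?thesis by blast
  qed
qed

lemma commutes_between:
  assumes "S1 \<subseteq> {1..<x}" "S2 \<subseteq> {y..<N}" "1 \<le> x" "y \<le> N"
  shows "commutes {x..<y} (S1 \<union> S2)" "commutes (S1 \<union> S2) {x..<y}"
    "commutes {x..<y} (S2 \<union> S1)" "commutes (S2 \<union> S1) {x..<y}"
proof -
  have "commutes {x..<y} (S1 \<union> S2)"
  proof (cases "x < y")
    case True
    then have "S1 \<subseteq> {1..<N}" "S2 \<subseteq> {1..<N}"
      using assms by (simp_all add: subset_ivl[OF assms(1)] subset_ivl[OF assms(2)])
    moreover have "{x..<y} \<inter> S1 = {}" "{x..<y} \<inter> S2 = {}" using assms by auto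
    ultimately show ?thesis
      using True assms by (intro interval_commutes[OF refl]) (auto simp: comparable_def)
  qed simp
  then show "commutes {x..<y} (S1 \<union> S2)" "commutes (S1 \<union> S2) {x..<y}"
    "commutes {x..<y} (S2 \<union> S1)" "commutes (S2 \<union> S1) {x..<y}"
    by (simp_all add: Un_commute commutes_sym)
qed

lemma exch_wrap_gap4:
  assumes "exch c (P \<union> Q \<union> A) G K" "exch c (P \<union> H \<union> A) G K" "exch c (P \<union> A) G K" "exch c (P \<union> Q \<union> H \<union> A) G K"
    "exch c Q H (A \<union> G \<union> P)" "exch c Q H (A \<union> P)" "exch c Q H (A \<union> G \<union> K \<union> P)"
    "commutes (Q \<union> H) (G \<union> K)" "commutes Q (G \<union> K)" "commutes H (G \<union> K)" "commutes G (Q \<union> H)" "commutes K (Q \<union> H)"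
    "commutes G Q" "commutes G H"
  shows "exch c Q H (A \<union> K \<union> P)"
  using assms apply -
  apply (unfold exch_def commutes_def)
  apply (simp (no_asm_use) only: Un_ac)
  apply (rule W_gap4_ring; assumption)
  done

lemma exch_wrap_gap1:
  assumes "exch c A G (K \<union> Q \<union> R)" "exch c A G (K \<union> H \<union> R)" "exch c A G (K \<union> R)" "exch c A G (K \<union> Q \<union> H \<union> R)"
    "exch c Q H (R \<union> G \<union> K)" "exch c Q H (R \<union> K)" "exch c Q H (R \<union> A \<union> G \<union> K)"
    "commutes (Q \<union> H) (A \<union> G)" "commutes Q (A \<union> G)" "commutes H (A \<union> G)" "commutes G (Q \<union> H)" "commutes A (Q \<union> H)"
    "commutes G Q" "commutes G H" "commutes A Q" "commutes A H"
  shows "exch c Q H (R \<union> A \<union> K)"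
  using assms apply -
  apply (unfold exch_def commutes_def)
  apply (simp (no_asm_use) only: Un_ac)
  apply (rule W_gap1_ring; assumption)
  done

lemma exch_wrap_gap2:
  assumes "exch c A G (K \<union> H)" "exch c A G K" "exch c A G (K \<union> R \<union> P)" "exch c A G (K \<union> H \<union> R \<union> P)"
    "exch c (G \<union> K) H (R \<union> P)" "exch c K H (R \<union> P)" "exch c (A \<union> G \<union> K) H (R \<union> P)"
    "commutes (A \<union> G) (P \<union> H \<union> R)" "commutes (A \<union> G) (P \<union> R)" "commutes H (A \<union> G)" "commutes A (P \<union> H \<union> R)" "commutes G (P \<union> H \<union> R)"
    "commutes A H" "commutes G H"
  shows "exch c (A \<union> K) H (R \<union> P)"
  using assms apply -
  apply (unfold exch_def commutes_def)
  apply (simp (no_asm_use) only: Un_ac)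
  apply (rule W_gap2_ring; assumption)
  done

text \<open>Gaps of \<open>R\<close> are closed by \<open>exch_wrap_gap4\<close>. The free space
  between \<open>e\<close> and an interval that starts later counts as a gap too (\<open>A\<close>
  empty, \<open>x = e\<close>), so only intervals touching the middle block remain.\<close>

lemma exch_wrap_induct4:
  assumes P: "P \<subseteq> {1..<l}" and Q: "Q \<subseteq> {l..<d}" and R: "R \<subseteq> {e..<N}" and le: "1 \<le> l" "l \<le> d" "d < e" "e \<le> N"
    and empty: "exch c Q {d..<e} P" and adj: "\<And>f. e < f \<Longrightarrow> f \<le> N \<Longrightarrow> exch c Q {d..<e} ({e..<f} \<union> P)"
  shows "exch c Q {d..<e} (R \<union> P)"
proof -
  have ap: "commutes X Y \<and> commutes Y X" if "X \<subseteq> {1..<e}" "Y \<subseteq> {e..<N}" for X Y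
    using commutes_apart[OF that] le by simp
  have step: "exch c Q {d..<e} (A \<union> K \<union> P)"
    if A: "A \<subseteq> {e..<x}" and x: "e \<le> x" "x < y" "y \<le> N" and K: "K \<subseteq> {y..<N}"
      and IH: "exch c Q {d..<e} (A \<union> {x..<y} \<union> P)" "exch c Q {d..<e} (A \<union> P)" "exch c Q {d..<e} (A \<union> {x..<y} \<union> K \<union> P)"
    for A K x y
  proof (rule exch_wrap_gap4[OF _ _ _ _ IH])
    note S = subset_ivl[OF P] subset_ivl[OF Q] subset_ivl[OF A] subset_ivl[OF K]
    show "exch c (P \<union> Q \<union> A) {x..<y} K" "exch c (P \<union> {d..<e} \<union> A) {x..<y} K" "exch c (P \<union> A) {x..<y} K"
      "exch c (P \<union> Q \<union> {d..<e} \<union> A) {x..<y} K"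
      using x le K by (intro exch_middle; simp add: S)+
    show "commutes (Q \<union> {d..<e}) ({x..<y} \<union> K)" "commutes Q ({x..<y} \<union> K)" "commutes {d..<e} ({x..<y} \<union> K)"
      "commutes {x..<y} (Q \<union> {d..<e})" "commutes K (Q \<union> {d..<e})" "commutes {x..<y} Q" "commutes {x..<y} {d..<e}"
      using x le by (simp_all add: ap S)
  qed
  show ?thesis using finite_ivl_subset[OF R] R
  proof (induction R rule: gap_induct)
    case empty
    then show ?case using assms(8) by simp
  next
    case (interval r f)
    then have r: "e \<le> r" "f \<le> N" by auto
    show ?case
    proof (cases "r = e")
      case True then show ?thesis using adj interval r by simp
    next
      case False
      then show ?thesis
        using step[of "{}" e r "{r..<f}"] adj[of r] adj[of f] empty r interval by (simp add: Un_ivl)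
    qed
  next
    case (gap r x y K)
    note B = gap_bounds[OF gap.prems gap(1-4)]
    have ivl: "exch c Q {d..<e} ({r..<f} \<union> P)" if "r < f" "f < N" for f
    proof (cases "r = e")
      case True then show ?thesis using adj that by simp
    next
      case False
      then show ?thesis
        using step[of "{}" e r "{r..<f}"] adj[of r] adj[of f] empty B that by (simp add: Un_ivl)
    qed
    show ?case
      using step[of "{r..<x}" x y K] ivl[of x] ivl[of y] gap(8)[OF B(5)] B gap(1,2) by (simp add: Un_ivl)
  qed
qed

text \<open>The same reduction for \<open>P\<close>, with the free space below \<open>b\<close>
  counted as a gap. For empty \<open>P\<close> the relation does not wrap around and is an instance
  of \<open>exch_middle\<close>.\<close>

lemma exch_wrap_induct1:
  assumes P: "P \<subseteq> {1..<b}" and R: "R \<subseteq> {e..<N}" and le: "b < d" "d < e" "e \<le> N"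
    and adj: "\<And>a. 1 \<le> a \<Longrightarrow> a < b \<Longrightarrow> exch c {b..<d} {d..<e} (R \<union> {a..<b})"
    and b: "1 \<le> b"
  shows "exch c {b..<d} {d..<e} (R \<union> P)"
proof -
  have ap: "commutes X Y \<and> commutes Y X" if "X \<subseteq> {1..<b}" "Y \<subseteq> {b..<N}" for X Y
    using commutes_apart[OF that] le b by simp
  have empty: "exch c {b..<d} {d..<e} R"
    using exch_middle[of "{b..<d}" d e R] le b R by simp
  have step: "exch c {b..<d} {d..<e} (R \<union> {a..<x} \<union> K)"
    if x: "1 \<le> a" "a < x" "x < y" "y \<le> b" and K: "K \<subseteq> {y..<b}"
      and IH: "exch c {b..<d} {d..<e} (R \<union> {x..<y} \<union> K)" "exch c {b..<d} {d..<e} (R \<union> K)" "exch c {b..<d} {d..<e} (R \<union> {a..<x} \<union> {x..<y} \<union> K)"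
    for a x y K
  proof (rule exch_wrap_gap1[OF _ _ _ _ IH])
    note S = subset_ivl[OF R] subset_ivl[OF K]
    show "exch c {a..<x} {x..<y} (K \<union> {b..<d} \<union> R)" "exch c {a..<x} {x..<y} (K \<union> {d..<e} \<union> R)" "exch c {a..<x} {x..<y} (K \<union> R)"
      "exch c {a..<x} {x..<y} (K \<union> {b..<d} \<union> {d..<e} \<union> R)"
      using x le b by (intro exch_middle; simp add: S)+
    show "commutes ({b..<d} \<union> {d..<e}) ({a..<x} \<union> {x..<y})" "commutes {b..<d} ({a..<x} \<union> {x..<y})" "commutes {d..<e} ({a..<x} \<union> {x..<y})"
      "commutes {x..<y} ({b..<d} \<union> {d..<e})" "commutes {a..<x} ({b..<d} \<union> {d..<e})"
      "commutes {x..<y} {b..<d}" "commutes {x..<y} {d..<e}" "commutes {a..<x} {b..<d}" "commutes {a..<x} {d..<e}"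
      using x le b by (simp_all add: ap S)
  qed
  have ivl: "exch c {b..<d} {d..<e} (R \<union> {a..<x})" if "1 \<le> a" "a < x" "x \<le> b" for a x
  proof (cases "x = b")
    case True then show ?thesis using adj that by simp
  next
    case False
    then show ?thesis
      using step[of a x b "{}"] adj[of x] adj[of a] empty that by (simp add: Un_ivl Un_assoc)
  qed
  show ?thesis using finite_ivl_subset[OF P] P
  proof (induction P rule: gap_induct)
    case empty
    then show ?case using \<open>exch c {b..<d} {d..<e} R\<close> by simp
  next
    case (interval a x)
    then show ?case using ivl by simp
  next
    case (gap a x y K)
    note B = gap_bounds[OF gap.prems gap(1-4)]
    show ?case
      using step[of a x y K] gap(6)[OF B(6)] gap(7)[OF B(4)] gap(8)[OF B(5)] B gap(1,2) by (simp add: Un_ivl Un_assoc flip: Un_assoc[of "{a..<x}" "{x..<y}"])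
  qed
qed

lemma intervals_commute':
  assumes "1 \<le> x" "1 \<le> x'" "y \<le> N" "y' \<le> N" "y \<le> x' \<or> y' \<le> x \<or> x' \<le> x \<and> y \<le> y' \<or> x \<le> x' \<and> y' \<le> y"
  shows "c {x..<y} * c {x'..<y'} = c {x'..<y'} * c {x..<y}"
proof (cases "x < y \<and> x' < y'")
  case True
  then show ?thesis
    using intervals_commutes[of x y x' y'] assms by (auto simp: commutes_def disjoint_iff)
qed (auto simp: c_empty)

text \<open>Apart from reflection, this is where the decreasing quadruple relation
  \<open>upper\<close> enters. All index sets are intervals or pairs of intervals, so that the
  hypotheses of \<open>four_blocks_ring\<close> are instances of the axioms and of
  \<open>exch_hole_right\<close>.\<close>

lemma four_intervals:
  assumes le: "1 \<le> a" "a < b" "b < d" "d < e" "e < f" "f \<le> N"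
  shows exch_wrap_base: "exch c {b..<d} {d..<e} ({e..<f} \<union> {a..<b})"
    and upper_commutes_base: "comm (- qcomm (c {b..<e}) (c {a..<d}) + c {a..<b} * c {d..<e} + c {b..<d} * c {a..<e})
      (c ({b..<d} \<union> {e..<f})) = 0"
proof -
  note sw = Un_commute[of "{d..<e}" "{a..<b}"] Un_commute[of "{e..<f}" "{b..<d}"] Un_commute[of "{e..<f}" "{a..<d}"]
    Un_commute[of "{e..<f}" "{a..<b}"] Un_commute[of "{d..<f}" "{a..<b}"]
  have cm: "c {d..<e} * c {b..<d} = c {b..<d} * c {d..<e}" "c {b..<d} * c {a..<b} = c {a..<b} * c {b..<d}"
    "c {d..<e} * c {a..<d} = c {a..<d} * c {d..<e}" "c {b..<e} * c {a..<b} = c {a..<b} * c {b..<e}"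
    "c {d..<f} * c {a..<b} = c {a..<b} * c {d..<f}" "c {b..<d} * c {d..<f} = c {d..<f} * c {b..<d}"
    by (rule intervals_commute'; use le in simp)+
  have x13: "c ({a..<b} \<union> {d..<e}) = - qcomm (c {a..<d}) (c {b..<e}) + c {a..<b} * c {d..<e} + c {b..<d} * c {a..<e}"
    using exch_first[of a b d "{d..<e}"] le unfolding exch_def by (simp add: Un_ivl)
  have x24: "c ({b..<d} \<union> {e..<f}) = - qcomm (c {b..<e}) (c {d..<f}) + c {b..<d} * c {e..<f} + c {d..<e} * c {b..<f}"
    using exch_first[of b d e "{e..<f}"] le unfolding exch_def by (simp add: Un_ivl)
  have x124: "c ({a..<d} \<union> {e..<f}) = - qcomm (c {a..<e}) (c {d..<f}) + c {a..<d} * c {e..<f} + c {d..<e} * c {a..<f}"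
    using exch_first[of a d e "{e..<f}"] le unfolding exch_def by (simp add: Un_ivl)
  have x134: "c ({a..<b} \<union> {d..<f}) = - qcomm (c {a..<d}) (c {b..<f}) + c {a..<b} * c {d..<f} + c {b..<d} * c {a..<f}"
    using exch_first[of a b d "{d..<f}"] le unfolding exch_def by (simp add: Un_ivl)
  have x14: "c ({a..<b} \<union> {e..<f}) = - qcomm (c {a..<e}) (c {b..<f}) + c {a..<b} * c {e..<f} + c {b..<e} * c {a..<f}"
    using exch_first[of a b e "{e..<f}"] le unfolding exch_def by (simp add: Un_ivl)
  have x14': "c ({a..<b} \<union> {e..<f}) = - qcomm (c {a..<d}) (c ({b..<d} \<union> {e..<f})) + c {a..<b} * c {e..<f} + c {b..<d} * c ({a..<d} \<union> {e..<f})"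
    using exch_hole_right[of a b d e f] le unfolding exch_def by (simp add: Un_ivl)
  have L0: "c {a..<d} = - qcomm (c {b..<e}) (c ({a..<b} \<union> {d..<e})) + c {a..<b} * c {b..<d} + c {d..<e} * c {a..<e}"
    using exch_adj_L[of a b d e] le unfolding exch_def by (simp add: Un_ivl sw cm)
  have L1: "c {b..<e} = - qcomm (c {d..<f}) (c ({b..<d} \<union> {e..<f})) + c {b..<d} * c {d..<e} + c {e..<f} * c {b..<f}"
    using exch_adj_L[of b d e f] le unfolding exch_def by (simp add: Un_ivl sw cm)
  have L2: "c {a..<e} = - qcomm (c {d..<f}) (c ({a..<d} \<union> {e..<f})) + c {a..<d} * c {d..<e} + c {e..<f} * c {a..<f}"
    using exch_adj_L[of a d e f] le unfolding exch_def by (simp add: Un_ivl sw cm)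
  have L3: "c {a..<e} = - qcomm (c {b..<f}) (c ({a..<b} \<union> {e..<f})) + c {a..<b} * c {b..<e} + c {e..<f} * c {a..<f}"
    using exch_adj_L[of a b e f] le unfolding exch_def by (simp add: Un_ivl sw cm)
  have L4: "c {a..<d} = - qcomm (c {b..<f}) (c ({a..<b} \<union> {d..<f})) + c {a..<b} * c {b..<d} + c {d..<f} * c {a..<f}"
    using exch_adj_L[of a b d f] le unfolding exch_def by (simp add: Un_ivl sw cm)
  note U = upper[OF le]
  have C: "\<forall>z\<in>{c {a..<b}, c {b..<d}, c {d..<e}, c {e..<f}, c {a..<f}}.
      \<forall>y\<in>{c {a..<d}, c {b..<e}, c {d..<f}, c {a..<e}, c {b..<f}}. y * z = z * y"
    "\<forall>y\<in>{c {b..<d}, c {d..<e}, c {e..<f}, c {a..<f}}. y * c {a..<b} = c {a..<b} * y"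
    "\<forall>y\<in>{c {d..<e}, c {e..<f}, c {a..<f}}. y * c {b..<d} = c {b..<d} * y"
    "\<forall>y\<in>{c {e..<f}, c {a..<f}}. y * c {d..<e} = c {d..<e} * y"
    "c {a..<f} * c {e..<f} = c {e..<f} * c {a..<f}"
    "c {d..<f} * c {a..<d} = c {a..<d} * c {d..<f}" "c {b..<f} * c {b..<e} = c {b..<e} * c {b..<f}"
    "c {b..<f} * c {d..<f} = c {d..<f} * c {b..<f}" "c {a..<e} * c {b..<e} = c {b..<e} * c {a..<e}"
    "c {a..<e} * c {a..<d} = c {a..<d} * c {a..<e}"
    by ((simp only: ball_simps simp_thms)?; (intro conjI)?; rule intervals_commute'; use le in simp)+
  note R = four_blocks_ring[OF x13 x24 x124 x134 x14 x14' L0 L1 L2 L3 L4 U C]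
  have eq: "{b..<d} \<union> ({e..<f} \<union> {a..<b}) = {a..<d} \<union> {e..<f}" "{d..<e} \<union> ({e..<f} \<union> {a..<b}) = {a..<b} \<union> {d..<f}"
    "{e..<f} \<union> {a..<b} = {a..<b} \<union> {e..<f}" "{b..<d} \<union> {d..<e} \<union> ({e..<f} \<union> {a..<b}) = {a..<f}" "{b..<d} \<union> {d..<e} = {b..<e}"
    using Un_ivl(1)[of a b d] Un_ivl(1)[of d e f] Un_ivl(1)[of b d e] Un_ivl(1)[of a b e] Un_ivl(1)[of a e f] le
    by (simp_all only: less_imp_le simp_thms) (blast+)
  show "exch c {b..<d} {d..<e} ({e..<f} \<union> {a..<b})"
    unfolding exch_def eq(1,2,4) unfolding eq(3,5) by (rule R(2))
  show "comm (- qcomm (c {b..<e}) (c {a..<d}) + c {a..<b} * c {d..<e} + c {b..<d} * c {a..<e}) (c ({b..<d} \<union> {e..<f})) = 0"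
    by (rule R(3))
qed

lemma exch_wrap_adjacent:
  assumes P: "P \<subseteq> {1..<b}" and R: "R \<subseteq> {e..<N}" and le: "1 \<le> b" "b < d" "d < e" "e \<le> N"
  shows "exch c {b..<d} {d..<e} (R \<union> P)"
proof (rule exch_wrap_induct1[OF P R])
  fix a assume a: "1 \<le> a" "a < b"
  show "exch c {b..<d} {d..<e} (R \<union> {a..<b})"
  proof (rule exch_wrap_induct4[of _ b _ _ _ e])
    show "exch c {b..<d} {d..<e} {a..<b}" using a le by (simp add: exch_adj_L)
    show "exch c {b..<d} {d..<e} ({e..<f} \<union> {a..<b})" if "e < f" "f \<le> N" for f
      using exch_wrap_base[of a b d e f] that a le by simp
  qed (use a le R in simp_all)
qed (use le in simp_all)

text \<open>It remains to close the gaps of \<open>Q\<close> by \<open>exch_wrap_gap2\<close>, whose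
  expansions of the larger elements are supplied by \<open>exch_wrap_adjacent\<close>.\<close>

lemma exch_wrap:
  assumes P: "P \<subseteq> {1..<l}" and Q: "Q \<subseteq> {l..<d}" and R: "R \<subseteq> {e..<N}" and le: "1 \<le> l" "l \<le> d" "d < e" "e \<le> N"
  shows "exch c Q {d..<e} (R \<union> P)"
proof -
  have N: "R \<subseteq> {1..<N}" "P \<subseteq> {1..<N}" using le by (simp_all add: subset_ivl[OF R] subset_ivl[OF P])
  have empty: "exch c {} {d..<e} (R \<union> P)"
    using N le by (intro exch_empty_left commutes_nested) auto
  have ap: "commutes X Y \<and> commutes Y X" if "X \<subseteq> {1..<d}" "Y \<subseteq> {d..<N}" for X Y
    using commutes_apart[OF that] le by simp
  have step: "exch c ({a..<x} \<union> K) {d..<e} (R \<union> P)"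
    if x: "l \<le> a" "a < x" "x < y" "y \<le> d" and K: "K \<subseteq> {y..<d}"
      and IH: "exch c ({x..<y} \<union> K) {d..<e} (R \<union> P)" "exch c K {d..<e} (R \<union> P)" "exch c ({a..<x} \<union> {x..<y} \<union> K) {d..<e} (R \<union> P)"
    for a x y K
  proof (rule exch_wrap_gap2[OF _ _ _ _ IH])
    note S = subset_ivl[OF R] subset_ivl[OF K] subset_ivl[OF P]
    show "exch c {a..<x} {x..<y} (K \<union> {d..<e})" "exch c {a..<x} {x..<y} K"
      using x le by (intro exch_middle; simp add: S)+
    show "exch c {a..<x} {x..<y} (K \<union> R \<union> P)" "exch c {a..<x} {x..<y} (K \<union> {d..<e} \<union> R \<union> P)"
      using x le by (intro exch_wrap_adjacent; simp add: S)+
    have 1: "commutes ({a..<y}) (P \<union> ({d..<e} \<union> R))" "commutes ({a..<y}) (P \<union> R)" "commutes {a..<x} (P \<union> ({d..<e} \<union> R))"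
      "commutes {x..<y} (P \<union> ({d..<e} \<union> R))"
      using x le by (intro commutes_between; simp add: S)+
    show "commutes ({a..<x} \<union> {x..<y}) (P \<union> {d..<e} \<union> R)" "commutes ({a..<x} \<union> {x..<y}) (P \<union> R)"
      "commutes {a..<x} (P \<union> {d..<e} \<union> R)" "commutes {x..<y} (P \<union> {d..<e} \<union> R)"
      using 1 x by (simp_all add: Un_ivl Un_assoc)
    show "commutes {d..<e} ({a..<x} \<union> {x..<y})" "commutes {a..<x} {d..<e}" "commutes {x..<y} {d..<e}"
      using x le by (simp_all add: ap)
  qed
  have adj: "exch c {a..<d} {d..<e} (R \<union> P)" if "l \<le> a" "a < d" for a
    using that le R by (intro exch_wrap_adjacent; simp add: subset_ivl[OF P])
  have ivl: "exch c {a..<x} {d..<e} (R \<union> P)" if "l \<le> a" "a < x" "x \<le> d" for a x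
  proof (cases "x = d")
    case True then show ?thesis using adj that by simp
  next
    case False
    \<comment> \<open>An interval ending before \<open>d\<close> is treated as having the gap up to
      \<open>d\<close>, with \<open>K\<close> empty.\<close>
    then show ?thesis
      using step[of a x d "{}"] adj[of x] adj[of a] empty that by (simp add: Un_ivl)
  qed
  show ?thesis using finite_ivl_subset[OF Q] Q
  proof (induction Q rule: gap_induct)
    case (interval a x)
    then show ?case using ivl by simp
  next
    case (gap a x y K)
    note B = gap_bounds[OF gap.prems gap(1-4)]
    show ?case
      using step[of a x y K] gap(6)[OF B(6)] gap(7)[OF B(4)] gap(8)[OF B(5)] B gap(1,2) by (simp add: Un_ivl)
  qed (rule empty)
qed

end

section \<open>Nested sets commute\<close>

context aw_family
begin

lemma exch_wrap_right:
  assumes P: "P \<subseteq> {1..<d}" and Q: "Q \<subseteq> {e..<u}" and R: "R \<subseteq> {u..<N}" and le: "1 \<le> d" "d < e" "e \<le> u" "u \<le> N"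
  shows "exch c (R \<union> P) {d..<e} Q"
proof -
  interpret m: aw_family c' N by (rule mirror_family)
  have N: "P \<subseteq> {1..<N}" "Q \<subseteq> {1..<N}" "R \<subseteq> {1..<N}"
    using le by (simp_all add: subset_ivl[OF P] subset_ivl[OF Q] subset_ivl[OF R])
  have mI: "mirror N {d..<e} = {N + 1 - e..<N + 1 - d}" using le by (simp add: mirror_interval)
  have "exch c' (mirror N Q) {N + 1 - e..<N + 1 - d} (mirror N P \<union> mirror N R)"
  proof (rule m.exch_wrap)
    show "mirror N R \<subseteq> {1..<N + 1 - u}" using mirror_subset[OF R order_refl] by simp
    show "mirror N Q \<subseteq> {N + 1 - u..<N + 1 - e}" using mirror_subset[OF Q] le by simp
    show "mirror N P \<subseteq> {N + 1 - d..<N}" using mirror_subset[OF P] le by simp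
  qed (use le in auto)
  then have "exch c' (mirror N Q) (mirror N {d..<e}) (mirror N (R \<union> P))"
    by (simp add: mI Un_commute)
  moreover have "commutes {d..<e} ((R \<union> P) \<union> {d..<e} \<union> Q)"
    using le N by (intro commutes_nested) auto
  ultimately show ?thesis
    using le N by (intro exch_from_mirror) auto
qed

text \<open>The element of the decreasing sequence \<open>(R, P)\<close> with hole \<open>Q\<close>.\<close>

definition upper_pair :: "nat set \<Rightarrow> nat set \<Rightarrow> nat set \<Rightarrow> 'a"
  where "upper_pair P Q R = - qcomm (c (Q \<union> R)) (c (P \<union> Q)) + c P * c R + c Q * c (P \<union> Q \<union> R)"

lemma commute_upper_pair:
  assumes "commutes X (P \<union> Q)" "commutes X (Q \<union> R)" "commutes X P" "commutes X R" "commutes X Q"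
    "commutes X (P \<union> Q \<union> R)"
  shows "c X * upper_pair P Q R = upper_pair P Q R * c X"
proof -
  note a = assms[unfolded commutes_def]
  show ?thesis unfolding upper_pair_def
    using commute_qcomm[OF a(2,1)] commute_mult[OF a(3,4)] commute_mult[OF a(5,6)]
    by (simp add: algebra_simps)
qed

text \<open>The outer blocks of the pair interleave with the two parts of the other set; the
  reversed q-commutator makes the elements commute nevertheless. The case of an interval touching
  \<open>{d..<e}\<close> is \<open>upper_commutes_base\<close>, and gaps of \<open>Z\<close> are
  handled by \<open>commute_exch\<close>.\<close>

lemma upper_pair_commutes:
  assumes le: "1 \<le> a" "a < b" "b < d" "d < e" "e \<le> N" and Z: "Z \<subseteq> {e..<N}"
  shows "upper_pair {a..<b} {b..<d} {d..<e} * c ({b..<d} \<union> Z) = c ({b..<d} \<union> Z) * upper_pair {a..<b} {b..<d} {d..<e}"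
proof -
  let ?u = "upper_pair {a..<b} {b..<d} {d..<e}"
  have far: "?u * c Y = c Y * ?u" if "Y \<subseteq> {e..<N}" for Y
  proof (cases "Y = {}")
    case False
    then have "e < N" using that by auto
    then show ?thesis
      using le commutes_apart(2)[OF _ that, of _ 1 e]
      by (intro commute_upper_pair[symmetric]) (simp_all add: Un_ivl)
  qed (simp add: c_empty)
  have self: "?u * c {b..<d} = c {b..<d} * ?u" if "e \<le> N"
    using le that
    by (intro commute_upper_pair[symmetric]) (simp_all add: Un_ivl, (intro intervals_commutes; auto)+)
  have step: "?u * c ({b..<d} \<union> A \<union> K) = c ({b..<d} \<union> A \<union> K) * ?u"
    if A: "A \<subseteq> {e..<x}" and x: "e \<le> x" "x < y" "y \<le> N" and K: "K \<subseteq> {y..<N}"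
      and IH: "?u * c ({b..<d} \<union> A) = c ({b..<d} \<union> A) * ?u" "?u * c ({b..<d} \<union> A \<union> {x..<y}) = c ({b..<d} \<union> A \<union> {x..<y}) * ?u"
        "?u * c ({b..<d} \<union> A \<union> {x..<y} \<union> K) = c ({b..<d} \<union> A \<union> {x..<y} \<union> K) * ?u"
    for A K x y
  proof (rule commute_exch[of c _ "{x..<y}"])
    show "exch c ({b..<d} \<union> A) {x..<y} K"
      using le x K by (intro exch_middle) (simp_all add: subset_ivl[OF A])
    show "?u * c ({x..<y} \<union> K) = c ({x..<y} \<union> K) * ?u" "?u * c K = c K * ?u" "?u * c {x..<y} = c {x..<y} * ?u"
      using x by (simp_all add: far subset_ivl[OF K])
  qed (use IH in simp_all)
  have adj: "?u * c ({b..<d} \<union> {e..<f}) = c ({b..<d} \<union> {e..<f}) * ?u" if "e < f" "f \<le> N" for f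
    using upper_commutes_base[of a b d e f] le that unfolding comm_def by (simp add: upper_pair_def Un_ivl)
  have ivl: "?u * c ({b..<d} \<union> {z..<f}) = c ({b..<d} \<union> {z..<f}) * ?u" if "e \<le> z" "z < f" "f \<le> N" for z f
  proof (cases "z = e")
    case True then show ?thesis using adj that by simp
  next
    case False
    then show ?thesis
      using step[of "{}" e z "{z..<f}"] adj[of z] adj[of f] self that by (simp add: Un_ivl Un_assoc)
  qed
  show ?thesis using finite_ivl_subset[OF Z] Z
  proof (induction Z rule: gap_induct)
    case empty
    show ?case using self le by simp
  next
    case (interval z f)
    then show ?case using ivl by simp
  next
    case (gap z x y K)
    note B = gap_bounds[OF gap.prems gap(1-4)]
    show ?case
      using step[of "{z..<x}" x y K] ivl[of z x] ivl[of z y] gap(8)[OF B(5)] B gap(1,2) by (simp add: Un_ivl Un_assoc)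
  qed
qed

text \<open>Serves the induction on gaps: every index set of a \<open>c\<close> term on the right
  that contains \<open>Z\<close> either starts at \<open>b\<close> or has the space between
  \<open>d\<close> and \<open>e\<close> filled, and the new factor is an upper pair, whose
  commutations are known.\<close>

lemma upper_pair_exch:
  assumes le: "1 \<le> a" "a < b" "b < d" "d < e" "e \<le> N" and Z: "Z \<subseteq> {e..<N}"
  shows "c ({a..<d} \<union> Z) = - qcomm (upper_pair {a..<b} {b..<d} {d..<e}) (c ({b..<e} \<union> Z)) + c {a..<b} * c ({b..<d} \<union> Z)
    + c {d..<e} * c ({a..<e} \<union> Z)"
proof -
  let ?P = "{a..<b}" and ?Q = "{b..<d}" and ?R = "{d..<e}"
  have u: "{a..<d} = ?P \<union> ?Q" "{b..<e} = ?Q \<union> ?R" "{a..<e} = ?P \<union> ?Q \<union> ?R" using le by auto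
  have "exch c ?Q ?R (Z \<union> ?P)" "exch c ?P ?Q (?R \<union> Z)" "exch c ?Q ?R Z" "exch c ?P (?Q \<union> ?R) Z"
    using le exch_wrap[of ?P b ?Q d Z e] exch_middle[of ?P b d "?R \<union> Z"] exch_middle[of ?Q d e Z] exch_middle[of ?P b e Z]
    by (simp_all add: subset_ivl[OF Z] Un_ivl)
  moreover have "commutes (?Q \<union> ?R) (?Q \<union> ?R \<union> Z)" "commutes ?P (?Q \<union> ?R)" "commutes ?Q (?Q \<union> ?R)" "commutes ?R (?Q \<union> ?R \<union> Z)"
    "commutes ?P (?Q \<union> ?R \<union> Z)" "commutes ?Q (?Q \<union> ?R \<union> Z)" "commutes ?Q ?P" "commutes ?R ?P" "commutes (?Q \<union> ?R) (?P \<union> ?Q \<union> ?R \<union> Z)"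
  proof -
    have S: "{x..<y} \<union> Z \<subseteq> {1..<N}" if "a \<le> x" "y \<le> e" for x y using le that by (simp add: subset_ivl[OF Z])
    have n: "commutes {x..<y} ({x'..<y'} \<union> Z)" if "a \<le> x'" "x' \<le> x" "y \<le> y'" "y' \<le> e" for x y x' y'
      using S[of x' y'] that by (intro commutes_nested) auto
    show "commutes (?Q \<union> ?R) (?Q \<union> ?R \<union> Z)" "commutes ?R (?Q \<union> ?R \<union> Z)" "commutes ?Q (?Q \<union> ?R \<union> Z)" "commutes (?Q \<union> ?R) (?P \<union> ?Q \<union> ?R \<union> Z)"
      using le by (simp_all add: Un_ivl n)
    show "commutes ?P (?Q \<union> ?R)" "commutes ?Q (?Q \<union> ?R)" "commutes ?Q ?P" "commutes ?R ?P"
      using le by (simp_all add: Un_ivl) (intro intervals_commutes; auto)+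
    show "commutes ?P (?Q \<union> ?R \<union> Z)"
      using le commutes_apart(1)[of ?P a b "?Q \<union> ?R \<union> Z" b N] by (simp add: subset_ivl[OF Z])
  qed
  ultimately show ?thesis unfolding u upper_pair_def apply -
    apply (unfold exch_def commutes_def)
    apply (simp (no_asm_use) only: Un_ac)
    apply (rule W_mixed_ring; assumption)
    done
qed

text \<open>In the expansion by \<open>upper_pair_exch\<close> each factor commutes with the given
  element: the upper pair by \<open>upper_pair_commutes\<close>, the intervals by position, the
  other sets by \<open>IH\<close>.\<close>

lemma commutes_suffix:
  assumes le: "1 \<le> a" "a < b" "b < d" "d < e" "e \<le> N" and Z: "Z \<subseteq> {e..<N}" and Y: "Y \<subseteq> {e..<N}"
    and IH: "commutes ({b..<d} \<union> Y) ({b..<e} \<union> Z)" "commutes ({b..<d} \<union> Y) ({b..<d} \<union> Z)" "commutes ({b..<d} \<union> Y) ({a..<e} \<union> Z)"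
  shows "commutes ({b..<d} \<union> Y) ({a..<d} \<union> Z)"
proof -
  note u = upper_pair_commutes[OF le Y]
  have P: "commutes ({b..<d} \<union> Y) {a..<b}"
    using le commutes_apart(2)[of "{a..<b}" a b "{b..<d} \<union> Y" b N] by (simp add: subset_ivl[OF Y])
  have H: "commutes ({b..<d} \<union> Y) {d..<e}"
    using commutes_between(2)[of "{b..<d}" d Y e] le Y by simp
  show ?thesis
    unfolding commutes_def upper_pair_exch[OF le Z]
    using u IH P H unfolding commutes_def
    by (intro commute_add commute_mult) (auto simp: commute_qcomm)
qed
end

section \<open>Double induction on gaps and missing elements\<close>

definition gaps :: "nat set \<Rightarrow> nat set"
  where "gaps Y = {x. x \<notin> Y \<and> (\<exists>y\<in>Y. y < x) \<and> (\<exists>z\<in>Y. x < z)}"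

lemma gaps_subset:
  assumes "Y' \<subseteq> Y \<union> gaps Y" "\<And>x y z. \<lbrakk>x \<in> Y; y \<in> Y'; z \<in> Y'; y < x; x < z\<rbrakk> \<Longrightarrow> x \<in> Y'"
  shows "gaps Y' \<subseteq> gaps Y"
proof
  fix x assume "x \<in> gaps Y'"
  then obtain y z where x: "x \<notin> Y'" "y \<in> Y'" "z \<in> Y'" "y < x" "x < z" by (auto simp: gaps_def)
  have "\<exists>y\<in>Y. y < x" using subsetD[OF assms(1) x(2)] x(4) by (auto simp: gaps_def intro: less_trans)
  moreover have "\<exists>y\<in>Y. x < y" using subsetD[OF assms(1) x(3)] x(5) by (auto simp: gaps_def intro: less_trans)
  moreover have "x \<notin> Y" using assms(2) x by blast
  ultimately show "x \<in> gaps Y" unfolding gaps_def by blast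
qed

lemma finite_gaps: "finite Y \<Longrightarrow> finite (gaps Y)"
  by (rule finite_subset[of _ "\<Union>z\<in>Y. {..<z}"]) (auto simp: gaps_def)

context aw_family
begin

text \<open>\<open>commutes_suffix\<close> for the reflected family, with long runs at the upper
  end.\<close>

lemma commutes_prefix:
  assumes le: "1 \<le> b" "b < d" "d < e" "e < f" "f \<le> N" and Z: "Z \<subseteq> {1..<b}" and Y: "Y \<subseteq> {1..<b}"
    and IH: "commutes (Y \<union> {d..<e}) (Z \<union> {b..<e})" "commutes (Y \<union> {d..<e}) (Z \<union> {d..<e})" "commutes (Y \<union> {d..<e}) (Z \<union> {b..<f})"
  shows "commutes (Y \<union> {d..<e}) (Z \<union> {d..<f})"
proof -
  interpret m: aw_family c' N by (rule mirror_family)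
  have cm: "m.commutes (mirror N S) (mirror N T) \<longleftrightarrow> commutes S T" if "S \<subseteq> {1..<N}" "T \<subseteq> {1..<N}" for S T
    unfolding m.commutes_def commutes_def
      mirror_mirror[OF that(1)] mirror_mirror[OF that(2)] Op_eq_iff Op_mult[symmetric] by metis
  have U: "S \<union> {x..<y} \<subseteq> {1..<N}" if "S \<in> {Y, Z}" "b \<le> x" "y \<le> f" for x y S
    using that le subset_ivl[OF Y, of 1 N] subset_ivl[OF Z, of 1 N] by auto
  have mi: "mirror N (S \<union> {x..<y}) = {N + 1 - y..<N + 1 - x} \<union> mirror N S" if "b \<le> x" "y \<le> f" for x y S
    using that le by (simp add: mirror_interval Un_commute)
  have t: "m.commutes ({N + 1 - y..<N + 1 - x} \<union> mirror N S) ({N + 1 - y'..<N + 1 - x'} \<union> mirror N S') \<longleftrightarrow> commutes (S \<union> {x..<y}) (S' \<union> {x'..<y'})"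
    if "S \<in> {Y, Z}" "b \<le> x" "y \<le> f" "S' \<in> {Y, Z}" "b \<le> x'" "y' \<le> f" for S S' x x' y y'
    using cm[OF U[OF that(1-3)] U[OF that(4-6)]] by (simp only: mi that)
  have "m.commutes ({N + 1 - e..<N + 1 - d} \<union> mirror N Y) ({N + 1 - f..<N + 1 - d} \<union> mirror N Z)"
    by (rule m.commutes_suffix[of _ _ _ "N + 1 - b"])
      (use le mirror_subset[OF Z, of N] mirror_subset[OF Y, of N] IH in \<open>simp_all only: t insertI1 insertI2 order_refl less_imp_le\<close>, auto)
  then show ?thesis using t[of Y d e Z d f] le by simp
qed

text \<open>Splitting \<open>Y\<close> at \<open>h\<close> and taking \<open>{h}\<close> as middle
  block of an exchange relation, all other index sets have fewer gaps. Those on the far side of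
  \<open>h\<close> are separated from \<open>X\<close>, and those containing \<open>X\<close> fall
  under \<open>IH\<close>.\<close>

lemma nested_commutes_step:
  assumes IH: "\<And>X' Y'. \<lbrakk>card (gaps Y') < card (gaps Y); Y' \<subseteq> {1..<N}; X' \<subseteq> Y'\<rbrakk> \<Longrightarrow> commutes X' Y'"
    and Y: "Y \<subseteq> {1..<N}" and h: "h \<in> gaps Y" and X: "X \<subseteq> Y \<inter> {..<h} \<or> X \<subseteq> Y \<inter> {Suc h..}"
  shows "commutes X Y"
proof -
  define L R where "L = Y \<inter> {..<h}" and "R = Y \<inter> {Suc h..}"
  have hN: "1 \<le> h" "h < N" using h Y by (auto simp: gaps_def)
  have hY: "h \<notin> Y" "\<exists>y\<in>Y. y < h" "\<exists>y\<in>Y. h < y" using h by (auto simp: gaps_def)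
  have Y_eq: "Y = L \<union> R" using hY(1) by (auto simp: L_def R_def not_less) (metis Suc_leI linorder_neqE_nat)
  have L: "L \<subseteq> {1..<h}" and R: "R \<subseteq> {Suc h..<N}" using Y by (auto simp: L_def R_def)
  have eh: "exch c L {h..<Suc h} R" using L R hN by (intro exch_middle) auto
  have less: "card (gaps Y') < card (gaps Y)" if "Y' \<in> {L, R, insert h L, insert h R, insert h Y}" for Y'
  proof (intro psubset_card_mono finite_gaps fin[OF Y] psubsetI)
    show "gaps Y' \<subseteq> gaps Y"
      by (rule gaps_subset) (use that h in \<open>auto simp: L_def R_def\<close>)
    have "h \<notin> gaps Y'" using that by (auto simp: gaps_def L_def R_def)
    then show "gaps Y' \<noteq> gaps Y" using h by blast
  qed
  have ivl: "{h..<Suc h} = {h}" by auto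
  have U: "L \<subseteq> {1..<N}" "R \<subseteq> {1..<N}" "insert h L \<subseteq> {1..<N}" "insert h R \<subseteq> {1..<N}" "insert h Y \<subseteq> {1..<N}"
    using Y hN by (auto simp: L_def R_def)
  have hL: "insert h L \<subseteq> {1..<Suc h}" "insert h R \<subseteq> {h..<N}" "L \<subseteq> {1..<Suc h}" using L R hN by auto
  have "commutes X (L \<union> R)"
  proof (rule commutes_exch[OF eh])
    have n: "commutes X Y'" if "X \<subseteq> Y'" "Y' \<in> {L, R, insert h L, insert h R, insert h Y}" for Y'
      using that by (intro IH less) (use U in auto)
    have eqs: "L \<union> {h..<Suc h} = insert h L" "{h..<Suc h} \<union> R = insert h R" "L \<union> {h..<Suc h} \<union> R = insert h Y"
      by (auto simp: Y_eq)
    consider "X \<subseteq> L" | "X \<subseteq> R" using X by (auto simp: L_def R_def)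
    then have "commutes X (L \<union> {h..<Suc h}) \<and> commutes X ({h..<Suc h} \<union> R) \<and> commutes X L \<and> commutes X R \<and>
        commutes X {h..<Suc h} \<and> commutes X (L \<union> {h..<Suc h} \<union> R)"
    proof cases
      case 1
      then have "X \<subseteq> {1..<h}" using L by simp
      then have "commutes X S" if "S \<subseteq> {h..<N}" for S using commutes_apart(1)[OF _ that] by simp
      then show "commutes X (L \<union> {h..<Suc h}) \<and> commutes X ({h..<Suc h} \<union> R) \<and> commutes X L \<and> commutes X R \<and>
        commutes X {h..<Suc h} \<and> commutes X (L \<union> {h..<Suc h} \<union> R)"
        unfolding eqs ivl using n[of L] n[of "insert h L"] n[of "insert h Y"] 1 hL hN by (auto simp: Y_eq subset_iff)
    next
      case 2
      then have "X \<subseteq> {Suc h..<N}" using R by simp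
      then have "commutes X S" if "S \<subseteq> {1..<Suc h}" for S using commutes_apart(2)[OF that] by simp
      then show "commutes X (L \<union> {h..<Suc h}) \<and> commutes X ({h..<Suc h} \<union> R) \<and> commutes X L \<and> commutes X R \<and>
        commutes X {h..<Suc h} \<and> commutes X (L \<union> {h..<Suc h} \<union> R)"
        unfolding eqs ivl using n[of R] n[of "insert h R"] n[of "insert h Y"] 2 hL hN by (auto simp: Y_eq subset_iff)
    qed
    then show "commutes X (L \<union> {h..<Suc h})" "commutes X ({h..<Suc h} \<union> R)" "commutes X L" "commutes X R"
      "commutes X {h..<Suc h}" "commutes X (L \<union> {h..<Suc h} \<union> R)" by blast+
  qed
  then show ?thesis by (simp add: Y_eq)
qed

lemma gapless_commutes:
  assumes "X \<subseteq> Y" "Y \<subseteq> {1..<N}" "gaps Y = {}"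
  shows "commutes X Y"
proof (cases "Y = {}")
  case False
  have f: "finite Y" using fin assms(2) .
  have mm: "Min Y \<in> Y" "Max Y \<in> Y" using f False by auto
  have "x \<in> Y" if "Min Y \<le> x" "x \<le> Max Y" for x
    using assms(3) that mm le_neq_implies_less[of "Min Y" x] le_neq_implies_less[of x "Max Y"] unfolding gaps_def by blast
  then have "Y = {Min Y..<Suc (Max Y)}"
    using f by (auto simp: less_Suc_eq_le)
  then show ?thesis
    using interval_commutes[OF _ assms(2), of "Min Y" "Suc (Max Y)" X] assms by (auto simp: comparable_def intro: commutes_sym)
qed simp

text \<open>The parts of \<open>X\<close> below and above \<open>e\<close> form an exchange relation
  with middle block \<open>{e}\<close>, in which \<open>c X\<close> is the left-hand side.\<close>

lemma commutes_remove:
  assumes T: "X \<subseteq> T" "T \<subseteq> {1..<N}" and e: "e \<in> T" "e \<notin> X"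
    and c: "commutes (insert e (X \<inter> {..<e})) T" "commutes (insert e (X \<inter> {Suc e..})) T" "commutes (X \<inter> {..<e}) T"
      "commutes (X \<inter> {Suc e..}) T" "commutes (insert e X) T"
  shows "commutes X T"
proof -
  let ?A = "X \<inter> {..<e}" and ?B = "X \<inter> {Suc e..}"
  have eN: "1 \<le> e" "e < N" using T(2) e(1) by auto
  have X: "X = ?A \<union> ?B" using e(2) by (auto simp: not_less) (metis Suc_leI linorder_neqE_nat)
  have ivl: "{e..<Suc e} = {e}" by auto
  have "exch c ?A {e..<Suc e} ?B" using T eN by (intro exch_middle) auto
  moreover have "?A \<union> {e} = insert e ?A" "{e} \<union> ?B = insert e ?B" "insert e ?A \<union> ?B = insert e X" using X by auto
  moreover have "commutes {e} T"
    using commutes_nested(1)[OF T(2), of e "Suc e"] e by (simp add: ivl)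
  ultimately have "commutes T (?A \<union> ?B)"
    using c by (intro commutes_exch[of ?A "{e}" ?B]) (simp_all add: ivl commutes_sym)
  then show ?thesis using X commutes_sym by metis
qed

text \<open>The outer induction is on the number of gaps, the inner one on the number of points of
  \<open>T\<close> missing in \<open>X\<close>. If a missing point \<open>e\<close> has gaps of
  \<open>T\<close> on both sides, the parts produced by \<open>commutes_remove\<close> lie on one
  side of a gap each. If all gaps lie on the same side of \<open>e\<close>, one part spreads over
  them, and \<open>commutes_suffix\<close> or \<open>commutes_prefix\<close> is needed.\<close>

lemma nested_commutes:
  assumes "X \<subseteq> Y" "Y \<subseteq> {1..<N}"
  shows "commutes X Y"
  using assms
proof (induction "card (gaps Y)" arbitrary: X Y rule: less_induct)
  case outer: less
  have "commutes X T" if "card (gaps T) \<le> card (gaps Y)" "X \<subseteq> T" "T \<subseteq> {1..<N}" for X T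
    using that
  proof (induction "card (T - X)" arbitrary: X T rule: less_induct)
    case (less X T)
    note TN = less.prems(3) and XT = less.prems(2)
    have finT: "finite T" using fin[OF TN] .
    have fewer: "commutes X' T'" if "card (gaps T') < card (gaps T)" "X' \<subseteq> T'" "T' \<subseteq> {1..<N}" for X' T'
      using outer.hyps[of T' X'] that less.prems(1) by simp
    have closer: "commutes X' T'" if "T' - X' \<subset> T - X" "gaps T' \<subseteq> gaps T" "X' \<subseteq> T'" "T' \<subseteq> {1..<N}" for X' T'
      using psubset_card_mono[OF _ that(1)] finT that card_mono[OF finite_gaps[OF finT] that(2)] less.prems(1)
      by (intro less.hyps) auto
    have miss: "commutes X' T" if "h \<in> gaps T" "X' \<subseteq> T \<inter> {..<h} \<or> X' \<subseteq> T \<inter> {Suc h..}" for X' h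
      using nested_commutes_step[OF fewer TN that] by blast
    have add: "commutes (insert e X) T" if "e \<in> T - X" for e
      using that XT TN by (intro closer) auto
    note rem = commutes_remove[OF XT TN]
    have fill: "commutes X' T'" if "gaps T' \<subseteq> gaps T" "h \<in> gaps T" "h \<in> T'" "X' \<subseteq> T'" "T' \<subseteq> {1..<N}" for X' T' h
    proof (rule fewer[OF psubset_card_mono[OF finite_gaps[OF finT]] that(4,5)])
      show "gaps T' \<subset> gaps T" using that(1-3) by (auto simp: gaps_def)
    qed
    consider "X = T" | "gaps T = {}"
      | e h h' where "e \<in> T - X" "h \<in> gaps T" "h < e" "h' \<in> gaps T" "e < h'"
      | e h where "e \<in> T - X" "h \<in> gaps T" "e < h" "\<forall>x\<in>gaps T. e < x"
      | e h where "e \<in> T - X" "h \<in> gaps T" "h < e" "\<forall>x\<in>gaps T. x < e"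
    proof -
      have "x \<noteq> e" if "e \<in> T - X" "x \<in> gaps T" for e x using that by (auto simp: gaps_def)
      then have "x < e \<or> e < x" if "e \<in> T - X" "x \<in> gaps T" for e x using that by (meson linorder_neqE_nat)
      moreover have "X = T \<or> T - X \<noteq> {}" using XT by blast
      ultimately show thesis using that by (metis ex_in_conv)
    qed
    then show ?case
    proof cases
      case 3
      show ?thesis
        by (rule rem[of e]) (use 3 XT add in \<open>auto intro: miss[OF 3(2)] miss[OF 3(4)]\<close>)
    next
      case 4
      define h0 where "h0 = Min (gaps T)"
      have h0: "h0 \<in> gaps T" "\<And>x. x \<in> gaps T \<Longrightarrow> h0 \<le> x"
        unfolding h0_def using Min_in[OF finite_gaps[OF finT]] Min_le[OF finite_gaps[OF finT]] 4(2) by blast+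
      \<comment> \<open>With the last missing point before the first gap, \<open>X\<close> contains
        the whole run from \<open>Suc e0\<close> up to \<open>h0\<close>, as
        \<open>commutes_suffix\<close> demands.\<close>
      define e0 where "e0 = Max {x\<in>T - X. x < h0}"
      have fe: "finite {x\<in>T - X. x < h0}" "{x\<in>T - X. x < h0} \<noteq> {}" using finT 4 h0(1) by auto
      have "e0 \<in> {x\<in>T - X. x < h0}" "\<And>x. x \<in> T - X \<Longrightarrow> x < h0 \<Longrightarrow> x \<le> e0"
        unfolding e0_def using Max_in[OF fe] Max_ge[OF fe(1)] by blast+
      then have e0: "e0 \<in> T - X" "e0 < h0" "\<And>x. x \<in> T \<Longrightarrow> x < h0 \<Longrightarrow> e0 < x \<Longrightarrow> x \<in> X"
        by (auto simp: not_le[symmetric])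
      define a where "a = Min T"
      have a: "a \<in> T" "\<And>x. x \<in> T \<Longrightarrow> a \<le> x"
        unfolding a_def using Min_in[OF finT] Min_le[OF finT] e0(1) by blast+
      obtain z where z: "z \<in> T" "h0 < z" using h0(1) by (auto simp: gaps_def)
      have fT: "x \<in> T" if "a \<le> x" "x < h0" for x
      proof (rule ccontr)
        assume "x \<notin> T"
        have "a \<noteq> x" using \<open>x \<notin> T\<close> a(1) by blast
        then have "a < x" "x < z" using that z(2) by simp_all
        then have "x \<in> gaps T" unfolding gaps_def using \<open>x \<notin> T\<close> a(1) z(1) by blast
        then show False using h0(2) that by force
      qed
      have h0T: "h0 \<notin> T" using h0(1) by (auto simp: gaps_def)
      define Z X3 where "Z = T \<inter> {Suc h0..}" and "X3 = X \<inter> {Suc h0..}"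
      have le: "1 \<le> a" "a \<le> e0" "Suc h0 \<le> N" "Z \<subseteq> {Suc h0..<N}" "X3 \<subseteq> {Suc h0..<N}" "X3 \<subseteq> Z"
        using a e0 z TN XT by (auto simp: Z_def X3_def)
      have T: "T = {a..<h0} \<union> Z"
      proof (intro equalityI subsetI)
        fix x assume "x \<in> T"
        then show "x \<in> {a..<h0} \<union> Z" using a(2)[of x] h0T by (cases x h0 rule: linorder_cases) (auto simp: Z_def)
      qed (use fT in \<open>auto simp: Z_def\<close>)
      have gs: "gaps ({s..<u} \<union> Z) \<subseteq> gaps T" if "a \<le> s" "s < h0" "u \<in> {h0, Suc h0}" for s u
      proof (rule gaps_subset)
        show "{s..<u} \<union> Z \<subseteq> T \<union> gaps T" using that fT h0(1) by (auto simp: Z_def less_Suc_eq)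
        show "x \<in> {s..<u} \<union> Z" if "x \<in> T" "y \<in> {s..<u} \<union> Z" "y < x" for x y
          using that \<open>s < h0\<close> \<open>u \<in> {h0, Suc h0}\<close> h0T by (cases x h0 rule: linorder_cases) (auto simp: Z_def)
      qed
      \<comment> \<open>The two values of \<open>s\<close> correspond to \<open>e0\<close> being put
        back into the upper part or left out.\<close>
      have suf: "commutes ({s..<h0} \<union> X3) T" if s: "e0 \<le> s" "s \<le> Suc e0" "s < h0" for s
      proof -
        \<comment> \<open>Inner induction: \<open>e0\<close> is in both sets or in neither, so it no
          longer counts as missing.\<close>
        have c: "commutes ({s..<h0} \<union> X3) ({s..<h0} \<union> Z)"
        proof (rule closer)
          have "({s..<h0} \<union> Z) - ({s..<h0} \<union> X3) \<subseteq> T - X - {e0}" using e0(2) by (auto simp: X3_def Z_def)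
          then show "({s..<h0} \<union> Z) - ({s..<h0} \<union> X3) \<subset> T - X" using e0(1) by blast
          show "gaps ({s..<h0} \<union> Z) \<subseteq> gaps T" using gs[of s h0] s le(2) by simp
          have "{s..<h0} \<union> Z \<subseteq> T" using s le(2) by (auto simp: Z_def intro: fT)
          then show "{s..<h0} \<union> Z \<subseteq> {1..<N}" using TN by (rule subset_trans)
          show "{s..<h0} \<union> X3 \<subseteq> {s..<h0} \<union> Z" using le(6) by blast
        qed
        show ?thesis
        proof (cases "a = s")
          case True then show ?thesis using c T by simp
        next
          case False
          \<comment> \<open>Outer induction: filling \<open>h0\<close> lowers the number of
            gaps.\<close>
          have f: "commutes ({s..<h0} \<union> X3) ({a'..<Suc h0} \<union> Z)" if "a \<le> a'" "a' \<le> s" for a'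
          proof (rule fill[OF gs h0(1)])
            show "{a'..<Suc h0} \<union> Z \<subseteq> {1..<N}" using that le(1,3) subset_ivl[OF le(4), of 1 N] by auto
            show "{s..<h0} \<union> X3 \<subseteq> {a'..<Suc h0} \<union> Z" using that le(6) by auto
          qed (use that s in simp_all)
          have "a < s" using False s(1) le(2) by simp
          show ?thesis unfolding T
            by (rule commutes_suffix[OF le(1) \<open>a < s\<close> s(3) lessI le(3,4,5) f c f]) (use \<open>a < s\<close> in simp_all)
        qed
      qed
      show ?thesis
      proof (rule rem[of e0])
        show "commutes (insert e0 (X \<inter> {..<e0})) T" "commutes (X \<inter> {..<e0}) T"
          using XT e0 by (auto intro!: miss[OF h0(1)])
        have mem: "x \<in> X \<and> Suc e0 \<le> x \<longleftrightarrow> x \<in> {Suc e0..<h0} \<union> X3" for x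
          using e0(2) e0(3)[of x] fT[of x] h0T XT le(2) by (cases x h0 rule: linorder_cases) (auto simp: X3_def)
        then have eq: "X \<inter> {Suc e0..} = {Suc e0..<h0} \<union> X3" by blast
        have eq2: "insert e0 (X \<inter> {Suc e0..}) = {e0..<h0} \<union> X3" unfolding eq using e0(2) by auto
        show "commutes (insert e0 (X \<inter> {Suc e0..})) T" unfolding eq2 using suf e0 by simp
        show "commutes (X \<inter> {Suc e0..}) T"
        proof (cases "Suc e0 < h0")
          case False
          then show ?thesis using XT by (intro miss[OF h0(1)]) (auto simp: eq X3_def)
        qed (use suf eq in simp)
      qed (use e0 add in auto)
    next
      case 5
      \<comment> \<open>The mirror image of the previous case: the last gap, and the first missing
        point after it.\<close>
      define h0 where "h0 = Max (gaps T)"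
      have h0: "h0 \<in> gaps T" "\<And>x. x \<in> gaps T \<Longrightarrow> x \<le> h0"
        unfolding h0_def using Max_in[OF finite_gaps[OF finT]] Max_ge[OF finite_gaps[OF finT]] 5(2) by blast+
      define e0 where "e0 = Min {x\<in>T - X. h0 < x}"
      have fe: "finite {x\<in>T - X. h0 < x}" "{x\<in>T - X. h0 < x} \<noteq> {}" using finT 5 h0(1) by auto
      have "e0 \<in> {x\<in>T - X. h0 < x}" "\<And>x. x \<in> T - X \<Longrightarrow> h0 < x \<Longrightarrow> e0 \<le> x"
        unfolding e0_def using Min_in[OF fe] Min_le[OF fe(1)] by blast+
      then have e0: "e0 \<in> T - X" "h0 < e0" "\<And>x. x \<in> T \<Longrightarrow> h0 < x \<Longrightarrow> x < e0 \<Longrightarrow> x \<in> X"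
        by (auto simp: not_le[symmetric])
      define b where "b = Suc (Max T)"
      have b: "Max T \<in> T" "\<And>x. x \<in> T \<Longrightarrow> x < b"
        unfolding b_def less_Suc_eq_le using Max_in[OF finT] Max_ge[OF finT] e0(1) by blast+
      obtain z where z: "z \<in> T" "z < h0" using h0(1) by (auto simp: gaps_def)
      have fT: "x \<in> T" if "h0 < x" "x < b" for x
      proof (rule ccontr)
        assume "x \<notin> T"
        have "x \<noteq> Max T" using \<open>x \<notin> T\<close> b(1) by blast
        then have "x < Max T" "z < x" using that z(2) by (simp_all add: b_def)
        then have "x \<in> gaps T" unfolding gaps_def using \<open>x \<notin> T\<close> b(1) z(1) by blast
        then show False using h0(2) that by force
      qed
      have h0T: "h0 \<notin> T" using h0(1) by (auto simp: gaps_def)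
      define Z X3 where "Z = T \<inter> {..<h0}" and "X3 = X \<inter> {..<h0}"
      have le: "b \<le> N" "e0 < b" "1 \<le> h0" "Z \<subseteq> {1..<h0}" "X3 \<subseteq> {1..<h0}" "X3 \<subseteq> Z"
        using b e0 z TN XT by (auto simp: Z_def X3_def b_def)
      have T: "T = Z \<union> {Suc h0..<b}"
      proof (intro equalityI subsetI)
        fix x assume "x \<in> T"
        then show "x \<in> Z \<union> {Suc h0..<b}" using b(2)[of x] h0T by (cases x h0 rule: linorder_cases) (auto simp: Z_def)
      qed (use fT in \<open>auto simp: Z_def\<close>)
      have gs: "gaps (Z \<union> {u..<s}) \<subseteq> gaps T" if "h0 < s" "s \<le> b" "u \<in> {h0, Suc h0}" for s u
      proof (rule gaps_subset)
        have "x \<in> T \<union> gaps T" if "h0 \<le> x" "x < b" for x using fT[of x] h0(1) that by (cases "x = h0") auto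
        moreover have "h0 \<le> x" "x < b" if "x \<in> {u..<s}" for x using that \<open>s \<le> b\<close> \<open>u \<in> {h0, Suc h0}\<close> by auto
        ultimately show "Z \<union> {u..<s} \<subseteq> T \<union> gaps T" unfolding Z_def by blast
        show "x \<in> Z \<union> {u..<s}" if "x \<in> T" "y \<in> Z \<union> {u..<s}" "x < y" for x y
          using that \<open>h0 < s\<close> \<open>u \<in> {h0, Suc h0}\<close> h0T by (cases x h0 rule: linorder_cases) (auto simp: Z_def)
      qed
      have pre: "commutes (X3 \<union> {Suc h0..<s}) T" if s: "e0 \<le> s" "s \<le> Suc e0" "Suc h0 < s" for s
      proof -
        have c: "commutes (X3 \<union> {Suc h0..<s}) (Z \<union> {Suc h0..<s})"
        proof (rule closer)
          have "(Z \<union> {Suc h0..<s}) - (X3 \<union> {Suc h0..<s}) \<subseteq> T - X - {e0}" using e0(2) by (auto simp: X3_def Z_def)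
          then show "(Z \<union> {Suc h0..<s}) - (X3 \<union> {Suc h0..<s}) \<subset> T - X" using e0(1) by blast
          show "gaps (Z \<union> {Suc h0..<s}) \<subseteq> gaps T" using gs[of s "Suc h0"] s le(2) by simp
          have "Z \<union> {Suc h0..<s} \<subseteq> T" using s le(2) by (auto simp: Z_def intro!: fT)
          then show "Z \<union> {Suc h0..<s} \<subseteq> {1..<N}" using TN by (rule subset_trans)
          show "X3 \<union> {Suc h0..<s} \<subseteq> Z \<union> {Suc h0..<s}" using le(6) by blast
        qed
        show ?thesis
        proof (cases "b = s")
          case True then show ?thesis using c T by simp
        next
          case False
          have f: "commutes (X3 \<union> {Suc h0..<s}) (Z \<union> {h0..<b'})" if "s \<le> b'" "b' \<le> b" for b'
          proof (rule fill[OF gs h0(1)])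
            show "Z \<union> {h0..<b'} \<subseteq> {1..<N}" using that le(1,3) e0(2) s(3) subset_ivl[OF le(4), of 1 N] le(2) by auto
            show "X3 \<union> {Suc h0..<s} \<subseteq> Z \<union> {h0..<b'}" using that le(6) by auto
          qed (use that s in simp_all)
          have "s < b" using False s(2) le(2) by simp
          show ?thesis unfolding T
            by (rule commutes_prefix[OF le(3) lessI s(3) \<open>s < b\<close> le(1,4,5) f c f]) (use \<open>s < b\<close> in simp_all)
        qed
      qed
      show ?thesis
      proof (rule rem[of e0])
        show "commutes (insert e0 (X \<inter> {Suc e0..})) T" "commutes (X \<inter> {Suc e0..}) T"
          using XT e0 by (auto intro!: miss[OF h0(1)])
        have mem: "x \<in> X \<and> x < e0 \<longleftrightarrow> x \<in> X3 \<union> {Suc h0..<e0}" for x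
          using e0(2) e0(3)[of x] fT[of x] h0T XT le(2) by (cases x h0 rule: linorder_cases) (auto simp: X3_def)
        then have eq: "X \<inter> {..<e0} = X3 \<union> {Suc h0..<e0}" by blast
        have eq2: "insert e0 (X \<inter> {..<e0}) = X3 \<union> {Suc h0..<Suc e0}" unfolding eq using e0(2) by auto
        show "commutes (insert e0 (X \<inter> {..<e0})) T" unfolding eq2 using pre e0 by simp
        show "commutes (X \<inter> {..<e0}) T"
        proof (cases "Suc h0 < e0")
          case False
          then show ?thesis using XT by (intro miss[OF h0(1)]) (auto simp: eq X3_def)
        qed (use pre eq in simp)
      qed (use e0 add in auto)
    next
      case 2
      show ?thesis by (rule gapless_commutes[OF XT TN 2])
    qed simp
  qed
  then show ?case using outer.prems by blast
qed

end

section \<open>The general exchange relation\<close>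

context aw_family
begin

lemma exch_right_induct:
  assumes R: "R \<subseteq> {u..<N}" and XY: "X \<subseteq> {1..<u}" "Y \<subseteq> {1..<u}" and u: "1 \<le> u" "u \<le> N"
    and base: "\<And>s f. u \<le> s \<Longrightarrow> s < f \<Longrightarrow> f \<le> N \<Longrightarrow> exch c X Y {s..<f}"
  shows "exch c X Y R"
proof -
  interpret m: aw_family c' N by (rule mirror_family)
  have N: "R \<subseteq> {1..<N}" "X \<subseteq> {1..<N}" "Y \<subseteq> {1..<N}"
    using u by (simp_all add: subset_ivl[OF R] subset_ivl[OF XY(1)] subset_ivl[OF XY(2)])
  show ?thesis
  proof (cases "R = {}")
    case True
    then show ?thesis using N by (auto intro!: exch_empty_right nested_commutes)
  next
    case False
    then have u1: "1 \<le> u" "u < N" using R u by auto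
    note N' = N
    have "exch c' (mirror N R) (mirror N Y) (mirror N X)"
    proof (rule m.exch_left_induct)
      show "mirror N R \<subseteq> {1..<N + 1 - u}" using mirror_subset[OF R order_refl] by simp
      show "mirror N Y \<subseteq> {N + 1 - u..<N}" "mirror N X \<subseteq> {N + 1 - u..<N}"
        using mirror_subset[OF XY(1) u(2)] mirror_subset[OF XY(2) u(2)] by simp_all
      show "exch c' {} (mirror N Y) (mirror N X)"
        using mirror_subset[OF XY(1) u(2)] mirror_subset[OF XY(2) u(2)] u1
        by (intro m.exch_empty_left m.nested_commutes) (auto simp: subset_iff)
      fix a p assume a: "1 \<le> a" "a < p" "p \<le> N + 1 - u"
      then have "exch c X Y {N + 1 - p..<N + 1 - a}" using u1 by (intro base) auto
      moreover have "mirror N {a..<p} = {N + 1 - p..<N + 1 - a}" using a u1 by (intro mirror_interval) auto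
      ultimately show "exch c' {a..<p} (mirror N Y) (mirror N X)"
        using N' a u1 by (intro exch_Op) (auto simp: mirror_mirror intro!: nested_commutes)
    qed
    then show ?thesis using N' by (intro exch_from_mirror nested_commutes) auto
  qed
qed

lemma exch_cyclic_gap:
  assumes "exch c A G (K \<union> Z)" "exch c A G (K \<union> Y)" "exch c A G K" "exch c A G (K \<union> Y \<union> Z)"
    "exch c Y Z (G \<union> K)" "exch c Y Z K" "exch c Y Z (A \<union> G \<union> K)"
    "commutes (A \<union> G) (Y \<union> Z)" "commutes (A \<union> G) Y" "commutes Z (A \<union> G)" "commutes A (Y \<union> Z)"
    "commutes G (Y \<union> Z)" "commutes A Z" "commutes G Z"
    "commutes Y (A \<union> G)" "commutes Y (A \<union> G \<union> K)" "commutes Y A" "commutes Y G" "commutes Y K" "commutes Y (G \<union> K)"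
    "commutes Y (A \<union> K)"
  shows "exch c Y Z (A \<union> K)"
proof -
  \<comment> \<open>The ring identity has the product of the first and third elements in the
    opposite order.\<close>
  have sw: "exch c Y Z S \<longleftrightarrow> c (S \<union> Y) = - qcomm (c (Y \<union> Z)) (c (S \<union> Z)) + c S * c Y + c Z * c (S \<union> Y \<union> Z)" if "commutes Y S" for S
    using that unfolding exch_def commutes_def by (simp only: Un_ac)
  show ?thesis
    using assms(1-14) unfolding sw[OF assms(19)] sw[OF assms(20)] sw[OF assms(16)] sw[OF assms(21)] apply -
    apply (unfold exch_def commutes_def)
    apply (simp (no_asm_use) only: Un_ac)
    apply (rule L_gapX_ring; assumption)
    done
qed

text \<open>Gaps of \<open>P\<close> are closed by \<open>exch_cyclic_gap\<close>, those of
  \<open>Q\<close> by the wrap-around identity with nothing on the far right. This leaves an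
  interval ending at \<open>d\<close> and an interval before it, while \<open>H\<close> stays
  arbitrary.\<close>

lemma exch_cyclic_induct:
  assumes P: "P \<subseteq> {1..<l}" and Q: "Q \<subseteq> {l..<d}" and H: "H \<subseteq> {d..<N}" and le: "1 \<le> l" "l \<le> d" "d \<le> N"
    and base: "\<And>a p b. \<lbrakk>1 \<le> a; a < p; p \<le> b; b < d\<rbrakk> \<Longrightarrow> exch c {b..<d} H {a..<p}"
  shows "exch c Q H P"
proof -
  have N: "P \<subseteq> {1..<N}" "Q \<subseteq> {1..<N}" "H \<subseteq> {1..<N}"
    using le by (simp_all add: subset_ivl[OF P] subset_ivl[OF Q] subset_ivl[OF H])
  have ap: "commutes X Y \<and> commutes Y X" if "X \<subseteq> {1..<x}" "Y \<subseteq> {x..<N}" "1 \<le> x" for X Y x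
    using commutes_apart[OF that(1,2)] by simp
  have adj: "exch c {b..<d} H P" if b: "l \<le> b" "b < d" for b
    using finite_ivl_subset[OF P] P
  proof (induction P rule: gap_induct)
    case empty
    show ?case using N b le by (intro exch_empty_right nested_commutes) auto
  next
    case (interval a x)
    then show ?case using base[of a x b] b by simp
  next
    case (gap a x y K)
    note B = gap_bounds[OF gap.prems gap(1-4)]
    note S = subset_ivl[OF B(2)] subset_ivl[OF H]
    show ?case
    proof (rule exch_cyclic_gap[of _ "{x..<y}"])
      show "exch c {a..<x} {x..<y} (K \<union> H)" "exch c {a..<x} {x..<y} (K \<union> {b..<d})" "exch c {a..<x} {x..<y} K"
        "exch c {a..<x} {x..<y} (K \<union> {b..<d} \<union> H)"
        using B gap(1,2) b le by (intro exch_middle; simp add: S)+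
      show "exch c {b..<d} H ({x..<y} \<union> K)" "exch c {b..<d} H K" "exch c {b..<d} H ({a..<x} \<union> {x..<y} \<union> K)"
        using gap(6)[OF B(6)] gap(7)[OF B(4)] gap(8)[OF B(5)] gap(1,2) by (simp_all add: Un_ivl)
      have "commutes X Y \<and> commutes Y X" if "X \<subseteq> {1..<b}" "Y \<subseteq> {b..<N}" for X Y
        using ap[OF that] b le by simp
      moreover have "{a..<x} \<union> {x..<y} \<subseteq> {1..<b}" "{x..<y} \<subseteq> {1..<b}" "{a..<x} \<subseteq> {1..<b}" "K \<subseteq> {1..<b}"
        "{b..<d} \<subseteq> {b..<N}" "H \<subseteq> {b..<N}" "{a..<x} \<union> {x..<y} \<union> K \<subseteq> {1..<b}" "{x..<y} \<union> K \<subseteq> {1..<b}" "{a..<x} \<union> K \<subseteq> {1..<b}" "{b..<d} \<union> H \<subseteq> {b..<N}"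
        using B gap(1,2) b le by (simp_all add: S)
      ultimately show "commutes ({a..<x} \<union> {x..<y}) ({b..<d} \<union> H)" "commutes ({a..<x} \<union> {x..<y}) {b..<d}" "commutes H ({a..<x} \<union> {x..<y})"
        "commutes {a..<x} ({b..<d} \<union> H)" "commutes {x..<y} ({b..<d} \<union> H)" "commutes {a..<x} H" "commutes {x..<y} H"
        "commutes {b..<d} ({a..<x} \<union> {x..<y})" "commutes {b..<d} ({a..<x} \<union> {x..<y} \<union> K)" "commutes {b..<d} {a..<x}" "commutes {b..<d} {x..<y}"
        "commutes {b..<d} K" "commutes {b..<d} ({x..<y} \<union> K)" "commutes {b..<d} ({a..<x} \<union> K)"
        by blast+
    qed
  qed
  have step: "exch c ({a..<x} \<union> K) H P"
    if x: "l \<le> a" "a < x" "x < y" "y \<le> d" and K: "K \<subseteq> {y..<d}"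
      and IH: "exch c ({x..<y} \<union> K) H P" "exch c K H P" "exch c ({a..<x} \<union> {x..<y} \<union> K) H P"
    for a x y K
  proof -
    note S = subset_ivl[OF H] subset_ivl[OF K] subset_ivl[OF P]
    have "exch c {a..<x} {x..<y} (K \<union> P)" "exch c {a..<x} {x..<y} ((K \<union> H) \<union> P)"
      using x le by (intro exch_wrap_adjacent; simp add: S)+
    moreover have "exch c {a..<x} {x..<y} (K \<union> H)" "exch c {a..<x} {x..<y} K"
      using x le by (intro exch_middle; simp add: S)+
    moreover have "commutes {x'..<y'} (P \<union> H)" if "a \<le> x'" "y' \<le> y" for x' y'
      using x le that by (intro commutes_between; simp add: S)
    moreover have "commutes X H \<and> commutes H X" if "X \<subseteq> {1..<d}" for X using ap[OF that H] le by simp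
    moreover have "commutes {x'..<y'} P" if "a \<le> x'" "y' \<le> y" for x' y'
      using ap[of P a "{x'..<y'}"] x le that by (simp add: S)
    moreover have "{a..<x} \<union> {x..<y} = {a..<y}" "{a..<x} \<subseteq> {1..<d}" "{x..<y} \<subseteq> {1..<d}" "{a..<y} \<subseteq> {1..<d}"
      using x le by (simp_all add: Un_ivl)
    ultimately have all: "exch c {a..<x} {x..<y} (K \<union> H)" "exch c {a..<x} {x..<y} K" "exch c {a..<x} {x..<y} (K \<union> P)"
      "exch c {a..<x} {x..<y} (K \<union> H \<union> P)" "commutes ({a..<x} \<union> {x..<y}) (P \<union> H)" "commutes ({a..<x} \<union> {x..<y}) P"
      "commutes H ({a..<x} \<union> {x..<y})" "commutes {a..<x} (P \<union> H)" "commutes {x..<y} (P \<union> H)" "commutes {a..<x} H" "commutes {x..<y} H"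
      using x(2,3) by (simp_all only: less_imp_le order_refl)
    show ?thesis
      by (rule exch_wrap_gap2[of "{a..<x}" "{x..<y}" K H "{}" P, unfolded Un_empty_left Un_empty_right])
        (rule all IH)+
  qed
  have empty: "exch c {} H P" using N by (intro exch_empty_left nested_commutes) auto
  have ivl: "exch c {a..<x} H P" if "l \<le> a" "a < x" "x \<le> d" for a x
  proof (cases "x = d")
    case True then show ?thesis using adj that by simp
  next
    case False
    then show ?thesis
      using step[of a x d "{}"] adj[of x] adj[of a] empty that by (simp add: Un_ivl)
  qed
  show ?thesis using finite_ivl_subset[OF Q] Q
  proof (induction Q rule: gap_induct)
    case (interval a x)
    then show ?case using ivl by simp
  next
    case (gap a x y K)
    note B = gap_bounds[OF gap.prems gap(1-4)]
    show ?case
      using step[of a x y K] gap(6)[OF B(6)] gap(7)[OF B(4)] gap(8)[OF B(5)] B gap(1,2) by (simp add: Un_ivl)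
  qed (rule empty)
qed

text \<open>Collects the commutations shared by the two four-block identities. The order on the line
  does not occur in it, so it also covers rotations in which the rightmost set is listed
  first.\<close>

definition blocks :: "nat set \<Rightarrow> nat set \<Rightarrow> nat set \<Rightarrow> nat set \<Rightarrow> bool"
  where "blocks A B D E \<longleftrightarrow> A \<union> B \<union> D \<union> E \<subseteq> {1..<N} \<and>
    A \<inter> B = {} \<and> A \<inter> D = {} \<and> A \<inter> E = {} \<and> B \<inter> D = {} \<and> B \<inter> E = {} \<and> D \<inter> E = {} \<and>
    (\<forall>X\<in>{A, B, D, E}. \<forall>Y. Y \<subseteq> A \<union> B \<union> D \<union> E \<and> X \<inter> Y = {} \<longrightarrow> commutes Y X) \<and>
    commutes (B \<union> D) (A \<union> E) \<and> commutes (D \<union> E) (A \<union> B)"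

lemma blocks_central:
  assumes "blocks A B D E"
  defines "F \<equiv> A \<union> B \<union> D \<union> E"
  shows "\<forall>z\<in>{c A, c B, c D, c E, c F}. \<forall>y\<in>{c (A \<union> B), c (B \<union> D), c (D \<union> E), c (A \<union> B \<union> D), c (B \<union> D \<union> E), c (A \<union> D), c (A \<union> E),
      c (B \<union> E), c (A \<union> B \<union> E), c (A \<union> D \<union> E)}. y * z = z * y"
    and "\<forall>y\<in>{c B, c D, c E, c F}. y * c A = c A * y" "\<forall>y\<in>{c D, c E, c F}. y * c B = c B * y"
    "\<forall>y\<in>{c E, c F}. y * c D = c D * y" "c F * c E = c E * c F"
proof -
  have F: "F \<subseteq> {1..<N}" using assms by (auto simp: blocks_def)
  note b = assms(1)[unfolded blocks_def]
  have dj0: "A \<inter> B = {}" "A \<inter> D = {}" "A \<inter> E = {}" "B \<inter> D = {}" "B \<inter> E = {}" "D \<inter> E = {}"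
    using b by (simp_all only:)
  have bl: "\<forall>X\<in>{A, B, D, E}. \<forall>Y. Y \<subseteq> F \<and> X \<inter> Y = {} \<longrightarrow> commutes Y X"
    using b unfolding F_def by (elim conjE)
  have dj: "B \<inter> A = {}" "D \<inter> A = {}" "E \<inter> A = {}" "D \<inter> B = {}" "E \<inter> B = {}" "E \<inter> D = {}"
    using dj0 by (simp_all only: Int_commute)
  note dj = dj0 dj
  have key: "c Y * c Z = c Z * c Y" if Z: "Z \<in> {A, B, D, E, F}" and Y: "Y \<subseteq> F" and r: "Z = F \<or> Z \<inter> Y = {} \<or> Z \<subseteq> Y" for Y Z
  proof -
    have "commutes Y Z"
      using r
    proof (elim disjE)
      assume "Z = F" then show ?thesis using nested_commutes[OF Y F] by simp
    next
      assume "Z \<subseteq> Y" then show ?thesis using nested_commutes[of Z Y] Y F by (auto intro: commutes_sym)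
    next
      assume *: "Z \<inter> Y = {}"
      show ?thesis
      proof (cases "Z = F")
        case True then show ?thesis using nested_commutes[OF Y F] by simp
      next
        case False
        then have "Z \<in> {A, B, D, E}" using Z by blast
        then show ?thesis using bl Y * by blast
      qed
    qed
    then show ?thesis by (rule commutesI)
  qed
  have F0: "F = A \<union> B \<union> D \<union> E" by (simp add: F_def)
  show "\<forall>z\<in>{c A, c B, c D, c E, c F}. \<forall>y\<in>{c (A \<union> B), c (B \<union> D), c (D \<union> E), c (A \<union> B \<union> D), c (B \<union> D \<union> E), c (A \<union> D), c (A \<union> E),
      c (B \<union> E), c (A \<union> B \<union> E), c (A \<union> D \<union> E)}. y * z = z * y"
    unfolding ball_simps by (intro conjI TrueI; rule key; simp add: F0 Int_Un_distrib dj; blast?)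
  show "\<forall>y\<in>{c B, c D, c E, c F}. y * c A = c A * y" "\<forall>y\<in>{c D, c E, c F}. y * c B = c B * y"
    "\<forall>y\<in>{c E, c F}. y * c D = c D * y" "c F * c E = c E * c F"
    unfolding ball_simps by ((intro conjI TrueI)?; rule key; simp add: F0 Int_Un_distrib dj; blast?)+
qed

lemma exch_step:
  assumes b: "blocks A B D E"
    and T: "exch c (D \<union> E) A B" "exch c (B \<union> D) E A" "exch c B (D \<union> E) A" "exch c E A D" "exch c B D A"
      "exch c E A (B \<union> D)" "exch c B D E" "exch c D E A" "exch c E A B" "exch c D A B" "exch c A B D"
      "exch c A D E" "exch c A B (D \<union> E)" "exch c A B E"
  shows "exch c A (B \<union> D) E"
proof -
  have U: "A \<union> B \<union> D \<union> E \<subseteq> {1..<N}" using b by (simp add: blocks_def)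
  have n: "commutes (A \<union> B \<union> D) (A \<union> B)" "commutes (A \<union> D \<union> E) (A \<union> E)" "commutes (A \<union> B \<union> E) (A \<union> B)"
    by (rule commutes_sym, rule nested_commutes; use U in blast)+
  have d: "commutes (B \<union> D) (A \<union> E)" "commutes (D \<union> E) (A \<union> B)" using b by (simp_all add: blocks_def)
  note C = blocks_central[OF b]
  have "c (A \<union> E) = - qcomm (c (A \<union> B \<union> D)) (c (B \<union> D \<union> E)) + c A * c E + c (B \<union> D) * c (A \<union> B \<union> D \<union> E)"
    apply (rule step_B_ring[where ?x1.0 = "c A" and ?x2.0 = "c B" and ?x3.0 = "c D" and ?x4.0 = "c E" and ?F = "c (A \<union> B \<union> D \<union> E)"
        and ?x12.0 = "c (A \<union> B)" and ?x23.0 = "c (B \<union> D)" and ?x34.0 = "c (D \<union> E)" and ?x123.0 = "c (A \<union> B \<union> D)"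
        and ?x234.0 = "c (B \<union> D \<union> E)" and ?x13.0 = "c (A \<union> D)" and ?x14.0 = "c (A \<union> E)" and ?x24.0 = "c (B \<union> E)"
        and ?x124.0 = "c (A \<union> B \<union> E)" and ?x134.0 = "c (A \<union> D \<union> E)", OF _ _ _ _ _ _ _ _ _ _ _ _ _ _ C
          n[unfolded commutes_def] d[unfolded commutes_def]])
                 apply (insert T(1), unfold exch_def, simp (no_asm_use) only: Un_ac)[1]
                 apply (insert T(2), unfold exch_def, simp (no_asm_use) only: Un_ac)[1]
                 apply (insert T(3), unfold exch_def, simp (no_asm_use) only: Un_ac)[1]
                 apply (insert T(4), unfold exch_def, simp (no_asm_use) only: Un_ac)[1]
                 apply (insert T(5), unfold exch_def, simp (no_asm_use) only: Un_ac)[1]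
                 apply (insert T(6), unfold exch_def, simp (no_asm_use) only: Un_ac)[1]
                 apply (insert T(7), unfold exch_def, simp (no_asm_use) only: Un_ac)[1]
                 apply (insert T(8), unfold exch_def, simp (no_asm_use) only: Un_ac)[1]
                 apply (insert T(9), unfold exch_def, simp (no_asm_use) only: Un_ac)[1]
                 apply (insert T(10), unfold exch_def, simp (no_asm_use) only: Un_ac)[1]
                 apply (insert T(11), unfold exch_def, simp (no_asm_use) only: Un_ac)[1]
                 apply (insert T(12), unfold exch_def, simp (no_asm_use) only: Un_ac)[1]
                 apply (insert T(13), unfold exch_def, simp (no_asm_use) only: Un_ac)[1]
                 apply (insert T(14), unfold exch_def, simp (no_asm_use) only: Un_ac)[1]
    done
  then show ?thesis unfolding exch_def by (simp only: Un_assoc)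
qed

text \<open>Disjoint enclosing intervals allow \<open>separated_commutes\<close> for a single block
  against any set that avoids it. The two commutations between unions depend on the arrangement and
  are left as hypotheses.\<close>

lemma blocksI:
  assumes S: "A \<subseteq> {a..<a'}" "B \<subseteq> {b..<b'}" "D \<subseteq> {d..<d'}" "E \<subseteq> {e..<e'}"
    and I: "{a..<a'} \<subseteq> {1..<N}" "{b..<b'} \<subseteq> {1..<N}" "{d..<d'} \<subseteq> {1..<N}" "{e..<e'} \<subseteq> {1..<N}"
    and J: "{a..<a'} \<inter> {b..<b'} = {}" "{a..<a'} \<inter> {d..<d'} = {}" "{a..<a'} \<inter> {e..<e'} = {}" "{b..<b'} \<inter> {d..<d'} = {}"
      "{b..<b'} \<inter> {e..<e'} = {}" "{d..<d'} \<inter> {e..<e'} = {}"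
    and c: "commutes (B \<union> D) (A \<union> E)" "commutes (D \<union> E) (A \<union> B)"
  shows "blocks A B D E"
proof -
  have U: "A \<subseteq> {1..<N}" "B \<subseteq> {1..<N}" "D \<subseteq> {1..<N}" "E \<subseteq> {1..<N}" using S I by (auto intro: subset_trans)
  have dj: "A \<inter> B = {}" "A \<inter> D = {}" "A \<inter> E = {}" "B \<inter> D = {}" "B \<inter> E = {}" "D \<inter> E = {}"
    using S J by blast+
  have disj: "I \<inter> Y = {}" if "X \<subseteq> I" "X1 \<subseteq> I1" "X2 \<subseteq> I2" "X3 \<subseteq> I3" "I \<inter> I1 = {}" "I \<inter> I2 = {}" "I \<inter> I3 = {}"
    "Y \<subseteq> X \<union> X1 \<union> X2 \<union> X3" "X \<inter> Y = {}" for I Y X X1 X2 X3 I1 I2 I3 :: "nat set"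
    using that by blast
  have "commutes Y X" if XY: "X \<in> {A, B, D, E}" "Y \<subseteq> A \<union> B \<union> D \<union> E" "X \<inter> Y = {}" for X Y
  proof -
    have "Y \<subseteq> {1..<N}" using XY(2) U by blast
    then have sep: "commutes Y X" if "X \<subseteq> {x..<x'}" "{x..<x'} \<inter> Y = {}" "{x..<x'} \<subseteq> {1..<N}" for x x'
      using separated_commutes(2)[OF that(1) refl that(2,3)] by blast
    consider "X = A" | "X = B" | "X = D" | "X = E" using XY(1) by blast
    then show ?thesis
    proof cases
      case 1
      have "Y \<subseteq> A \<union> B \<union> D \<union> E" "A \<inter> Y = {}" using XY(2,3) 1 by auto
      from disj[OF S(1) S(2) S(3) S(4) J(1) J(2) J(3) this] show ?thesis
        using sep[of a a'] S(1) 1 I(1) by simp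
    next
      case 2
      have "Y \<subseteq> B \<union> A \<union> D \<union> E" "B \<inter> Y = {}" using XY(2,3) 2 by auto
      from disj[OF S(2) S(1) S(3) S(4) J(1)[unfolded Int_commute[of "{a..<a'}"]] J(4) J(5) this] show ?thesis
        using sep[of b b'] S(2) 2 I(2) by simp
    next
      case 3
      have "Y \<subseteq> D \<union> A \<union> B \<union> E" "D \<inter> Y = {}" using XY(2,3) 3 by auto
      from disj[OF S(3) S(1) S(2) S(4) J(2)[unfolded Int_commute[of "{a..<a'}"]] J(4)[unfolded Int_commute[of "{b..<b'}"]] J(6) this] show ?thesis
        using sep[of d d'] S(3) 3 I(3) by simp
    next
      case 4
      have "Y \<subseteq> E \<union> A \<union> B \<union> D" "E \<inter> Y = {}" using XY(2,3) 4 by auto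
      from disj[OF S(4) S(1) S(2) S(3) J(3)[unfolded Int_commute[of "{a..<a'}"]] J(5)[unfolded Int_commute[of "{b..<b'}"]] J(6)[unfolded Int_commute[of "{d..<d'}"]] this] show ?thesis
        using sep[of e e'] S(4) 4 I(4) by simp
    qed
  qed
  then have all: "\<forall>X\<in>{A, B, D, E}. \<forall>Y. Y \<subseteq> A \<union> B \<union> D \<union> E \<and> X \<inter> Y = {} \<longrightarrow> commutes Y X" by blast
  have "A \<union> B \<union> D \<union> E \<subseteq> {1..<N}" using U by simp
  then show ?thesis unfolding blocks_def using dj all c by (intro conjI)
qed

lemma exch_left:
  assumes "P \<subseteq> {1..<l}" "Q \<subseteq> {l..<d}" "1 \<le> l" "l \<le> d" "d < e" "e \<le> N"
  shows "exch c Q {d..<e} P"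
  using exch_wrap[of P l Q d "{}" e] assms by simp

lemma exch_right:
  assumes "Q \<subseteq> {e..<u}" "R \<subseteq> {u..<N}" "1 \<le> d" "d < e" "e \<le> u" "u \<le> N"
  shows "exch c R {d..<e} Q"
  using exch_wrap_right[of "{}" d Q e u R] assms by simp

lemma exch_line_step:
  assumes B: "B \<subseteq> {p..<b}" and le: "1 \<le> a" "a < p" "p \<le> b" "Suc b < f" "f \<le> N"
    and IH: "\<And>E. E \<subseteq> {b..<N} \<Longrightarrow> exch c {a..<p} B E"
  shows "exch c {a..<p} (B \<union> {b}) {Suc b..<f}"
proof -
  let ?A = "{a..<p}" and ?D = "{b..<Suc b}" and ?E = "{Suc b..<f}"
  note S = subset_ivl[OF B]
  have u: "?D \<union> ?E = {b..<f}" using le by auto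
  have BD: "B \<union> ?D \<subseteq> {p..<Suc b}" using le by (simp add: S)
  have bl: "blocks ?A B ?D ?E"
  proof (rule blocksI[OF order_refl B order_refl order_refl])
    have "?A \<union> ?E \<subseteq> {1..<N}" "{p..<Suc b} \<subseteq> {1..<N}" using le by simp_all
    moreover have "{p..<Suc b} \<inter> (?A \<union> ?E) = {}" by auto
    ultimately show "commutes (B \<union> ?D) (?A \<union> ?E)" using separated_commutes(1)[OF BD refl] by blast
    show "commutes (?D \<union> ?E) (?A \<union> B)" unfolding u using le commutes_apart(2)[of "?A \<union> B" 1 b "{b..<f}" b N] by (simp add: S)
  qed (use le in auto)
  have "exch c ?A (B \<union> ?D) ?E"
  proof (rule exch_step[OF bl])
    show "exch c (?D \<union> ?E) ?A B" "exch c ?D ?A B"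
      using le by (intro exch_right[of _ _ b]; simp add: S)+
    show "exch c ?E ?A ?D" "exch c ?E ?A (B \<union> ?D)" "exch c ?E ?A B"
      using le by (intro exch_right[of _ _ "Suc b"]; simp add: S)+
    show "exch c (B \<union> ?D) ?E ?A" "exch c B (?D \<union> ?E) ?A" "exch c B ?D ?A" "exch c ?D ?E ?A"
      unfolding u using le by (intro exch_left[of _ p]; simp add: S)+
    show "exch c B ?D ?E" "exch c ?A ?D ?E" using le by (intro exch_middle; simp add: S)+
    show "exch c ?A B ?D" "exch c ?A B (?D \<union> ?E)" "exch c ?A B ?E" using le by (auto intro!: IH)
  qed
  then show ?thesis by simp
qed

text \<open>The middle block grows by its largest point \<open>b\<close>. With the outer blocks
  reduced to intervals, \<open>exch_line_step\<close> settles a third block that starts at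
  \<open>Suc b\<close>, and \<open>exch_exchange_hole\<close> reaches one that starts later.\<close>

lemma exch_line:
  assumes "P \<subseteq> {1..<l}" "Q \<subseteq> {l..<u}" "R \<subseteq> {u..<N}" "1 \<le> l" "l \<le> u" "u \<le> N"
  shows "exch c P Q R"
proof -
  have "finite Q" using finite_ivl_subset[OF assms(2)] .
  then show ?thesis using assms
  proof (induction Q arbitrary: P R u rule: finite_linorder_max_induct)
    case empty
    then show ?case using commutes_apart[of P 1 l R u N] by (intro exch_empty_middle) simp
  next
    case (insert b B)
    note prems = insert.prems
    have bl: "l \<le> b" "b < u" and B: "B \<subseteq> {l..<b}" using prems(2) insert.hyps by auto
    have N: "B \<union> {b} \<subseteq> {1..<N}" using B bl prems by (simp add: subset_ivl[OF B])
    have core: "exch c {a..<p} (B \<union> {b}) {s..<f}" if ap: "1 \<le> a" "a < p" "p \<le> l" and sf: "Suc b \<le> s" "s < f" "f \<le> N" for a p s f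
    proof -
      have st: "exch c {a..<p} (B \<union> {b}) {Suc b..<f}" if "Suc b < f" "f \<le> N" for f
        using ap that bl prems
        by (intro exch_line_step) (simp_all add: subset_ivl[OF B] insert.IH[of _ b])
      show ?thesis
      proof (cases "s = Suc b")
        case False
        then have s: "Suc b < s" using sf by simp
        have apart: "commutes X Y \<and> commutes Y X" if "X \<subseteq> {1..<x}" "Y \<subseteq> {x..<N}" for X Y x
          using commutes_apart[OF that order_refl] by simp
        have sub: "{a..<p} \<subseteq> {1..<l}" "B \<union> {b} \<subseteq> {l..<Suc b}" "{a..<p} \<union> (B \<union> {b}) \<subseteq> {1..<Suc b}" "B \<union> {b} \<subseteq> {1..<Suc b}" "{a..<p} \<subseteq> {1..<Suc b}"
          "{Suc b..<s} \<union> {s..<f} \<subseteq> {Suc b..<N}" "{Suc b..<s} \<subseteq> {Suc b..<N}" "{s..<f} \<subseteq> {Suc b..<N}"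
          "{Suc b..<s} \<union> {s..<f} \<subseteq> {1..<N}" "{Suc b..<s} \<subseteq> {Suc b..<s} \<union> {s..<f}" "B \<union> {b} \<subseteq> {a..<p} \<union> (B \<union> {b})"
          "{a..<p} \<union> (B \<union> {b}) \<subseteq> {1..<N}" "{s..<f} \<subseteq> {s..<N}"
          using ap sf s bl prems by (auto simp: subset_ivl[OF B])
        have "exch c {a..<p} (B \<union> {b}) {s..<f} \<longleftrightarrow> exch c {a..<p} {Suc b..<s} {s..<f}"
        proof (rule exch_exchange_hole)
          show "exch c {a..<p} (B \<union> {b}) {Suc b..<s}" using st s sf by simp
          show "exch c {a..<p} (B \<union> {b}) ({Suc b..<s} \<union> {s..<f})" using st[of f] s sf by (simp add: Un_ivl)
          show "exch c (B \<union> {b}) {Suc b..<s} {s..<f}" "exch c ({a..<p} \<union> (B \<union> {b})) {Suc b..<s} {s..<f}"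
            using s sf sub by (intro exch_middle; simp)+
          show "commutes {Suc b..<s} ({Suc b..<s} \<union> {s..<f})" using nested_commutes sub by blast
          show "commutes (B \<union> {b}) ({a..<p} \<union> (B \<union> {b}))" using nested_commutes sub by blast
        qed (rule apart[where x = "Suc b", THEN conjunct1] apart[where x = "Suc b", THEN conjunct2]; rule sub)+
        moreover have "exch c {a..<p} {Suc b..<s} {s..<f}" using s sf sub by (intro exch_middle) simp_all
        ultimately show ?thesis by simp
      qed (use st sf in simp)
    qed
    have Rb: "R \<subseteq> {Suc b..<N}" using bl by (simp add: subset_ivl[OF prems(3)])
    have "exch c P (B \<union> {b}) R"
    proof (rule exch_left_induct[OF prems(1)])
      show "B \<union> {b} \<subseteq> {l..<N}" "R \<subseteq> {l..<N}" using bl prems by (simp_all add: subset_ivl[OF B] subset_ivl[OF Rb])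
      have "R \<subseteq> {1..<N}" by (simp add: subset_ivl[OF Rb])
      then show "exch c {} (B \<union> {b}) R" using N by (intro exch_empty_left nested_commutes) auto
      fix a p assume ap: "1 \<le> a" "a < p" "p \<le> l"
      show "exch c {a..<p} (B \<union> {b}) R"
        by (rule exch_right_induct[OF Rb]) (use ap bl prems core in \<open>simp_all add: subset_ivl[OF B]\<close>)
    qed
    then show ?case by simp
  qed
qed

text \<open>Read cyclically, \<open>{z..<f}\<close> at the right end precedes \<open>A\<close>; with
  it as first block this is the same application of \<open>exch_step\<close> as on the line.\<close>

lemma exch_cyclic_step:
  assumes A: "A \<subseteq> {1..<b}" and le: "1 \<le> b" "Suc b < y" "y \<le> z" "z < f" "f \<le> N"
    and IH: "\<And>E. E \<subseteq> {b..<y} \<Longrightarrow> exch c {z..<f} A E"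
  shows "exch c {z..<f} (A \<union> {b}) {Suc b..<y}"
proof -
  let ?Z = "{z..<f}" and ?D = "{b..<Suc b}" and ?E = "{Suc b..<y}"
  note S = subset_ivl[OF A]
  have u: "?D \<union> ?E = {b..<y}" using le by auto
  have bl: "blocks ?Z A ?D ?E"
  proof (rule blocksI[OF order_refl A order_refl order_refl])
    show "commutes (A \<union> ?D) (?Z \<union> ?E)"
      using le by (intro commutes_apart(1)[of _ 1 "Suc b" _ "Suc b" N]) (simp_all add: S)
    show "commutes (?D \<union> ?E) (?Z \<union> A)" unfolding u using le A by (intro commutes_between) simp_all
  qed (use le in auto)
  have "exch c ?Z (A \<union> ?D) ?E"
  proof (rule exch_step[OF bl])
    show "exch c (?D \<union> ?E) ?Z A" "exch c ?E ?Z A" "exch c ?D ?Z A"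
      using le by (intro exch_left[of _ b]; simp add: S)+
    show "exch c ?E ?Z ?D" "exch c ?E ?Z (A \<union> ?D)"
      using le by (intro exch_left[of _ "Suc b"]; simp add: S)+
    show "exch c (A \<union> ?D) ?E ?Z" "exch c A (?D \<union> ?E) ?Z" "exch c A ?D ?Z" "exch c ?D ?E ?Z" "exch c A ?D ?E"
      unfolding u using le by (intro exch_middle; simp add: S)+
    show "exch c ?Z ?D ?E" using le by (intro exch_right[of _ _ y]) simp_all
    show "exch c ?Z A ?D" "exch c ?Z A (?D \<union> ?E)" "exch c ?Z A ?E" using le by (auto intro!: IH)
  qed
  then show ?thesis by simp
qed

lemma exch_cyclic_right:
  assumes "X \<subseteq> {1..<l}" "Y \<subseteq> {l..<u}" "Z \<subseteq> {u..<N}" "1 \<le> l" "l \<le> u" "u \<le> N"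
  shows "exch c Z X Y"
proof -
  interpret m: aw_family c' N by (rule mirror_family)
  have "finite X" using finite_ivl_subset[OF assms(1)] .
  then show ?thesis using assms
  proof (induction X arbitrary: l u Y Z rule: finite_linorder_max_induct)
    case empty
    then show ?case using commutes_apart[of Y l u Z u N] by (intro exch_empty_middle) simp
  next
    case (insert b A)
    note prems = insert.prems
    have bl: "1 \<le> b" "b < l" and A: "A \<subseteq> {1..<b}" using prems(1) insert.hyps by auto
    let ?X = "insert b A"
    have X: "?X \<subseteq> {1..<Suc b}" using A bl by auto
    have N: "?X \<subseteq> {1..<N}" "Y \<subseteq> {1..<N}" "Z \<subseteq> {1..<N}"
      using bl prems by (simp_all add: subset_ivl[OF A] subset_ivl[OF prems(2)] subset_ivl[OF prems(3)])
    \<comment> \<open>\<open>exch_cyclic_induct\<close> covers the rotation whose middle block is at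
      the right end; reflection carries the present one, with middle block at the left end, into
      it.\<close>
    have "exch c' (mirror N Y) (mirror N ?X) (mirror N Z)"
    proof (rule m.exch_cyclic_induct[of _ "N + 1 - u" _ "N - b"])
      show "mirror N Z \<subseteq> {1..<N + 1 - u}" using mirror_subset[OF prems(3) order_refl] by simp
      have "mirror N Y \<subseteq> {N + 1 - u..<N + 1 - l}" using mirror_subset[OF prems(2)] prems by simp
      then show "mirror N Y \<subseteq> {N + 1 - u..<N - b}" by (rule subset_ivl) (use bl in auto)
      show "mirror N ?X \<subseteq> {N - b..<N}" using mirror_subset[OF X, of N] bl prems by simp
      fix a p e assume ap: "1 \<le> a" "a < p" "p \<le> e" "e < N - b"
      let ?Z = "{N + 1 - p..<N + 1 - a}" and ?Y = "{Suc b..<N + 1 - e}"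
      have "exch c ?Z (A \<union> {b}) ?Y"
      proof (rule exch_cyclic_step[OF A bl(1)])
        fix E assume "E \<subseteq> {b..<N + 1 - e}"
        then show "exch c ?Z A E"
          by (rule insert.IH[OF A]) (use ap bl in auto)
      qed (use ap in auto)
      moreover have "mirror N {a..<p} = ?Z" "mirror N {e..<N - b} = ?Y" using ap by (auto simp: mirror_interval)
      moreover have "?Z \<subseteq> {1..<N}" "?Y \<subseteq> {1..<N}" using ap by auto
      ultimately show "exch c' {e..<N - b} (mirror N ?X) {a..<p}"
        using N(1) by (intro exch_Op) (auto simp: mirror_mirror intro!: nested_commutes)
    qed (use bl prems in auto)
    then show ?case using N by (intro exch_from_mirror nested_commutes) auto
  qed
qed

lemma exch_cyclic_left:
  assumes "X \<subseteq> {1..<l}" "Y \<subseteq> {l..<u}" "Z \<subseteq> {u..<N}" "1 \<le> l" "l \<le> u" "u \<le> N"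
  shows "exch c Y Z X"
proof -
  interpret m: aw_family c' N by (rule mirror_family)
  have N: "X \<subseteq> {1..<N}" "Y \<subseteq> {1..<N}" "Z \<subseteq> {1..<N}"
    using assms by (simp_all add: subset_ivl[OF assms(1)] subset_ivl[OF assms(2)] subset_ivl[OF assms(3)])
  have "exch c' (mirror N X) (mirror N Z) (mirror N Y)"
  proof (rule m.exch_cyclic_right[of _ "N + 1 - u" _ "N + 1 - l"])
    show "mirror N Z \<subseteq> {1..<N + 1 - u}" using mirror_subset[OF assms(3) order_refl] by simp
    show "mirror N Y \<subseteq> {N + 1 - u..<N + 1 - l}" using mirror_subset[OF assms(2)] assms by simp
    show "mirror N X \<subseteq> {N + 1 - l..<N}" using mirror_subset[OF assms(1)] assms by simp
  qed (use assms in auto)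
  then show ?thesis using N by (intro exch_from_mirror nested_commutes) auto
qed

end

section \<open>The Casimir elements\<close>

lemma Op_power: "Op (x ^ 2) = Op x ^ 2"
  by (simp add: power2_eq_square Op_mult)

text \<open>Reversal of the triple product exchanges \<open>u\<close> and \<open>w\<close>, hence
  also \<open>y\<close> and \<open>z\<close>, because \<open>u\<close> belongs to the pair of
  \<open>x\<close> and \<open>y\<close> and \<open>w\<close> to that of \<open>x\<close> and
  \<open>z\<close>.\<close>

lemma Op_casimir:
  assumes c: "y * x = x * y" "z * x = x * z" "z * y = y * z" "z * f = f * z" "y * f = f * y" "x * f = f * x"
   "\<forall>y\<in>{u,v,w}. y * x = x * y" "\<forall>x\<in>{u,v,w}. x * y = y * x" "\<forall>y\<in>{u,v,w}. y * z = z * y" "\<forall>y\<in>{u,v,w}. y * f = f * y"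
  shows "casimir (Op u) (Op v) (Op w) (Op x) (Op y) (Op z) (Op f) = Op (casimir w v u x z y f)"
proof -
  have c': "u * x = x * u" "v * x = x * v" "w * x = x * w" "u * y = y * u" "v * y = y * v" "w * y = y * w"
    "u * z = z * u" "v * z = z * v" "w * z = z * w" "u * f = f * u" "v * f = f * v" "w * f = f * w"
    using c(7-10) by simp_all
  note cc = c(1-6) c'
  have p: "(y * x + f * z) * u = u * (x * y + z * f)" "(z * y + f * x) * v = v * (z * y + x * f)"
    "(z * x + f * y) * w = w * (x * z + y * f)" "f * (z * (y * x)) = x * z * y * f"
    using cc cc[THEN commute_left] by (simp_all add: algebra_simps)
  show ?thesis
    unfolding casimir_def Op_one[symmetric] Op_mult[symmetric] Op_add[symmetric] Op_power[symmetric] Op_scaleQ[symmetric] Op_diff[symmetric]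
    unfolding p Op_eq_iff by (simp add: algebra_simps)
qed

context aw_family
begin

definition cas :: "nat set \<Rightarrow> nat set \<Rightarrow> nat set \<Rightarrow> 'a"
  where "cas I J K = casimir (c (I \<union> J)) (c (J \<union> K)) (c (I \<union> K)) (c I) (c J) (c K) (c (I \<union> J \<union> K))"

lemma triple_commutes:
  assumes "I \<subseteq> {1..<l}" "J \<subseteq> {l..<u}" "K \<subseteq> {u..<N}" "1 \<le> l" "l \<le> u" "u \<le> N"
  shows "c J * c I = c I * c J" "c K * c I = c I * c K" "c K * c J = c J * c K" "c K * c (I \<union> J \<union> K) = c (I \<union> J \<union> K) * c K"
    "c J * c (I \<union> J \<union> K) = c (I \<union> J \<union> K) * c J" "c I * c (I \<union> J \<union> K) = c (I \<union> J \<union> K) * c I"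
   "\<forall>y\<in>{c (I \<union> J), c (J \<union> K), c (I \<union> K)}. y * c I = c I * y" "\<forall>x\<in>{c (I \<union> J), c (J \<union> K), c (I \<union> K)}. x * c J = c J * x"
   "\<forall>y\<in>{c (I \<union> J), c (J \<union> K), c (I \<union> K)}. y * c K = c K * y" "\<forall>y\<in>{c (I \<union> J), c (J \<union> K), c (I \<union> K)}. y * c (I \<union> J \<union> K) = c (I \<union> J \<union> K) * y"
proof -
  have N: "I \<subseteq> {1..<N}" "J \<subseteq> {1..<N}" "K \<subseteq> {1..<N}"
    using assms(4-) by (simp_all add: subset_ivl[OF assms(1)] subset_ivl[OF assms(2)] subset_ivl[OF assms(3)])
  then have F: "I \<union> J \<union> K \<subseteq> {1..<N}" by blast
  have n: "commutes X Y \<and> commutes Y X" if "X \<subseteq> Y" "Y \<subseteq> {1..<N}" for X Y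
    using nested_commutes[OF that] commutes_sym by blast
  have IJ: "commutes (I \<union> J) K" "commutes J K" "commutes I (J \<union> K)" "commutes I J" "commutes I K"
    using commutes_apart(1)[of "I \<union> J" 1 u K u N] commutes_apart(1)[of I 1 l "J \<union> K" l N] commutes_apart(1)[of J 1 u K u N]
      commutes_apart(1)[of I 1 l J l N] commutes_apart(1)[of I 1 l K l N] assms
    by (simp_all add: subset_ivl[OF assms(1)] subset_ivl[OF assms(2)] subset_ivl[OF assms(3)])
  have Jb: "commutes J (I \<union> K)"
  proof (rule separated_commutes(1)[OF assms(2) refl])
    have "x < l" if "x \<in> I" for x using subsetD[OF assms(1) that] by simp
    moreover have "u \<le> x" if "x \<in> K" for x using subsetD[OF assms(3) that] by simp
    ultimately show "{l..<u} \<inter> (I \<union> K) = {}" by fastforce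
  qed (use N assms(4-) in auto)
  have nn: "commutes X Y" if "X \<subseteq> Y \<or> Y \<subseteq> X" "X \<union> Y \<subseteq> I \<union> J \<union> K" for X Y
  proof -
    have "X \<subseteq> {1..<N}" "Y \<subseteq> {1..<N}" using that(2) F by blast+
    then show ?thesis using that(1) n by blast
  qed
  note all = IJ Jb IJ[THEN commutes_sym] Jb[THEN commutes_sym]
  have "commutes J I" "commutes K I" "commutes K J" "commutes K (I \<union> J \<union> K)" "commutes J (I \<union> J \<union> K)" "commutes I (I \<union> J \<union> K)"
    "commutes (I \<union> J) I" "commutes (J \<union> K) I" "commutes (I \<union> K) I" "commutes (I \<union> J) J" "commutes (J \<union> K) J" "commutes (I \<union> K) J"
    "commutes (I \<union> J) K" "commutes (J \<union> K) K" "commutes (I \<union> K) K"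
    "commutes (I \<union> J) (I \<union> J \<union> K)" "commutes (J \<union> K) (I \<union> J \<union> K)" "commutes (I \<union> K) (I \<union> J \<union> K)"
    by (rule all | (rule nn; blast))+
  note L = this[unfolded commutes_def]
  show "c J * c I = c I * c J" "c K * c I = c I * c K" "c K * c J = c J * c K" "c K * c (I \<union> J \<union> K) = c (I \<union> J \<union> K) * c K"
    "c J * c (I \<union> J \<union> K) = c (I \<union> J \<union> K) * c J" "c I * c (I \<union> J \<union> K) = c (I \<union> J \<union> K) * c I"
    by (rule L)+
  show "\<forall>y\<in>{c (I \<union> J), c (J \<union> K), c (I \<union> K)}. y * c I = c I * y" "\<forall>x\<in>{c (I \<union> J), c (J \<union> K), c (I \<union> K)}. x * c J = c J * x"
    "\<forall>y\<in>{c (I \<union> J), c (J \<union> K), c (I \<union> K)}. y * c K = c K * y" "\<forall>y\<in>{c (I \<union> J), c (J \<union> K), c (I \<union> K)}. y * c (I \<union> J \<union> K) = c (I \<union> J \<union> K) * y"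
    unfolding ball_simps by (intro conjI TrueI; rule L)+
qed

lemma cas_rotate:
  assumes "I \<subseteq> {1..<l}" "J \<subseteq> {l..<u}" "K \<subseteq> {u..<N}" "1 \<le> l" "l \<le> u" "u \<le> N"
  shows "cas I J K = casimir (c (I \<union> K)) (c (I \<union> J)) (c (J \<union> K)) (c K) (c I) (c J) (c (I \<union> J \<union> K))"
proof -
  note C = triple_commutes[OF assms]
  have "c (I \<union> J) = - qcomm (c (J \<union> K)) (c (I \<union> K)) + c I * c J + c K * c (I \<union> J \<union> K)"
    using exch_cyclic_left[OF assms] C(1) unfolding exch_def by (simp only: Un_ac)
  moreover have "c (J \<union> K) = - qcomm (c (I \<union> K)) (c (I \<union> J)) + c J * c K + c I * c (I \<union> J \<union> K)"
    using exch_cyclic_right[OF assms] C(3) unfolding exch_def by (simp only: Un_ac)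
  ultimately show ?thesis unfolding cas_def using C by (rule casimir_rotate)
qed

lemma cas_exchange:
  assumes bl: "blocks A B D E"
    and T: "exch c A D E" "exch c B D A" "exch c B D (E \<union> A)" "exch c (A \<union> B) D E" "exch c B D E"
    "exch c A (B \<union> D) E" "exch c (B \<union> D) E A" "exch c E A (B \<union> D)" "exch c A B (D \<union> E)" "exch c B (D \<union> E) A"
    "exch c (D \<union> E) A B" "exch c A B D" "exch c D A B" "exch c D E A" "exch c E A D"
  shows "casimir (c (A \<union> E)) (c (A \<union> B \<union> D)) (c (B \<union> D \<union> E)) (c E) (c A) (c (B \<union> D)) (c (A \<union> B \<union> D \<union> E))
     + casimir (c (A \<union> B)) (c (B \<union> D)) (c (A \<union> D)) (c A) (c B) (c D) (c (A \<union> B \<union> D))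
     = casimir (c (A \<union> B)) (c (B \<union> D \<union> E)) (c (A \<union> D \<union> E)) (c A) (c B) (c (D \<union> E)) (c (A \<union> B \<union> D \<union> E))
     + casimir (c (A \<union> E)) (c (A \<union> D)) (c (D \<union> E)) (c E) (c A) (c D) (c (A \<union> D \<union> E))"
proof -
  note C = blocks_central[OF bl]
  have U: "A \<union> B \<union> D \<union> E \<subseteq> {1..<N}" using bl by (simp add: blocks_def)
  have d: "commutes (A \<union> E) (B \<union> D)" "commutes (D \<union> E) (A \<union> B)" using bl by (simp_all add: blocks_def commutes_sym)
  have n1: "commutes (A \<union> D) (A \<union> B \<union> D)" "commutes (A \<union> B) (A \<union> B \<union> D)" by (rule nested_commutes; use U in blast)+
  have n2: "commutes (A \<union> D \<union> E) (A \<union> D)" "commutes (B \<union> D \<union> E) (B \<union> D)" "commutes (B \<union> D \<union> E) (D \<union> E)"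
     "commutes (A \<union> D \<union> E) (A \<union> E)"
    by (rule commutes_sym, rule nested_commutes; use U in blast)+
  have C1: "y * z = z * y" if "z \<in> {c A, c B, c D, c E, c (A \<union> B \<union> D \<union> E)}"
     "y \<in> {c (A \<union> B), c (B \<union> D), c (D \<union> E)}" for y z
    using bspec[OF bspec[OF C(1) that(1)], of y] that(2) by blast
  have "c B * c A = c A * c B" "c E * c (A \<union> B) = c (A \<union> B) * c E"
    "c (B \<union> D) * c (A \<union> B \<union> D \<union> E) = c (A \<union> B \<union> D \<union> E) * c (B \<union> D)" "c (B \<union> D) * c A = c A * c (B \<union> D)"
    "c (D \<union> E) * c (A \<union> B \<union> D \<union> E) = c (A \<union> B \<union> D \<union> E) * c (D \<union> E)" "c (D \<union> E) * c B = c B * c (D \<union> E)"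
    "c D * c B = c B * c D" "c D * c A = c A * c D" "c E * c D = c D * c E"
    by (rule bspec[OF C(2)] bspec[OF C(3)] bspec[OF C(4)] C1 C1[symmetric]; simp)+
  note sw = this[unfolded Un_assoc]
  show ?thesis
    apply (rule casimir_exchange_ring[where ?x1.0 = "c A" and ?x2.0 = "c B" and ?x3.0 = "c D" and ?x4.0 = "c E"
        and F = "c (A \<union> B \<union> D \<union> E)"
        and e = "c (A \<union> B)" and u = "c (B \<union> D)" and v = "c (D \<union> E)" and a = "c (A \<union> B \<union> D)"
        and b = "c (B \<union> D \<union> E)" and d = "c (A \<union> D)" and c = "c (A \<union> E)" and f = "c (B \<union> E)"
        and h = "c (A \<union> B \<union> E)" and g = "c (A \<union> D \<union> E)", OF _ _ _ _ _ _ _ _ _ _ _ _ _ _ _ C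
          n1(1)[unfolded commutes_def] n2(1)[unfolded commutes_def] n2(2)[unfolded commutes_def] n2(3)[unfolded commutes_def]
          d(1)[unfolded commutes_def] d(2)[unfolded commutes_def] n1(2)[unfolded commutes_def] n2(4)[unfolded commutes_def]])
                  apply (insert T(1), unfold exch_def, simp (no_asm_use) only: Un_ac sw)[1]
                  apply (insert T(2), unfold exch_def, simp (no_asm_use) only: Un_ac sw)[1]
                  apply (insert T(3), unfold exch_def, simp (no_asm_use) only: Un_ac sw)[1]
                  apply (insert T(4), unfold exch_def, simp (no_asm_use) only: Un_ac sw)[1]
                  apply (insert T(5), unfold exch_def, simp (no_asm_use) only: Un_ac sw)[1]
                  apply (insert T(6), unfold exch_def, simp (no_asm_use) only: Un_ac sw)[1]
                  apply (insert T(7), unfold exch_def, simp (no_asm_use) only: Un_ac sw)[1]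
                  apply (insert T(8), unfold exch_def, simp (no_asm_use) only: Un_ac sw)[1]
                  apply (insert T(9), unfold exch_def, simp (no_asm_use) only: Un_ac sw)[1]
                  apply (insert T(10), unfold exch_def, simp (no_asm_use) only: Un_ac sw)[1]
                  apply (insert T(11), unfold exch_def, simp (no_asm_use) only: Un_ac sw)[1]
                  apply (insert T(12), unfold exch_def, simp (no_asm_use) only: Un_ac sw)[1]
                  apply (insert T(13), unfold exch_def, simp (no_asm_use) only: Un_ac sw)[1]
                  apply (insert T(14), unfold exch_def, simp (no_asm_use) only: Un_ac sw)[1]
                  apply (insert T(15), unfold exch_def, simp (no_asm_use) only: Un_ac sw)[1]
    done
qed

lemma cas_move_right:
  assumes A: "A \<subseteq> {1..<l}" and B: "B \<subseteq> {l..<d}" and E: "E \<subseteq> {Suc d..<N}" and le: "1 \<le> l" "l \<le> d" "d < N"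
  shows "cas A (B \<union> {d}) E + cas A B {d} = cas A B ({d} \<union> E) + cas A {d} E"
proof -
  let ?D = "{d}"
  note S = subset_ivl[OF A] subset_ivl[OF B] subset_ivl[OF E]
  have ivl: "{d..<Suc d} = {d}" by auto
  have bl: "blocks A B ?D E"
  proof (rule blocksI[OF A B _ E])
    show "{d} \<subseteq> {d..<Suc d}" by simp
    have "x < l" if "x \<in> A" for x using subsetD[OF A that] by simp
    moreover have "Suc d \<le> x" if "x \<in> E" for x using subsetD[OF E that] by simp
    ultimately have dj: "{l..<Suc d} \<inter> (A \<union> E) = {}" by fastforce
    have sb: "B \<union> ?D \<subseteq> {l..<Suc d}" "{l..<Suc d} \<subseteq> {1..<N}" "A \<union> E \<subseteq> {1..<N}"
      using le by (simp_all add: S)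
    show "commutes (B \<union> ?D) (A \<union> E)" by (rule separated_commutes(1)[OF sb(1) refl dj sb(2,3)])
    show "commutes (?D \<union> E) (A \<union> B)" using le by (intro commutes_apart(2)[of _ 1 d _ d N]) (simp_all add: S)
  qed (use le in auto)
  have T: "exch c A ?D E" "exch c B ?D A" "exch c B ?D (E \<union> A)" "exch c (A \<union> B) ?D E" "exch c B ?D E"
    "exch c A (B \<union> ?D) E" "exch c (B \<union> ?D) E A" "exch c E A (B \<union> ?D)" "exch c A B (?D \<union> E)" "exch c B (?D \<union> E) A"
    "exch c (?D \<union> E) A B" "exch c A B ?D" "exch c ?D A B" "exch c ?D E A" "exch c E A ?D"
    subgoal using le by (intro exch_line[of _ d _ "Suc d"]) (simp_all add: S)
    subgoal using le by (intro exch_cyclic_left[of _ l _ d]) (simp_all add: S)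
    subgoal using le exch_wrap[OF A B E] by (simp add: ivl)
    subgoal using le by (intro exch_line[of _ d _ "Suc d"]) (simp_all add: S)
    subgoal using le by (intro exch_line[of _ d _ "Suc d"]) (simp_all add: S)
    subgoal using le by (intro exch_line[of _ l _ "Suc d"]) (simp_all add: S)
    subgoal using le by (intro exch_cyclic_left[of _ l _ "Suc d"]) (simp_all add: S)
    subgoal using le by (intro exch_cyclic_right[of _ l _ "Suc d"]) (simp_all add: S)
    subgoal using le by (intro exch_line[of _ l _ d]) (simp_all add: S)
    subgoal using le by (intro exch_cyclic_left[of _ l _ d]) (simp_all add: S)
    subgoal using le by (intro exch_cyclic_right[of _ l _ d]) (simp_all add: S)
    subgoal using le by (intro exch_line[of _ l _ d]) (simp_all add: S)
    subgoal using le by (intro exch_cyclic_right[of _ l _ d]) (simp_all add: S)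
    subgoal using le by (intro exch_cyclic_left[of _ d _ "Suc d"]) (simp_all add: S)
    subgoal using le by (intro exch_cyclic_right[of _ d _ "Suc d"]) (simp_all add: S)
    done
  \<comment> \<open>\<open>cas_exchange\<close> contains two of the four terms in rotated
    form.\<close>
  have r1: "cas A (B \<union> ?D) E = casimir (c (A \<union> E)) (c (A \<union> (B \<union> ?D))) (c (B \<union> ?D \<union> E)) (c E) (c A) (c (B \<union> ?D)) (c (A \<union> (B \<union> ?D) \<union> E))"
    by (rule cas_rotate[of _ l _ "Suc d"]) (use le in \<open>simp_all add: S\<close>)
  have r2: "cas A ?D E = casimir (c (A \<union> E)) (c (A \<union> ?D)) (c (?D \<union> E)) (c E) (c A) (c ?D) (c (A \<union> ?D \<union> E))"
    by (rule cas_rotate[of _ d _ "Suc d"]) (use le in \<open>simp_all add: S\<close>)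
  show ?thesis
    unfolding r1 r2 unfolding cas_def using cas_exchange[OF bl T] by (simp only: Un_assoc)
qed

text \<open>By \<open>Op_casimir\<close> the reversed expression is a cyclic rotation of the
  original one, and \<open>cas_rotate\<close> undoes the rotation.\<close>

lemma cas_mirror:
  assumes "I \<subseteq> {1..<l}" "J \<subseteq> {l..<u}" "K \<subseteq> {u..<N}" "1 \<le> l" "l \<le> u" "u \<le> N"
  shows "aw_family.cas c' (mirror N K) (mirror N J) (mirror N I) = Op (cas I J K)"
proof -
  interpret m: aw_family c' N by (rule mirror_family)
  have N: "I \<subseteq> {1..<N}" "J \<subseteq> {1..<N}" "K \<subseteq> {1..<N}"
    using assms(4-) by (simp_all add: subset_ivl[OF assms(1)] subset_ivl[OF assms(2)] subset_ivl[OF assms(3)])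
  then have mm: "mirror N (mirror N X) = X" if "X \<subseteq> I \<union> J \<union> K" for X using that by (intro mirror_mirror) auto
  note C = triple_commutes[OF assms]
  have "m.cas (mirror N K) (mirror N J) (mirror N I) =
    casimir (Op (c (K \<union> J))) (Op (c (J \<union> I))) (Op (c (K \<union> I))) (Op (c K)) (Op (c J)) (Op (c I)) (Op (c (K \<union> J \<union> I)))"
    unfolding m.cas_def mirror_Un[symmetric] by (subst mm, blast)+ (rule refl)
  also have "\<dots> = Op (casimir (c (I \<union> K)) (c (I \<union> J)) (c (J \<union> K)) (c K) (c I) (c J) (c (I \<union> J \<union> K)))"
  proof -
    have e: "K \<union> J = J \<union> K" "J \<union> I = I \<union> J" "K \<union> I = I \<union> K" "J \<union> K \<union> I = I \<union> J \<union> K" by auto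
    show ?thesis unfolding e by (rule Op_casimir) (use C in \<open>simp_all only: ball_simps simp_thms\<close>)
  qed
  finally show ?thesis unfolding cas_rotate[OF assms] .
qed

lemma cas_move_left:
  assumes A: "A \<subseteq> {1..<d}" and B: "B \<subseteq> {Suc d..<u}" and E: "E \<subseteq> {u..<N}" and le: "1 \<le> d" "Suc d \<le> u" "u \<le> N"
  shows "cas A (B \<union> {d}) E + cas {d} B E = cas (A \<union> {d}) B E + cas A {d} E"
proof -
  interpret m: aw_family c' N by (rule mirror_family)
  note S = subset_ivl[OF A] subset_ivl[OF B] subset_ivl[OF E]
  have dm: "{N - d} = mirror N {d}" by (simp add: mirror_def)
  have "m.cas (mirror N E) (mirror N B \<union> {N - d}) (mirror N A) + m.cas (mirror N E) (mirror N B) {N - d}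
    = m.cas (mirror N E) (mirror N B) ({N - d} \<union> mirror N A) + m.cas (mirror N E) {N - d} (mirror N A)"
  proof (rule m.cas_move_right)
    show "mirror N E \<subseteq> {1..<N + 1 - u}" using mirror_subset[OF E order_refl] by simp
    show "mirror N B \<subseteq> {N + 1 - u..<N - d}" using mirror_subset[OF B le(3)] by simp
    show "mirror N A \<subseteq> {Suc (N - d)..<N}" using mirror_subset[OF A, of N] le by (simp add: Suc_diff_le)
  qed (use le in auto)
  then have "Op (cas A (B \<union> {d}) E) + Op (cas {d} B E) = Op (cas (A \<union> {d}) B E) + Op (cas A {d} E)"
    unfolding dm mirror_Un[symmetric] using le
    by (simp add: cas_mirror[of _ d _ u] cas_mirror[of _ "Suc d" _ u] S Un_commute)
  then show ?thesis by (simp only: Op_eq_iff flip: Op_add)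
qed

end

section \<open>The family in $\mathfrak{aw}(n)$\<close>

text \<open>The least elements of the entries form a strictly increasing list, which is determined
  by its set, and they identify the entries.\<close>

lemma sorted_set_less_unique:
  assumes "sorted_wrt (\<prec>) us" "sorted_wrt (\<prec>) vs" "set us = set vs" "{} \<notin> set us"
  shows "us = vs"
proof -
  let ?m = "\<lambda>X. LEAST x. x \<in> X"
  have m: "?m X \<in> X" if "X \<noteq> {}" for X :: "nat set" using that by (metis LeastI ex_in_conv)
  have s: "sorted_wrt (<) (map ?m ws)" if "sorted_wrt (\<prec>) ws" "{} \<notin> set ws" for ws
    using that
  proof (induction ws)
    case (Cons w ws)
    have "?m w < ?m X" if "X \<in> set ws" for X
    proof -
      have "w \<prec> X" "w \<noteq> {}" "X \<noteq> {}" using Cons.prems that by auto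
      then show ?thesis using m unfolding set_less_def by blast
    qed
    then show ?case using Cons by simp
  qed simp
  have su: "sorted_wrt (<) (map ?m us)" "sorted_wrt (<) (map ?m vs)" using s assms by auto
  then have "map ?m us = map ?m vs" using assms(3) by (intro strict_sorted_equal) auto
  moreover have "inj_on ?m (set us)" using su(1) by (metis distinct_map strict_sorted_iff)
  ultimately show ?thesis using assms(3) by (intro map_inj_on[of ?m us vs]) simp_all
qed

section \<open>Maximal connected components\<close>

lemma conn_ivl: "a < b \<Longrightarrow> conn {a..<b}"
  unfolding conn_def by (intro exI[of _ a] exI[of _ "b - 1"]) auto

lemma connD: "conn I \<Longrightarrow> x \<in> I \<Longrightarrow> y \<in> I \<Longrightarrow> x \<le> z \<Longrightarrow> z \<le> y \<Longrightarrow> z \<in> I"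
  by (auto simp: conn_def)

lemma conn_nonempty: "conn I \<Longrightarrow> \<exists>x. x \<in> I"
  by (auto simp: conn_def)

text \<open>The point \<open>b\<close> is in neither part, so no connected subset meets
  both.\<close>

lemma components_gap:
  assumes ab: "a < b" and K: "K \<subseteq> {Suc b..}"
  shows "components ({a..<b} \<union> K) = insert {a..<b} (components K)"
proof -
  let ?S = "{a..<b} \<union> K"
  have side: "J \<subseteq> {a..<b} \<or> J \<subseteq> K" if J: "conn J" "J \<subseteq> ?S" for J
  proof (rule ccontr)
    assume "\<not> ?thesis"
    then obtain x y where "x \<in> J" "x \<in> {a..<b}" "y \<in> J" "y \<in> K" using J(2) by blast
    then have "b \<in> J" using connD[OF J(1), of x y b] K by auto
    then have "b \<in> {a..<b} \<union> K" using J(2) by blast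
    then show False using subsetD[OF K, of b] by simp
  qed
  have cI: "conn {a..<b}" using ab by (rule conn_ivl)
  have dis: "{a..<b} \<inter> K = {}" using K by auto
  show ?thesis
  proof (intro equalityI subsetI)
    fix J assume J: "J \<in> components ?S"
    then have "conn J" "J \<subseteq> ?S" and mx: "\<And>J'. conn J' \<Longrightarrow> J \<subseteq> J' \<Longrightarrow> J' \<subseteq> ?S \<Longrightarrow> J' = J"
      unfolding components_def by blast+
    from side[OF this(1,2)] show "J \<in> insert {a..<b} (components K)"
    proof
      assume "J \<subseteq> {a..<b}"
      then show ?thesis using mx[OF cI] by blast
    next
      assume "J \<subseteq> K"
      then show ?thesis using mx \<open>conn J\<close> unfolding components_def by blast
    qed
  next
    fix J assume "J \<in> insert {a..<b} (components K)"
    then consider "J = {a..<b}" | "J \<in> components K" by blast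
    then show "J \<in> components ?S"
    proof cases
      case 1
      have "J' = {a..<b}" if "conn J'" "{a..<b} \<subseteq> J'" "J' \<subseteq> ?S" for J'
      proof -
        have "a \<in> J'" "a \<notin> K" using that(2) ab dis by auto
        then show ?thesis using side[OF that(1,3)] that(2) by blast
      qed
      then show ?thesis unfolding components_def using 1 cI by blast
    next
      case 2
      then have J: "conn J" "J \<subseteq> K" and mx: "\<And>J'. conn J' \<Longrightarrow> J \<subseteq> J' \<Longrightarrow> J' \<subseteq> K \<Longrightarrow> J' = J"
        unfolding components_def by blast+
      have "J' = J" if "conn J'" "J \<subseteq> J'" "J' \<subseteq> ?S" for J'
      proof -
        obtain x where "x \<in> J" using conn_nonempty[OF J(1)] by blast
        then have "x \<in> J'" "x \<notin> {a..<b}" using that(2) J(2) dis by blast+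
        then have "J' \<subseteq> K" using side[OF that(1,3)] by blast
        then show ?thesis by (rule mx[OF that(1,2)])
      qed
      then show ?thesis unfolding components_def using J by blast
    qed
  qed
qed

lemma component_list_empty: "component_list {} = []"
proof -
  have "components {} = {}" by (auto simp: components_def conn_def)
  then show ?thesis using component_list[of "{}"] by simp
qed

lemma component_list_gap:
  assumes ab: "a < b" and K: "K \<subseteq> {Suc b..}" "finite K"
  shows "component_list ({a..<b} \<union> K) = {a..<b} # component_list K"
proof (rule sorted_set_less_unique)
  note L = component_list[OF K(2)] component_list[of "{a..<b} \<union> K"]
  show "sorted_wrt (\<prec>) (component_list ({a..<b} \<union> K))" using L K by simp
  show "set (component_list ({a..<b} \<union> K)) = set ({a..<b} # component_list K)"
    using L K components_gap[OF ab K(1)] by simp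
  show "{} \<notin> set (component_list ({a..<b} \<union> K))" using L K by (auto simp: components_def conn_def)
  have "{a..<b} \<prec> J" if "J \<in> components K" for J
    using that K(1) unfolding components_def set_less_def by fastforce
  then show "sorted_wrt (\<prec>) ({a..<b} # component_list K)" using L by simp
qed

section \<open>The defining relations read in the quotient\<close>

lemma abs_aw_hom:
  shows "abs_aw (x + y) = abs_aw x + abs_aw y" "abs_aw (x - y) = abs_aw x - abs_aw y"
    "abs_aw (- x) = - abs_aw x" "abs_aw (x * y) = abs_aw x * abs_aw y" "abs_aw (a *\<^sub>Q x) = a *\<^sub>Q abs_aw x"
  by (simp_all add: plus_aw.abs_eq minus_aw.abs_eq uminus_aw.abs_eq times_aw.abs_eq scaleQ_aw.abs_eq)

lemma abs_aw_one: "abs_aw 1 = 1"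
  by (simp add: one_aw_def)

lemma abs_aw_qcomm: "abs_aw (qcomm x y) = qcomm (abs_aw x) (abs_aw y)"
  by (simp add: qcomm_def abs_aw_hom)

lemma abs_aw_gen: "abs_aw (gen I) = aw_gen I"
  by (simp add: aw_gen.abs_eq)

lemma abs_aw_Cseq: "abs_aw (Cseq gen Is) = Cseq aw_gen Is"
proof (induction "gen :: nat set \<Rightarrow> 'a::finite conn_subset free_algebra" Is rule: Cseq.induct)
  case (3 I J Is)
  then show ?case
    by (cases "hole I J = {}") (simp_all add: Let_def abs_aw_hom abs_aw_qcomm abs_aw_gen)
qed (simp_all add: abs_aw_one abs_aw_gen)

lemma relator_eq: "x - y \<in> aw_relators \<Longrightarrow> abs_aw x = abs_aw y"
  using aw_ideal.relator by (simp add: aw.abs_eq_iff)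

lemma aw_commuting:
  assumes "conn I" "I \<subseteq> {1..CARD('n::finite)}" "conn J" "J \<subseteq> {1..CARD('n)}" "I \<inter> J = {} \<or> I \<subseteq> J"
  shows "aw_gen I * aw_gen J = aw_gen J * (aw_gen I :: 'n aw)"
  using relator_eq[OF aw_relators.commuting[OF assms, unfolded comm_def]] by (simp add: abs_aw_hom abs_aw_gen)

lemma aw_triple:
  assumes "monotonic_adjacent CARD('n::finite) [I1, I2, I3]"
  shows "(aw_gen (I1 \<union> I2) :: 'n aw) = - qcomm (aw_gen (I2 \<union> I3)) (Cseq aw_gen [I1, I3])
            + aw_gen I1 * aw_gen I2 + aw_gen I3 * aw_gen (I1 \<union> I2 \<union> I3)"
  using relator_eq[OF aw_relators.triple[OF assms]]
  by (simp only: abs_aw_hom abs_aw_qcomm abs_aw_gen abs_aw_Cseq)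

lemma aw_quadruple:
  assumes "monotonic_adjacent CARD('n::finite) [I1, I2, I3, I4]"
  shows "(Cseq aw_gen [I1, I4] :: 'n aw) = - qcomm (Cseq aw_gen [I1, I3]) (aw_gen (I3 \<union> I4))
            + aw_gen I1 * aw_gen I4 + aw_gen I3 * Cseq aw_gen [I1, I3 \<union> I4]"
  using relator_eq[OF aw_relators.quadruple[OF assms]]
  by (simp only: abs_aw_hom abs_aw_qcomm abs_aw_gen abs_aw_Cseq)

lemma hole_ivl:
  assumes "a < b" "b \<le> d" "d < e"
  shows "hole {a..<b} {d..<e} = {b..<d}" "hole {d..<e} {a..<b} = {b..<d}"
proof -
  have "(\<forall>i\<in>{a..<b}. \<forall>j\<in>{d..<e}. i < x \<and> x < j) \<longleftrightarrow> x \<in> {b..<d}" for x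
  proof
    assume *: "\<forall>i\<in>{a..<b}. \<forall>j\<in>{d..<e}. i < x \<and> x < j"
    \<comment> \<open>The extreme points \<open>b - 1\<close> and \<open>d\<close> give the
      strongest of the conditions.\<close>
    have "b - 1 \<in> {a..<b}" "d \<in> {d..<e}" using assms by auto
    then have "b - 1 < x \<and> x < d" using * by blast
    then show "x \<in> {b..<d}" using assms by auto
  qed (use assms in auto)
  moreover have "\<not> (\<forall>i\<in>{a..<b}. \<forall>j\<in>{d..<e}. j < x \<and> x < i)" for x
    using assms by (auto intro!: bexI[of _ a] bexI[of _ d])
  ultimately show "hole {a..<b} {d..<e} = {b..<d}" "hole {d..<e} {a..<b} = {b..<d}"
    unfolding hole_def by blast+
qed

lemma adjacent_ivl:
  assumes "a < b" "b < d"
  shows "adjacent {a..<b} {b..<d}" "adjacent {b..<d} {a..<b}"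
proof -
  have "{a..<b} \<union> {b..<d} = {a..<d}" "{b..<d} \<union> {a..<b} = {a..<d}" using assms by auto
  then show "adjacent {a..<b} {b..<d}" "adjacent {b..<d} {a..<b}"
    unfolding adjacent_def using assms by (auto intro: conn_ivl)
qed

text \<open>Removes the element of a decreasing sequence from the decreasing triple relation: it
  occurs between two copies of \<open>x12\<close>, and rebracketing
  \<open>qcomm x12 (qcomm x23 x12)\<close> replaces it by the increasing one.\<close>

lemma adj_R_ring:
  fixes x1 :: "'a::ratfun_algebra"
  assumes "x13 = - qcomm x12 x23 + x1 * x3 + x2 * x123"
    and "x23 = - qcomm x12 (- qcomm x23 x12 + x3 * x1 + x2 * x123) + x3 * x2 + x1 * x123"
    and c: "x3 * x1 = x1 * x3" "x1 * x12 = x12 * x1" "x2 * x12 = x12 * x2" "x3 * x12 = x12 * x3" "x123 * x12 = x12 * x123"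
  shows "x23 = - qcomm x13 x12 + x3 * x2 + x1 * x123"
proof -
  have "qcomm (x1 * x3 + x2 * x123) x12 = qcomm x12 (x3 * x1 + x2 * x123)"
    using c c[THEN commute_left] by (simp add: qcomm_commuting algebra_simps)
  moreover have "qcomm (qcomm x12 x23) x12 = qcomm x12 (qcomm x23 x12)" by (rule qcomm_assoc) simp
  ultimately show ?thesis
    by (subst assms(2)) (simp add: assms(1) qcomm_linear algebra_simps)
qed

text \<open>Brings the decreasing quadruple relation, with its inner sequences unfolded, into the
  form of the axiom \<open>upper\<close>; the terms with \<open>x4\<close> cancel.\<close>

lemma upper_ring:
  fixes x1 :: "'a::ratfun_algebra"
  assumes "- qcomm x234 x123 + x4 * x1 + x23 * F = - qcomm (- qcomm x34 x23 + x4 * x2 + x3 * x234) x12 + x4 * x1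
      + x2 * (- qcomm x34 x123 + x4 * x12 + x3 * F)"
    and c: "x12 * x3 = x3 * x12" "x12 * x4 = x4 * x12" "x12 * x2 = x2 * x12" "x4 * x2 = x2 * x4" "x2 * x3 = x3 * x2"
  shows "- qcomm x234 x123 + x23 * F = qcomm (qcomm x34 x23) x12 - x3 * qcomm x234 x12 - x2 * qcomm x34 x123 + x2 * x3 * F"
proof -
  have "qcomm (x4 * x2) x12 = x2 * (x4 * x12)" "qcomm (x3 * x234) x12 = x3 * qcomm x234 x12"
    using c c[THEN commute_left] by (simp_all add: qcomm_commuting qcomm_mult_left qcomm_mult_right algebra_simps)
  then show ?thesis using assms(1) by (simp add: qcomm_linear algebra_simps)
qed

lemma C_ivl: "a < b \<Longrightarrow> C {a..<b} = aw_gen {a..<b}"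
  using component_list_gap[of a b "{}"] by (simp add: C_def component_list_empty)

lemma C_two: "a < b \<Longrightarrow> b < d \<Longrightarrow> d < e \<Longrightarrow> C ({a..<b} \<union> {d..<e}) = Cseq aw_gen [{a..<b}, {d..<e}]"
proof -
  assume A: "a < b" "b < d" "d < e"
  have "component_list ({a..<b} \<union> {d..<e}) = {a..<b} # component_list {d..<e}"
    using A by (intro component_list_gap) auto
  moreover have "component_list {d..<e} = [{d..<e}]"
    using component_list_gap[of d e "{}"] A by (simp add: component_list_empty)
  ultimately show ?thesis by (simp only: C_def)
qed

lemma C_empty: "C {} = 1"
  by (simp add: C_def component_list_empty)

lemma C_exch_first:
  assumes K: "1 \<le> a" "a < b" "b < d" "d \<in> K" "K \<subseteq> {d..<Suc CARD('n::finite)}"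
  shows "exch (C :: nat set \<Rightarrow> 'n::finite aw) {a..<b} {b..<d} K"
proof -
  \<comment> \<open>The end of the first component of \<open>K\<close>. The recursion of
    \<open>Cseq\<close> sees only this component, while the remaining ones pass through all terms
    unchanged.\<close>
  define e where "e = (LEAST x. d \<le> x \<and> x \<notin> K)"
  have "Suc CARD('n) \<notin> K" "d \<le> Suc CARD('n)" using subsetD[OF K(5), of "Suc CARD('n)"] subsetD[OF K(5) K(4)] by auto
  then have de: "d \<le> e" "e \<notin> K" unfolding e_def using LeastI[of "\<lambda>x. d \<le> x \<and> x \<notin> K" "Suc CARD('n)"] by simp_all
  have eK: "x \<in> K" if "d \<le> x" "x < e" for x using not_less_Least[of x] that unfolding e_def by blast
  have "d \<noteq> e" using de(2) K(4) by blast
  then have e: "d < e" "e \<notin> K" using de by simp_all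
  define K' where "K' = K \<inter> {Suc e..}"
  have K': "K' \<subseteq> {Suc e..}" "finite K'" using finite_subset[OF K(5)] by (simp_all add: K'_def)
  have KK: "K = {d..<e} \<union> K'"
  proof (intro equalityI subsetI)
    fix x assume "x \<in> K"
    then show "x \<in> {d..<e} \<union> K'" using e(2) subsetD[OF K(5), of x] by (cases x e rule: linorder_cases) (simp_all add: K'_def)
  next
    fix x assume "x \<in> {d..<e} \<union> K'"
    then show "x \<in> K" using eK[of x] by (auto simp: K'_def)
  qed
  let ?Is = "component_list K'"
  have l: "C ({x..<e} \<union> K') = (Cseq aw_gen ({x..<e} # ?Is) :: 'n aw)" if "x < e" for x
    using component_list_gap[OF that K'] by (simp only: C_def)
  have s: "{b..<d} \<union> K = {b..<e} \<union> K'" "{a..<d} \<union> K = {a..<e} \<union> K'" "{a..<b} \<union> {b..<d} = {a..<d}"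
    "{b..<d} \<union> {d..<e} = {b..<e}" "{a..<d} \<union> {d..<e} = {a..<e}"
    unfolding KK using K(2,3) e(1) by auto
  have "K \<subseteq> {Suc b..}" by (rule order_trans[OF K(5)]) (use K(3) in auto)
  moreover have "finite K" by (rule finite_subset[OF K(5)]) simp
  ultimately have "component_list ({a..<b} \<union> K) = {a..<b} # component_list K" by (rule component_list_gap[OF K(2)])
  moreover have "component_list K = {d..<e} # ?Is" unfolding KK by (rule component_list_gap[OF e(1) K'])
  ultimately have l': "C ({a..<b} \<union> K) = (Cseq aw_gen ({a..<b} # {d..<e} # ?Is) :: 'n aw)" "C K = (Cseq aw_gen ({d..<e} # ?Is) :: 'n aw)"
    by (simp_all only: C_def)
  have h: "hole {a..<b} {d..<e} = {b..<d}" "{b..<d} \<noteq> {}" using K(2,3) e(1) by (simp_all add: hole_ivl)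
  have g: "C {a..<d} = (aw_gen {a..<d} :: 'n aw)" "C {a..<b} = (aw_gen {a..<b} :: 'n aw)" "C {b..<d} = (aw_gen {b..<d} :: 'n aw)"
    using K(2,3) by (simp_all add: C_ivl)
  have lx: "C ({b..<e} \<union> K') = (Cseq aw_gen ({b..<e} # ?Is) :: 'n aw)" "C ({a..<e} \<union> K') = (Cseq aw_gen ({a..<e} # ?Is) :: 'n aw)"
    using K(2,3) e(1) by (auto intro!: l)
  show "exch (C :: nat set \<Rightarrow> 'n aw) {a..<b} {b..<d} K"
    unfolding exch_def l' s lx g by (simp only: Cseq.simps(3) Let_def h s if_False)
qed

text \<open>The increasing triple relation is the first claim up to commuting factors; the
  decreasing one gives the second through \<open>adj_R_ring\<close>.\<close>

lemma C_exch_adjacent: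
  assumes A: "1 \<le> a" "a < b" "b < d" "d < e" "e \<le> Suc CARD('n::finite)"
  shows "exch (C :: nat set \<Rightarrow> 'n::finite aw) {b..<d} {d..<e} {a..<b}"
    and "exch (C :: nat set \<Rightarrow> 'n aw) {d..<e} {a..<b} {b..<d}"
proof -
  let ?a = "{a..<b}" and ?b = "{b..<d}" and ?d = "{d..<e}"
  have m: "monotonic_adjacent CARD('n) [?a, ?b, ?d]" "monotonic_adjacent CARD('n) [?d, ?b, ?a]"
    unfolding monotonic_adjacent_def monotonic_def
    using A by (simp_all add: conn_ivl adjacent_ivl) (auto simp: set_less_def)
  have u: "?a \<union> ?b = {a..<d}" "?b \<union> ?d = {b..<e}" "?a \<union> ?b \<union> ?d = {a..<e}" "?d \<union> ?b = {b..<e}" "?b \<union> ?a = {a..<d}"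
    "?d \<union> ?b \<union> ?a = {a..<e}" "{b..<e} \<union> ?a = {a..<e}" "?a \<union> {b..<e} = {a..<e}" "?d \<union> ?a = ?a \<union> ?d" "?d \<union> (?a \<union> ?b) = {a..<e}" "?d \<union> {a..<d} = {a..<e}"
    "{b..<e} \<union> {a..<b} = {a..<e}" "?a \<union> ?d \<union> ?b = {a..<e}" "?a \<union> ?b \<union> ?d = {a..<e}" "{b..<d} \<union> {a..<b} = {a..<d}" "{a..<d} \<union> {d..<e} = {a..<e}"
    using A by auto
  have cm0: "aw_gen {x..<y} * aw_gen {x'..<y'} = aw_gen {x'..<y'} * (aw_gen {x..<y} :: 'n aw)"
    if "a \<le> x" "x < y" "y \<le> e" "a \<le> x'" "x' < y'" "y' \<le> e" "y \<le> x' \<or> y' \<le> x \<or> x' \<le> x \<and> y \<le> y'" for x y x' y'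
    using that A by (intro aw_commuting conn_ivl) auto
  then have cm: "aw_gen {x..<y} * aw_gen {x'..<y'} = aw_gen {x'..<y'} * (aw_gen {x..<y} :: 'n aw)"
    if "a \<le> x" "x < y" "y \<le> e" "a \<le> x'" "x' < y'" "y' \<le> e" "y \<le> x' \<or> y' \<le> x \<or> x' \<le> x \<and> y \<le> y' \<or> x \<le> x' \<and> y' \<le> y" for x y x' y'
    using that by metis
  have T1: "(aw_gen {a..<d} :: 'n aw) = - qcomm (aw_gen {b..<e}) (C (?a \<union> ?d)) + aw_gen ?a * aw_gen ?b + aw_gen ?d * aw_gen {a..<e}"
    using aw_triple[OF m(1)] A by (simp only: u C_two)
  have civ: "C {x..<y} = (aw_gen {x..<y} :: 'n aw)" if "x < y" for x y using that by (rule C_ivl)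
  have civs: "C ?a = (aw_gen ?a :: 'n aw)" "C ?b = (aw_gen ?b :: 'n aw)" "C ?d = (aw_gen ?d :: 'n aw)"
    "C {a..<d} = (aw_gen {a..<d} :: 'n aw)" "C {b..<e} = (aw_gen {b..<e} :: 'n aw)" "C {a..<e} = (aw_gen {a..<e} :: 'n aw)"
    using A by (auto intro!: C_ivl)
  have sw: "aw_gen ?b * aw_gen ?a = aw_gen ?a * (aw_gen ?b :: 'n aw)" using A by (intro cm) auto
  show "exch (C :: nat set \<Rightarrow> 'n aw) ?b ?d ?a"
    unfolding exch_def u civs sw by (rule T1)
  have "Cseq aw_gen [?d, ?a] = - qcomm (aw_gen {b..<e}) (aw_gen {a..<d}) + aw_gen ?d * aw_gen ?a + aw_gen ?b * (aw_gen {a..<e} :: 'n aw)"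
    using A by (simp add: hole_ivl u)
  then have T2: "(aw_gen {b..<e} :: 'n aw) = - qcomm (aw_gen {a..<d}) (- qcomm (aw_gen {b..<e}) (aw_gen {a..<d}) + aw_gen ?d * aw_gen ?a + aw_gen ?b * aw_gen {a..<e})
      + aw_gen ?d * aw_gen ?b + aw_gen ?a * aw_gen {a..<e}"
    using aw_triple[OF m(2)] by (simp only: u)
  have T3: "(C (?a \<union> ?d) :: 'n aw) = - qcomm (aw_gen {a..<d}) (aw_gen {b..<e}) + aw_gen ?a * aw_gen ?d + aw_gen ?b * aw_gen {a..<e}"
    using A by (simp add: C_two hole_ivl u)
  have "(aw_gen {b..<e} :: 'n aw) = - qcomm (C (?a \<union> ?d)) (aw_gen {a..<d}) + aw_gen ?d * aw_gen ?b + aw_gen ?a * aw_gen {a..<e}"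
    by (rule adj_R_ring[OF T3 T2]; rule cm; use A in auto)
  then show "exch (C :: nat set \<Rightarrow> 'n aw) ?d ?a ?b"
    unfolding exch_def u civs .
qed

lemma C_four_blocks:
  assumes A: "1 \<le> a" "a < b" "b < d" "d < e" "e < f" "f \<le> Suc CARD('n::finite)"
  shows "exch (C :: nat set \<Rightarrow> 'n::finite aw) {a..<b} {d..<e} {e..<f}"
    and "- qcomm (C {b..<f}) (C {a..<e}) + C {b..<e} * C {a..<f} =
      qcomm (qcomm (C {d..<f}) (C {b..<e})) (C {a..<d}) - C {d..<e} * qcomm (C {b..<f}) (C {a..<d})
      - C {b..<d} * qcomm (C {d..<f}) (C {a..<e}) + C {b..<d} * C {d..<e} * (C {a..<f} :: 'n aw)"
proof -
  let ?a = "{a..<b}" and ?b = "{b..<d}" and ?d = "{d..<e}" and ?e = "{e..<f}"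
  have m: "monotonic_adjacent CARD('n) [?a, ?b, ?d, ?e]" "monotonic_adjacent CARD('n) [?e, ?d, ?b, ?a]"
    unfolding monotonic_adjacent_def monotonic_def
    using A by (auto simp: conn_ivl adjacent_ivl set_less_def)
  have u: "?d \<union> ?e = {d..<f}" "?a \<union> ?d \<union> ?e = ?a \<union> {d..<f}" "?b \<union> ?a = {a..<d}"
    "?e \<union> {b..<e} = {b..<f}" "{b..<e} \<union> ?a = {a..<e}" "{b..<f} \<union> ?a = {a..<f}" "?e \<union> ?d = {d..<f}" "?d \<union> ?b = {b..<e}" "{d..<f} \<union> ?b = {b..<f}"
    "?d \<union> {a..<d} = {a..<e}" "{d..<f} \<union> {a..<d} = {a..<f}"
    using A by auto
  have cm0: "aw_gen {x..<y} * aw_gen {x'..<y'} = aw_gen {x'..<y'} * (aw_gen {x..<y} :: 'n aw)"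
    if "a \<le> x" "x < y" "y \<le> f" "a \<le> x'" "x' < y'" "y' \<le> f" "y \<le> x' \<or> y' \<le> x \<or> x' \<le> x \<and> y \<le> y'" for x y x' y'
    using that A by (intro aw_commuting conn_ivl) auto
  then have cm: "aw_gen {x..<y} * aw_gen {x'..<y'} = aw_gen {x'..<y'} * (aw_gen {x..<y} :: 'n aw)"
    if "a \<le> x" "x < y" "y \<le> f" "a \<le> x'" "x' < y'" "y' \<le> f" "y \<le> x' \<or> y' \<le> x \<or> x' \<le> x \<and> y \<le> y' \<or> x \<le> x' \<and> y' \<le> y" for x y x' y'
    using that by metis
  show "exch (C :: nat set \<Rightarrow> 'n aw) ?a ?d ?e"
    using aw_quadruple[OF m(1)] A unfolding exch_def by (simp add: u C_ivl C_two del: Cseq.simps)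
  have h: "hole ?e ?a = {b..<e}" "hole ?e ?b = {d..<e}" "hole ?e {a..<d} = {d..<e}" using A by (simp_all add: hole_ivl)
  have ne: "{b..<e} \<noteq> {}" "{d..<e} \<noteq> {}" using A by auto
  have U: "- qcomm (aw_gen {b..<f}) (aw_gen {a..<e}) + aw_gen ?e * aw_gen ?a + aw_gen {b..<e} * aw_gen {a..<f}
    = - qcomm (- qcomm (aw_gen {d..<f}) (aw_gen {b..<e}) + aw_gen ?e * aw_gen ?b + aw_gen ?d * aw_gen {b..<f}) (aw_gen {a..<d}) + aw_gen ?e * aw_gen ?a
      + aw_gen ?b * (- qcomm (aw_gen {d..<f}) (aw_gen {a..<e}) + aw_gen ?e * aw_gen {a..<d} + aw_gen ?d * (aw_gen {a..<f} :: 'n aw))"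
    using aw_quadruple[OF m(2)] by (simp only: u Cseq.simps Let_def h ne if_False)
  have "- qcomm (aw_gen {b..<f}) (aw_gen {a..<e}) + aw_gen {b..<e} * aw_gen {a..<f} =
      qcomm (qcomm (aw_gen {d..<f}) (aw_gen {b..<e})) (aw_gen {a..<d}) - aw_gen ?d * qcomm (aw_gen {b..<f}) (aw_gen {a..<d})
      - aw_gen ?b * qcomm (aw_gen {d..<f}) (aw_gen {a..<e}) + aw_gen ?b * aw_gen ?d * (aw_gen {a..<f} :: 'n aw)"
    by (rule upper_ring[OF U]; rule cm; use A in auto)
  then show "- qcomm (C {b..<f}) (C {a..<e}) + C {b..<e} * C {a..<f} =
      qcomm (qcomm (C {d..<f}) (C {b..<e})) (C {a..<d}) - C {d..<e} * qcomm (C {b..<f}) (C {a..<d})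
      - C {b..<d} * qcomm (C {d..<f}) (C {a..<e}) + C {b..<d} * C {d..<e} * (C {a..<f} :: 'n aw)"
    using A by (simp add: C_ivl)
qed

text \<open>The bound is \<open>Suc CARD('n)\<close> because the index sets of a family are
  half-open, \<open>{1..<N}\<close>.\<close>

lemma aw_family_C: "aw_family (C :: nat set \<Rightarrow> 'n::finite aw) (Suc CARD('n))"
proof
  show "(C {} :: 'n aw) = 1" by (simp add: C_def component_list_empty)
next
  fix a b a' b' assume ab: "{a..<b} \<subseteq> {1..<Suc CARD('n)}" "{a'..<b'} \<subseteq> {1..<Suc CARD('n)}" "{a..<b} \<inter> {a'..<b'} = {} \<or> {a..<b} \<subseteq> {a'..<b'}"
  then show "C {a..<b} * C {a'..<b'} = C {a'..<b'} * (C {a..<b} :: 'n aw)"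
  proof (cases "a < b \<and> a' < b'")
    case True
    then have "C {a..<b} = (aw_gen {a..<b} :: 'n aw)" "C {a'..<b'} = (aw_gen {a'..<b'} :: 'n aw)" by (simp_all add: C_ivl)
    moreover have "aw_gen {a..<b} * aw_gen {a'..<b'} = aw_gen {a'..<b'} * (aw_gen {a..<b} :: 'n aw)"
      using ab True by (intro aw_commuting conn_ivl) (simp_all only: atLeastLessThanSuc_atLeastAtMost)
    ultimately show ?thesis by simp
  qed (auto simp: C_empty)
qed (fact C_exch_first C_exch_adjacent C_four_blocks)+

section \<open>Alternating sums over subsets\<close>

definition altsum :: "nat set \<Rightarrow> (nat set \<Rightarrow> 'a::ring_1) \<Rightarrow> 'a"
  where "altsum X g = (\<Sum>I\<in>Pow X. (- 1) ^ card I * g I)"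

lemma altsum_insert:
  assumes "finite X" "d \<notin> X"
  shows "altsum (insert d X) g = altsum X (\<lambda>I. g I - g (insert d I))"
proof -
  have inj: "inj_on (insert d) (Pow X)" using assms(2) by (auto simp: inj_on_def)
  have "altsum (insert d X) g = (\<Sum>I\<in>Pow X. (- 1) ^ card I * g I) + (\<Sum>I\<in>insert d ` Pow X. (- 1) ^ card I * g I)"
    unfolding altsum_def Pow_insert using assms by (intro sum.union_disjoint) auto
  also have "(\<Sum>I\<in>insert d ` Pow X. (- 1) ^ card I * g I) = (\<Sum>I\<in>Pow X. - ((- 1) ^ card I * g (insert d I)))"
  proof (subst sum.reindex[OF inj], unfold o_def, rule sum.cong[OF refl])
    fix I assume "I \<in> Pow X"
    then have "finite I" "d \<notin> I" using assms finite_subset by auto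
    then show "(- 1) ^ card (insert d I) * g (insert d I) = - ((- 1) ^ card I * g (insert d I))" by simp
  qed
  finally show ?thesis
    by (simp add: altsum_def right_diff_distrib sum_subtractf sum_negf)
qed

text \<open>Makes every term vanish that is independent of the subset of some non-empty
  block.\<close>

lemma altsum_const: "finite X \<Longrightarrow> X \<noteq> {} \<Longrightarrow> altsum X (\<lambda>_. w) = 0"
proof -
  assume X: "finite X" "X \<noteq> {}"
  then obtain e where "e \<in> X" by blast
  then have "altsum X (\<lambda>_. w) = altsum (insert e (X - {e})) (\<lambda>_. w)" by (simp add: insert_absorb)
  also have "\<dots> = 0" using X by (subst altsum_insert) (simp_all add: altsum_def)
  finally show ?thesis .
qed

lemma altsum_zero: "altsum X (\<lambda>_. 0) = 0"
  by (simp add: altsum_def)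

lemma altsum_add: "altsum X (\<lambda>I. g I + h I) = altsum X g + altsum X h"
  and altsum_diff: "altsum X (\<lambda>I. g I - h I) = altsum X g - altsum X h"
  by (simp_all add: altsum_def distrib_left right_diff_distrib sum.distrib sum_subtractf)

lemma altsum_cong: "(\<And>I. I \<subseteq> X \<Longrightarrow> g I = h I) \<Longrightarrow> altsum X g = altsum X h"
  unfolding altsum_def by (rule sum.cong) auto

lemma omega_altsum:
  assumes S: "finite S" "I1 \<union> I2 \<union> I3 = S" "I1 \<inter> I2 = {}" "(I1 \<union> I2) \<inter> I3 = {}"
  shows "(omega S I1 I2 I3 :: 'n::finite aw) = (- 1) ^ card S * altsum I1 (\<lambda>I. altsum I2 (\<lambda>J. altsum I3 (\<lambda>K. Omega I J K)))"
proof -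
  have f: "finite I1" "finite I2" "finite I3" using S(1,2) by auto
  have n: "card S = card I1 + card I2 + card I3"
    using card_Un_disjoint[of "I1 \<union> I2" I3] card_Un_disjoint[of I1 I2] f S by auto
  have sign: "(- 1) ^ (card S - card I - card J - card K) = ((- 1) ^ card S * ((- 1) ^ card I * ((- 1) ^ card J * (- 1) ^ card K)) :: 'n aw)"
    if "I \<in> Pow I1" "J \<in> Pow I2" "K \<in> Pow I3" for I J K
  proof -
    have "card I \<le> card I1" "card J \<le> card I2" "card K \<le> card I3" using that f by (auto intro: card_mono)
    \<comment> \<open>The natural subtraction in the exponent is therefore not truncated, and its
      parity is that of the sum.\<close>
    then have "card I + card J + card K \<le> card S" using n by simp
    then have "even (card S - (card I + card J + card K)) \<longleftrightarrow> even (card S + (card I + card J + card K))" by simp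
    then have "(- 1) ^ (card S - (card I + card J + card K)) = ((- 1) ^ (card S + (card I + card J + card K)) :: 'n aw)"
      by (simp only: minus_one_power_iff)
    then show ?thesis by (simp only: diff_diff_left add.assoc power_add)
  qed
  show ?thesis
    unfolding omega_def altsum_def sum_distrib_left
    by (intro sum.cong refl) (simp only: sign mult.assoc)
qed

lemma Omega_cas: "Omega I J K = aw_family.cas (C :: nat set \<Rightarrow> 'n::finite aw) I J K"
  unfolding aw_family.cas_def[OF aw_family_C] casimir_def Omega_def by (rule refl)

text \<open>By \<open>altsum_insert\<close> only the terms in which \<open>d\<close> is present have
  to be compared. They differ by \<open>Omega I {d} K\<close>, constant in \<open>J\<close>, and
  \<open>Omega I J {d}\<close>, constant in \<open>K\<close>; both sum to zero since
  \<open>B\<close> and \<open>E\<close> are non-empty.\<close>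

lemma altsum_move_right:
  fixes A :: "nat set"
  assumes A: "A \<subseteq> {1..<l}" and B: "B \<subseteq> {l..<d}" and E: "E \<subseteq> {Suc d..<Suc CARD('n::finite)}" and le: "1 \<le> l" "l \<le> d" "d < Suc CARD('n)"
    and ne: "B \<noteq> {}" "E \<noteq> {}"
  shows "altsum A (\<lambda>I. altsum (insert d B) (\<lambda>J. altsum E (\<lambda>K. Omega I J K :: 'n aw)))
    = altsum A (\<lambda>I. altsum B (\<lambda>J. altsum (insert d E) (\<lambda>K. Omega I J K)))"
proof -
  interpret aw_family "C :: nat set \<Rightarrow> 'n aw" "Suc CARD('n)" by (rule aw_family_C)
  have f: "finite B" "finite E" "d \<notin> B" "d \<notin> E" using finite_subset[OF B] finite_subset[OF E] B E by auto
  have D: "Omega I (insert d J) K = Omega I J (insert d K) + (Omega I {d} K - (Omega I J {d} :: 'n aw))" if "I \<subseteq> A" "J \<subseteq> B" "K \<subseteq> E" for I J K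
    using cas_move_right[OF order_trans[OF that(1) A] order_trans[OF that(2) B] order_trans[OF that(3) E] le]
    by (simp add: Omega_cas algebra_simps)
  have "altsum B (\<lambda>J. altsum E (\<lambda>K. Omega I (insert d J) K)) = altsum B (\<lambda>J. altsum E (\<lambda>K. Omega I J (insert d K) :: 'n aw))" if I: "I \<subseteq> A" for I
  proof -
    have "altsum B (\<lambda>J. altsum E (\<lambda>K. Omega I (insert d J) K))
      = altsum B (\<lambda>J. altsum E (\<lambda>K. Omega I J (insert d K) + (Omega I {d} K - (Omega I J {d} :: 'n aw))))"
      by (intro altsum_cong D I)
    then show ?thesis
      by (simp only: altsum_add altsum_diff altsum_const f ne not_False_eq_True diff_0_right add_0_right)
  qed
  then show ?thesis
    by (intro altsum_cong) (simp only: altsum_insert f not_False_eq_True altsum_diff)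
qed

text \<open>Here the differences are \<open>Omega {d} J K\<close>, constant in \<open>I\<close>, and
  \<open>Omega I {d} K\<close>, constant in \<open>J\<close>.\<close>

lemma altsum_move_left:
  fixes A :: "nat set"
  assumes A: "A \<subseteq> {1..<d}" and B: "B \<subseteq> {Suc d..<u}" and E: "E \<subseteq> {u..<Suc CARD('n::finite)}" and le: "1 \<le> d" "Suc d \<le> u" "u \<le> Suc CARD('n)"
    and ne: "A \<noteq> {}" "B \<noteq> {}"
  shows "altsum (insert d A) (\<lambda>I. altsum B (\<lambda>J. altsum E (\<lambda>K. Omega I J K :: 'n aw)))
    = altsum A (\<lambda>I. altsum (insert d B) (\<lambda>J. altsum E (\<lambda>K. Omega I J K)))"
proof -
  interpret aw_family "C :: nat set \<Rightarrow> 'n aw" "Suc CARD('n)" by (rule aw_family_C)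
  have f: "finite A" "finite B" "d \<notin> A" "d \<notin> B" using finite_subset[OF A] finite_subset[OF B] A B by auto
  have D: "Omega (insert d I) J K = Omega I (insert d J) K + (Omega {d} J K - (Omega I {d} K :: 'n aw))" if "I \<subseteq> A" "J \<subseteq> B" "K \<subseteq> E" for I J K
    using cas_move_left[OF order_trans[OF that(1) A] order_trans[OF that(2) B] order_trans[OF that(3) E] le]
    by (simp add: Omega_cas algebra_simps)
  have "altsum A (\<lambda>I. altsum B (\<lambda>J. altsum E (\<lambda>K. Omega (insert d I) J K)))
    = altsum A (\<lambda>I. altsum B (\<lambda>J. altsum E (\<lambda>K. Omega I (insert d J) K + (Omega {d} J K - (Omega I {d} K :: 'n aw)))))"
    by (intro altsum_cong D)
  also have "\<dots> = altsum A (\<lambda>I. altsum B (\<lambda>J. altsum E (\<lambda>K. Omega I (insert d J) K)))"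
    by (simp only: altsum_add altsum_diff altsum_const altsum_zero f ne not_False_eq_True diff_0_right add_0_right)
  finally show ?thesis
    by (simp only: altsum_insert f not_False_eq_True altsum_diff)
qed

text \<open>The normal form has the two smallest points as first two blocks. The largest point of
  \<open>I2\<close> goes to \<open>I3\<close> while \<open>I2\<close> has at least two points;
  otherwise the largest point of \<open>I1\<close> goes to \<open>I2\<close>. The weight 2 of
  \<open>I1\<close> in the measure makes the latter move decrease it as well, and no block ever
  becomes empty.\<close>

lemma omega_normal:
  assumes S: "S \<subseteq> {1..CARD('n::finite)}"
    and I: "I1 \<noteq> {}" "I2 \<noteq> {}" "I3 \<noteq> {}" "I1 \<union> I2 \<union> I3 = S" "I1 \<prec> I2" "I2 \<prec> I3"
  shows "(omega S I1 I2 I3 :: 'n aw) = omega S {Min S} {Min (S - {Min S})} (S - {Min S} - {Min (S - {Min S})})"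
  using I
proof (induction "2 * card I1 + card I2" arbitrary: I1 I2 I3 rule: less_induct)
  case less
  note ne = less.prems(1-3) and un = less.prems(4)
  have fS: "finite S" using finite_subset[OF S] by simp
  have f: "finite I1" "finite I2" "finite I3" using un fS by auto
  have o12: "x < y" if "x \<in> I1" "y \<in> I2" for x y using less.prems(5) that by (auto simp: set_less_def)
  have o23: "x < y" if "x \<in> I2" "y \<in> I3" for x y using less.prems(6) that by (auto simp: set_less_def)
  obtain m where m: "m \<in> I2" using ne by blast
  have o13: "x < y" if "x \<in> I1" "y \<in> I3" for x y using o12[OF that(1) m] o23[OF m that(2)] by simp
  have sub: "x \<in> {1..<Suc CARD('n)}" if "x \<in> I1 \<union> I2 \<union> I3" for x using that un S by auto
  have dis: "I1 \<inter> I2 = {}" "(I1 \<union> I2) \<inter> I3 = {}" using o12 o23 o13 less_irrefl by blast+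
  consider "card I2 \<ge> 2" | "card I2 = 1" "card I1 \<ge> 2" | "card I2 = 1" "card I1 = 1"
  proof -
    have "card I1 \<noteq> 0" "card I2 \<noteq> 0" using f ne by simp_all
    then have "card I2 \<ge> 2 \<or> card I2 = 1 \<and> card I1 \<ge> 2 \<or> card I2 = 1 \<and> card I1 = 1" by linarith
    then show thesis using that by blast
  qed
  then show ?case
  proof cases
    case 1
    define d B where "d = Max I2" and "B = I2 - {d}"
    have d: "d \<in> I2" "\<And>x. x \<in> I2 \<Longrightarrow> x \<le> d"
      unfolding d_def using Max_in[OF f(2) ne(2)] Max_ge[OF f(2)] by blast+
    have I2: "I2 = insert d B" "d \<notin> B" "card I2 = Suc (card B)" using d(1) card.remove[OF f(2) d(1)] by (auto simp: B_def)
    have "card B \<noteq> 0" using 1 I2(3) by simp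
    then have B: "B \<noteq> {}" "finite B" using f(2) by (auto simp: B_def)
    have Bd: "x < d" if "x \<in> B" for x using d(2)[of x] that by (auto simp: B_def le_less)
    define l where "l = Min I2"
    have l: "l \<in> I2" "\<And>x. x \<in> I2 \<Longrightarrow> l \<le> x"
      unfolding l_def using Min_in[OF f(2) ne(2)] Min_le[OF f(2)] by blast+
    have mv: "altsum I1 (\<lambda>I. altsum (insert d B) (\<lambda>J. altsum I3 (\<lambda>K. Omega I J K :: 'n aw)))
      = altsum I1 (\<lambda>I. altsum B (\<lambda>J. altsum (insert d I3) (\<lambda>K. Omega I J K)))"
    proof (rule altsum_move_right)
      show "I1 \<subseteq> {1..<l}" by (rule subsetI) (use o12[OF _ l(1)] sub in auto)
      show "B \<subseteq> {l..<d}"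
      proof
        fix x assume x: "x \<in> B"
        then show "x \<in> {l..<d}" using Bd[OF x] l(2)[of x] by (simp add: B_def)
      qed
      show "I3 \<subseteq> {Suc d..<Suc CARD('n)}" by (rule subsetI) (use o23[OF d(1)] sub in \<open>auto simp: Suc_le_eq\<close>)
      show "1 \<le> l" "l \<le> d" "d < Suc CARD('n)" using sub[of l] sub[of d] l d by auto
    qed (use B ne in auto)
    have e: "(omega S I1 B (insert d I3) :: 'n aw) = (- 1) ^ card S * altsum I1 (\<lambda>I. altsum B (\<lambda>J. altsum (insert d I3) (\<lambda>K. Omega I J K)))"
      by (rule omega_altsum[OF fS]) (use un I2(1,2) dis in blast)+
    have "(omega S I1 I2 I3 :: 'n aw) = omega S I1 B (insert d I3)"
      by (simp only: omega_altsum[OF fS un dis] e mv[folded I2(1)])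
    also have "\<dots> = omega S {Min S} {Min (S - {Min S})} (S - {Min S} - {Min (S - {Min S})})"
    proof (rule less.hyps)
      show "2 * card I1 + card B < 2 * card I1 + card I2" using I2(3) by simp
      show "I1 \<union> B \<union> insert d I3 = S" using un I2(1) by blast
      show "I1 \<prec> B" unfolding set_less_def using o12 by (simp add: B_def)
      show "B \<prec> insert d I3" unfolding set_less_def using Bd o23 by (simp add: B_def)
    qed (use ne B in simp_all)
    finally show ?thesis .
  next
    case 2
    define d A where "d = Max I1" and "A = I1 - {d}"
    have d: "d \<in> I1" "\<And>x. x \<in> I1 \<Longrightarrow> x \<le> d"
      unfolding d_def using Max_in[OF f(1) ne(1)] Max_ge[OF f(1)] by blast+
    have I1: "I1 = insert d A" "d \<notin> A" "card I1 = Suc (card A)" using d(1) card.remove[OF f(1) d(1)] by (auto simp: A_def)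
    have "card A \<noteq> 0" using 2(2) I1(3) by simp
    then have A: "A \<noteq> {}" "finite A" using f(1) by (auto simp: A_def)
    have Ad: "x < d" if "x \<in> A" for x using d(2)[of x] that by (auto simp: A_def le_less)
    have d2: "d \<notin> I2" using o12[OF d(1)] by auto
    define u where "u = Suc (Max I2)"
    have u: "Max I2 \<in> I2" "\<And>x. x \<in> I2 \<Longrightarrow> x < u"
      unfolding u_def less_Suc_eq_le using Max_in[OF f(2) ne(2)] Max_ge[OF f(2)] by blast+
    have mv: "altsum (insert d A) (\<lambda>I. altsum I2 (\<lambda>J. altsum I3 (\<lambda>K. Omega I J K :: 'n aw)))
      = altsum A (\<lambda>I. altsum (insert d I2) (\<lambda>J. altsum I3 (\<lambda>K. Omega I J K)))"
    proof (rule altsum_move_left)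
      show "A \<subseteq> {1..<d}"
      proof
        fix x assume x: "x \<in> A"
        then show "x \<in> {1..<d}" using Ad[OF x] sub[of x] by (simp add: A_def)
      qed
      show "I2 \<subseteq> {Suc d..<u}" by (rule subsetI) (use o12[OF d(1)] u(2) in \<open>auto simp: Suc_le_eq\<close>)
      show "I3 \<subseteq> {u..<Suc CARD('n)}" by (rule subsetI) (use o23[OF u(1)] sub in \<open>auto simp: u_def Suc_le_eq\<close>)
      show "1 \<le> d" "Suc d \<le> u" "u \<le> Suc CARD('n)" using sub[of d] sub[of "Max I2"] o12[OF d(1) u(1)] u(1) d by (auto simp: u_def)
    qed (use A ne in auto)
    have e: "(omega S A (insert d I2) I3 :: 'n aw) = (- 1) ^ card S * altsum A (\<lambda>I. altsum (insert d I2) (\<lambda>J. altsum I3 (\<lambda>K. Omega I J K)))"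
      by (rule omega_altsum[OF fS]) (use un I1(1,2) dis in blast)+
    have "(omega S I1 I2 I3 :: 'n aw) = omega S A (insert d I2) I3"
      by (simp only: omega_altsum[OF fS un dis] e mv[folded I1(1)])
    also have "\<dots> = omega S {Min S} {Min (S - {Min S})} (S - {Min S} - {Min (S - {Min S})})"
    proof (rule less.hyps)
      show "2 * card A + card (insert d I2) < 2 * card I1 + card I2" using I1(3) d2 f by simp
      show "A \<union> insert d I2 \<union> I3 = S" using un I1(1) by blast
      show "A \<prec> insert d I2" unfolding set_less_def using Ad o12 by (simp add: A_def)
      show "insert d I2 \<prec> I3" unfolding set_less_def using o23 o13[OF d(1)] by simp
    qed (use ne A in simp_all)
    finally show ?thesis .
  next
    case 3
    then obtain a b where ab: "I1 = {a}" "I2 = {b}" by (metis card_1_singletonE)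
    have S': "S - {a} = insert b I3" "S = insert a (insert b I3)" "S - {a} - {b} = I3" using un ab dis by auto
    have lt: "a < b" "\<And>y. y \<in> I3 \<Longrightarrow> a < y" "\<And>y. y \<in> I3 \<Longrightarrow> b < y" using o12 o13 o23 ab by blast+
    have "Min S = a"
    proof (rule Min_eqI[OF fS])
      show "a \<le> y" if "y \<in> S" for y using that lt unfolding S'(2) by (auto simp: le_less)
      show "a \<in> S" unfolding S'(2) by simp
    qed
    moreover have "Min (S - {a}) = b"
    proof (rule Min_eqI)
      show "finite (S - {a})" using fS by simp
      show "b \<le> y" if "y \<in> S - {a}" for y using that lt unfolding S'(1) by (auto simp: le_less)
      show "b \<in> S - {a}" unfolding S'(1) by simp
    qed
    ultimately show ?thesis using ab S'(3) by simp
  qed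
qed

theorem proposition5p4:
  fixes S I1 I2 I3 J1 J2 J3 :: "nat set"
  assumes "CARD('n::finite) \<ge> 3"
    and "S \<subseteq> {1..CARD('n)}" and "card S \<ge> 3"
    and "I1 \<noteq> {}" "I2 \<noteq> {}" "I3 \<noteq> {}" "I1 \<union> I2 \<union> I3 = S" "I1 \<prec> I2" "I2 \<prec> I3"
    and "J1 \<noteq> {}" "J2 \<noteq> {}" "J3 \<noteq> {}" "J1 \<union> J2 \<union> J3 = S" "J1 \<prec> J2" "J2 \<prec> J3"
  shows "(omega S I1 I2 I3 :: 'n aw) = omega S J1 J2 J3"
  using omega_normal[OF assms(2) assms(4-9)] omega_normal[OF assms(2) assms(10-15)] by simp

end
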